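(* Let $k$ be an algebraically closed field of characteristic zero and let $n\ge 1$ be an integer. Let $\pi:(\mathbf{P}^1_k)^n\to\mathbf{P}^n_k$ be the map given by the elementary homogeneous symmetric polynomials, let $D_n\subseteq\mathbf{P}^n_k$ be the discriminant scheme of degree $n$ binary forms, and let $X_n=\pi^{-1}(D_n)$ be the scheme-theoretic inverse image, with the $\Sigma_n$-action induced from the action of $\Sigma_n$ on $(\mathbf{P}^1_k)^n$. Then the induced map $\tilde{\pi}:X_n\to D_n$ is a quotient map for the $\Sigma_n$-action on $X_n$; hence there is an isomorphism $$X_n/\Sigma_n\cong D_n.$$
   Context: Elementary homogeneous symmetric polynomials: for independent variables $x_{01},x_{11},\dots,x_{0n},x_{1n},X,Y$, the polynomials $p_0(x_{ij}),\dots,p_n(x_{ij})$ are defined by $$\prod_{i=1}^n (x_{0i}X-x_{1i}Y)=p_0X^n-p_1X^{n-1}Y+\cdots+(-1)^np_nY^n.$$ Map $\pi$: $\pi:(\mathbf{P}^1_k)^n\to\mathbf{P}^n_k$ is the morphism given on closed points by $\pi((x_{01}:x_{11}),\dots,(x_{0n}:x_{1n}))=(p_0(x_{ij}):\cdots:p_n(x_{ij}))$. The symmetric group $\Sigma_n$ on $n$ letters acts on $(\mathbf{P}^1_k)^n$ by permuting the factors, and $\pi$ is invariant, so $X_n$ inherits an action. Resultant: for $f=v_0Z^n+\cdots+v_n$ and $g=w_0Z^m+\cdots+w_m$, $\mathrm{Res}(f,g)$ is the determinant of the $(n+m)\times(n+m)$ Sylvester matrix whose row $r$, for $1\le r\le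 m$, has entry $v_{c-r}$ in column $c$, and whose row $m+s$, for $1\le s\le n$, has entry $w_{c-s}$ in column $c$ (entries with index out of range are $0$). Discriminant scheme: $D_n$ is the closed subscheme of $\mathbf{P}^n_k$ (homogeneous coordinates $p_0,\dots,p_n$) defined by the homogeneous polynomial $\Delta_n=\frac{1}{p_0}\mathrm{Res}(f_p,f_p')$, where $f_p(Z)=p_0Z^n+p_1Z^{n-1}+\cdots+p_n$ and $f_p'$ is its derivative with respect to $Z$ (viewed as a polynomial of degree $n-1$). Quotients: for a finite group $G$ acting on a projective $k$-scheme $Y=\mathrm{Proj}(S)$ through a graded linear action on its homogeneous coordinate ring $S$, the quotient is $Y/G=\mathrm{Proj}(S^G)$ with quotient map $Y\to Y/G$ induced by $S^G\subseteq S$; equivalently, it is the topological orbit space with the sheaf of $G$-invariant functions. The latter description defines the quotient of a $G$-stable closed subscheme of $Y$. A $G$-invariant morphism is called a quotient map if it identifies its target with the quotient of its source by $G$. *)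

theory Defs
  imports
    "HOL-Library.Poly_Mapping"
    "HOL-Library.Product_Lexorder"
    "HOL-Computational_Algebra.Computational_Algebra"
    "HOL-Algebra.QuotRing"
    "HOL-Algebra.Sym_Groups"
    "HOL-Analysis.Abstract_Topology"
    "Subresultants.Resultant_Prelim"
begin

section \<open>Ringed spaces over a field\<close>

text \<open>
  A \<open>k\<close>-ringed space in the usual presentation: a topological space with a ring of sections
  over every open set, restriction maps, and the structure maps from \<open>k\<close>.
  Only the values at open sets are meaningful.
\<close>

record ('k, 'p, 's) rspace =
  rtop :: "'p topology"
  rsec :: "'p set \<Rightarrow> 's ring"
  rres :: "'p set \<Rightarrow> 'p set \<Rightarrow> 's \<Rightarrow> 's"
  rscal :: "'p set \<Rightarrow> 'k \<Rightarrow> 's"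

text \<open>
  A map from a space with points \<open>'p\<close> and sections \<open>'s\<close> to one with points \<open>'q\<close> and
  sections \<open>'t\<close>: the point map, and for \<open>V\<close> open in the target the comorphism on
  sections over \<open>V\<close>.
\<close>

record ('p, 'q, 's, 't) rmap =
  rpt :: "'p \<Rightarrow> 'q"
  rpull :: "'q set \<Rightarrow> 't \<Rightarrow> 's"

definition rspace_iso ::
  "('k, 'p, 's) rspace \<Rightarrow> ('k, 'q, 't) rspace \<Rightarrow> ('p, 'q, 's, 't) rmap \<Rightarrow> bool" where
  "rspace_iso X Y f \<longleftrightarrow>
     homeomorphic_map (rtop X) (rtop Y) (rpt f) \<and>
     (\<forall>V. openin (rtop Y) V \<longrightarrow>
        (let U = {p \<in> topspace (rtop X). rpt f p \<in> V} in
           rpull f V \<in> ring_iso (rsec Y V) (rsec X U) \<and>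
           (\<forall>c. rpull f V (rscal Y V c) = rscal X U c) \<and>
           (\<forall>V' s. openin (rtop Y) V' \<and> V' \<subseteq> V \<and> s \<in> carrier (rsec Y V) \<longrightarrow>
              rpull f V' (rres Y V V' s)
                = rres X U {p \<in> topspace (rtop X). rpt f p \<in> V'} (rpull f V s))))"

definition rspace_isomorphic :: "('k, 'p, 's) rspace \<Rightarrow> ('k, 'q, 't) rspace \<Rightarrow> bool" where
  "rspace_isomorphic X Y \<longleftrightarrow> (\<exists>f. rspace_iso X Y f)"


section \<open>Locally ringed spaces given by stalks\<close>

text \<open>
  Locally ringed spaces are presented by their stalks: a section over \<open>U\<close> is identified
  with the function sending each point of \<open>U\<close> to its germ there (extensional outside \<open>U\<close>),
  and \<open>sects X U\<close> tells which of these functions are sections.  Operations on sections are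
  pointwise.
\<close>

record ('k, 'p, 's) lrspace =
  undertop :: "'p topology"
  stalk :: "'p \<Rightarrow> 's ring"
  scal :: "'p \<Rightarrow> 'k \<Rightarrow> 's"
  sects :: "'p set \<Rightarrow> ('p \<Rightarrow> 's) set"

abbreviation points :: "('k, 'p, 's) lrspace \<Rightarrow> 'p set" where
  "points X \<equiv> topspace (undertop X)"

definition section_ring :: "('k, 'p, 's) lrspace \<Rightarrow> 'p set \<Rightarrow> ('p \<Rightarrow> 's) ring" where
  "section_ring X U =
     \<lparr>carrier = sects X U,
      mult = (\<lambda>s t. \<lambda>p\<in>U. s p \<otimes>\<^bsub>stalk X p\<^esub> t p),
      one = (\<lambda>p\<in>U. \<one>\<^bsub>stalk X p\<^esub>),
      zero = (\<lambda>p\<in>U. \<zero>\<^bsub>stalk X p\<^esub>),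
      add = (\<lambda>s t. \<lambda>p\<in>U. s p \<oplus>\<^bsub>stalk X p\<^esub> t p)\<rparr>"

definition ringed_space_of :: "('k, 'p, 's) lrspace \<Rightarrow> ('k, 'p, 'p \<Rightarrow> 's) rspace" where
  "ringed_space_of X =
     \<lparr>rtop = undertop X,
      rsec = section_ring X,
      rres = (\<lambda>U V s. restrict s V),
      rscal = (\<lambda>U c. \<lambda>p\<in>U. scal X p c)\<rparr>"

text \<open>
  A map is a point map \<open>pt f\<close> with, for every point \<open>p\<close> of the source, a map \<open>germ f p\<close>
  from the stalk of the target at \<open>pt f p\<close> to the stalk of the source at \<open>p\<close>.
\<close>

record ('p, 'q, 's, 't) lrmap =
  pt :: "'p \<Rightarrow> 'q"
  germ :: "'p \<Rightarrow> 't \<Rightarrow> 's"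

definition preim :: "('k, 'p, 's) lrspace \<Rightarrow> ('p, 'q, 's, 't) lrmap \<Rightarrow> 'q set \<Rightarrow> 'p set" where
  "preim X f V = {p \<in> points X. pt f p \<in> V}"

definition pull ::
  "('k, 'p, 's) lrspace \<Rightarrow> ('p, 'q, 's, 't) lrmap \<Rightarrow> 'q set \<Rightarrow> ('q \<Rightarrow> 't) \<Rightarrow> 'p \<Rightarrow> 's" where
  "pull X f V s = (\<lambda>p\<in>preim X f V. germ f p (s (pt f p)))"

definition lrs_morphism ::
  "('k, 'p, 's) lrspace \<Rightarrow> ('k, 'q, 't) lrspace \<Rightarrow> ('p, 'q, 's, 't) lrmap \<Rightarrow> bool" where
  "lrs_morphism X Y f \<longleftrightarrow>
     continuous_map (undertop X) (undertop Y) (pt f) \<and>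
     (\<forall>p \<in> points X.
        germ f p \<in> Ring.ring_hom (stalk Y (pt f p)) (stalk X p) \<and>
        (\<forall>z \<in> carrier (stalk Y (pt f p)).
           germ f p z \<in> Units (stalk X p) \<longrightarrow> z \<in> Units (stalk Y (pt f p))) \<and>
        (\<forall>c. germ f p (scal Y (pt f p) c) = scal X p c)) \<and>
     (\<forall>V s. openin (undertop Y) V \<and> s \<in> sects Y V \<longrightarrow> pull X f V s \<in> sects X (preim X f V))"


section \<open>Closed subspaces\<close>

text \<open>
  An ideal sheaf on \<open>X\<close> is given by its stalks \<open>J p\<close>.  The closed subspace it defines has the
  support of the quotient sheaf as its space, with the restriction of the quotient sheaf: its
  sections are the functions to the quotient stalks that locally come from sections of \<open>X\<close>.
\<close>

definition closed_subspace ::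
  "('k, 'p, 's) lrspace \<Rightarrow> ('p \<Rightarrow> 's set) \<Rightarrow> ('k, 'p, 's set) lrspace" where
  "closed_subspace X J =
     \<lparr>undertop = subtopology (undertop X) {p \<in> points X. J p \<noteq> carrier (stalk X p)},
      stalk = (\<lambda>p. stalk X p Quot J p),
      scal = (\<lambda>p c. J p +>\<^bsub>stalk X p\<^esub> scal X p c),
      sects = (\<lambda>V. {s \<in> extensional V.
        \<forall>p\<in>V. \<exists>U t. openin (undertop X) U \<and> p \<in> U \<and> t \<in> sects X U \<and>
          (\<forall>q \<in> U \<inter> V. s q = J q +>\<^bsub>stalk X q\<^esub> t q)})\<rparr>"

text \<open>
  The inverse image ideal sheaf, generated by the pullback of \<open>J\<close> along \<open>f\<close>.  The closed
  subspace it defines is the scheme-theoretic inverse image of the one defined by \<open>J\<close>.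
\<close>

definition inverse_image_ideal ::
  "('k, 'p, 's) lrspace \<Rightarrow> ('p, 'q, 's, 't) lrmap \<Rightarrow> ('q \<Rightarrow> 't set) \<Rightarrow> 'p \<Rightarrow> 's set" where
  "inverse_image_ideal X f J p = Idl\<^bsub>stalk X p\<^esub> (germ f p ` J (pt f p))"

text \<open>
  The map induced by \<open>f\<close> from the closed subspace of \<open>X\<close> with ideal \<open>I\<close> to a closed subspace
  of the target: the class of \<open>z\<close> goes to the class of \<open>germ f p z\<close> modulo \<open>I p\<close>.
\<close>

definition induced_map ::
  "('k, 'p, 's) lrspace \<Rightarrow> ('p \<Rightarrow> 's set) \<Rightarrow> ('p, 'q, 's, 't) lrmap
     \<Rightarrow> ('p, 'q, 's set, 't set) lrmap" where
  "induced_map X I f =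
     \<lparr>pt = pt f, germ = (\<lambda>p C. I p <+>\<^bsub>stalk X p\<^esub> germ f p ` C)\<rparr>"


section \<open>Group actions and quotients\<close>

definition acts_on ::
  "'g monoid \<Rightarrow> ('g \<Rightarrow> ('p, 'p, 's, 's) lrmap) \<Rightarrow> ('k, 'p, 's) lrspace \<Rightarrow> bool" where
  "acts_on G \<rho> X \<longleftrightarrow>
     group G \<and>
     (\<forall>g \<in> carrier G. lrs_morphism X X (\<rho> g)) \<and>
     (\<forall>p \<in> points X.
        pt (\<rho> \<one>\<^bsub>G\<^esub>) p = p \<and> (\<forall>z \<in> carrier (stalk X p). germ (\<rho> \<one>\<^bsub>G\<^esub>) p z = z)) \<and>
     (\<forall>g \<in> carrier G. \<forall>h \<in> carrier G. \<forall>p \<in> points X.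
        pt (\<rho> (g \<otimes>\<^bsub>G\<^esub> h)) p = pt (\<rho> g) (pt (\<rho> h) p) \<and>
        (\<forall>z \<in> carrier (stalk X (pt (\<rho> (g \<otimes>\<^bsub>G\<^esub> h)) p)).
           germ (\<rho> (g \<otimes>\<^bsub>G\<^esub> h)) p z = germ (\<rho> h) p (germ (\<rho> g) (pt (\<rho> h) p) z)))"

definition invariant_morphism ::
  "'g monoid \<Rightarrow> ('g \<Rightarrow> ('p, 'p, 's, 's) lrmap) \<Rightarrow> ('k, 'p, 's) lrspace
     \<Rightarrow> ('k, 'q, 't) lrspace \<Rightarrow> ('p, 'q, 's, 't) lrmap \<Rightarrow> bool" where
  "invariant_morphism G \<rho> X Y f \<longleftrightarrow>
     lrs_morphism X Y f \<and>
     (\<forall>g \<in> carrier G. \<forall>p \<in> points X.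
        pt f (pt (\<rho> g) p) = pt f p \<and>
        (\<forall>z \<in> carrier (stalk Y (pt f p)). germ (\<rho> g) p (germ f (pt (\<rho> g) p) z) = germ f p z))"

definition orbit_of ::
  "'g monoid \<Rightarrow> ('g \<Rightarrow> ('p, 'p, 's, 's) lrmap) \<Rightarrow> 'p \<Rightarrow> 'p set" where
  "orbit_of G \<rho> p = (\<lambda>g. pt (\<rho> g) p) ` carrier G"

text \<open>
  The topological orbit space with the sheaf of invariant functions.  A set of orbits is open
  if its union is, and that union is its inverse image under the projection.
\<close>

definition orbit_topology ::
  "'g monoid \<Rightarrow> ('g \<Rightarrow> ('p, 'p, 's, 's) lrmap) \<Rightarrow> ('k, 'p, 's) lrspace \<Rightarrow> 'p set topology" where
  "orbit_topology G \<rho> X =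
     topology (\<lambda>U. U \<subseteq> orbit_of G \<rho> ` points X \<and> openin (undertop X) (\<Union>U))"

definition quotient_space ::
  "'g monoid \<Rightarrow> ('g \<Rightarrow> ('p, 'p, 's, 's) lrmap) \<Rightarrow> ('k, 'p, 's) lrspace
     \<Rightarrow> ('k, 'p set, 'p \<Rightarrow> 's) rspace" where
  "quotient_space G \<rho> X =
     \<lparr>rtop = orbit_topology G \<rho> X,
      rsec = (\<lambda>U. (section_ring X (\<Union>U))
        \<lparr>carrier := {s \<in> sects X (\<Union>U). \<forall>g \<in> carrier G. pull X (\<rho> g) (\<Union>U) s = s}\<rparr>),
      rres = (\<lambda>U V s. restrict s (\<Union>V)),
      rscal = (\<lambda>U c. \<lambda>p\<in>\<Union>U. scal X p c)\<rparr>"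

text \<open>The map from the quotient to \<open>Y\<close> through which an invariant morphism \<open>f\<close> factors.\<close>

definition descended_map ::
  "('k, 'p, 's) lrspace \<Rightarrow> ('p, 'q, 's, 't) lrmap \<Rightarrow> ('p set, 'q, 'p \<Rightarrow> 's, 'q \<Rightarrow> 't) rmap" where
  "descended_map X f = \<lparr>rpt = (\<lambda>orb. the_elem (pt f ` orb)), rpull = pull X f\<rparr>"

definition is_quotient_morphism ::
  "'g monoid \<Rightarrow> ('g \<Rightarrow> ('p, 'p, 's, 's) lrmap) \<Rightarrow> ('k, 'p, 's) lrspace
     \<Rightarrow> ('k, 'q, 't) lrspace \<Rightarrow> ('p, 'q, 's, 't) lrmap \<Rightarrow> bool" where
  "is_quotient_morphism G \<rho> X Y f \<longleftrightarrow>
     acts_on G \<rho> X \<and> invariant_morphism G \<rho> X Y f \<and>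
     rspace_iso (quotient_space G \<rho> X) (ringed_space_of Y) (descended_map X f)"


section \<open>Products of projective spaces\<close>

text \<open>
  The variable \<open>(i, j)\<close> is the \<open>j\<close>-th homogeneous coordinate on the \<open>i\<close>-th factor.  The
  lexicographic order on the variables plays no role in the mathematics: it makes the
  polynomial ring an instance of \<open>idom\<close>.
\<close>

type_synonym 'k mpoly = "((nat \<times> nat) \<Rightarrow>\<^sub>0 nat) \<Rightarrow>\<^sub>0 'k"

definition Var :: "nat \<Rightarrow> nat \<Rightarrow> 'k::field mpoly" where
  "Var i j = Poly_Mapping.single (Poly_Mapping.single (i, j) 1) 1"

definition Cst :: "'k::field \<Rightarrow> 'k mpoly" where
  "Cst c = Poly_Mapping.single 0 c"

definition psubst :: "(nat \<times> nat \<Rightarrow> 'k mpoly) \<Rightarrow> 'k::field mpoly \<Rightarrow> 'k mpoly" where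
  "psubst g F = (\<Sum>m\<in>Poly_Mapping.keys F. Cst (Poly_Mapping.lookup F m) * (\<Prod>v\<in>Poly_Mapping.keys m. g v ^ Poly_Mapping.lookup m v))"

definition multideg :: "((nat \<times> nat) \<Rightarrow>\<^sub>0 nat) \<Rightarrow> nat \<Rightarrow> nat" where
  "multideg m i = (\<Sum>v \<in> {v \<in> Poly_Mapping.keys m. fst v = i}. Poly_Mapping.lookup m v)"

definition multihom_part :: "(nat \<Rightarrow> nat) \<Rightarrow> 'k::field mpoly \<Rightarrow> 'k mpoly" where
  "multihom_part d F =
     (\<Sum>m \<in> {m \<in> Poly_Mapping.keys F. multideg m = d}. Poly_Mapping.single m (Poly_Mapping.lookup F m))"

text \<open>
  Throughout, \<open>I\<close> is the set of factors and \<open>r i\<close> the dimension of the \<open>i\<close>-th one.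
\<close>

definition coords :: "nat set \<Rightarrow> (nat \<Rightarrow> nat) \<Rightarrow> (nat \<times> nat) set" where
  "coords I r = {(i, j). i \<in> I \<and> j \<le> r i}"

definition polys :: "nat set \<Rightarrow> (nat \<Rightarrow> nat) \<Rightarrow> 'k::field mpoly set" where
  "polys I r = {F. \<forall>m \<in> Poly_Mapping.keys F. Poly_Mapping.keys m \<subseteq> coords I r}"

definition coord_ring :: "nat set \<Rightarrow> (nat \<Rightarrow> nat) \<Rightarrow> 'k::field mpoly ring" where
  "coord_ring I r = \<lparr>carrier = polys I r, mult = (*), one = 1, zero = 0, add = (+)\<rparr>"

definition multiforms :: "nat set \<Rightarrow> (nat \<Rightarrow> nat) \<Rightarrow> (nat \<Rightarrow> nat) \<Rightarrow> 'k::field mpoly set" where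
  "multiforms I r d = {F \<in> polys I r. \<forall>m \<in> Poly_Mapping.keys F. multideg m = d}"

text \<open>
  Points of the multigraded Proj: the multihomogeneous prime ideals which, for every factor,
  miss at least one coordinate of that factor.
\<close>

definition multiproj_points :: "nat set \<Rightarrow> (nat \<Rightarrow> nat) \<Rightarrow> 'k::field mpoly set set" where
  "multiproj_points I r =
     {P. primeideal P (coord_ring I r) \<and>
         (\<forall>F \<in> P. \<forall>d. multihom_part d F \<in> P) \<and>
         (\<forall>i \<in> I. \<exists>j \<le> r i. Var i j \<notin> P)}"

definition basic_open :: "nat set \<Rightarrow> (nat \<Rightarrow> nat) \<Rightarrow> 'k::field mpoly \<Rightarrow> 'k mpoly set set" where
  "basic_open I r F = {P \<in> multiproj_points I r. F \<notin> P}"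

definition degree_zero_fractions ::
  "nat set \<Rightarrow> (nat \<Rightarrow> nat) \<Rightarrow> 'k::field mpoly set \<Rightarrow> 'k mpoly fract set" where
  "degree_zero_fractions I r P =
     {Fract a f | a f d. a \<in> multiforms I r d \<and> f \<in> multiforms I r d \<and> f \<notin> P}"

text \<open>
  As the polynomial ring is a domain, every local ring is a subring of its fraction field.
  The basic open sets form a base, so a section is a function which near each point \<open>P\<close> of
  its domain is \<open>a / f\<close> on the points of the domain where a suitable \<open>f\<close>, not vanishing
  at \<open>P\<close>, does not vanish.
\<close>

definition multiproj ::
  "nat set \<Rightarrow> (nat \<Rightarrow> nat) \<Rightarrow> ('k::field, 'k mpoly set, 'k mpoly fract) lrspace" where
  "multiproj I r =
     \<lparr>undertop = topology_generated_by {basic_open I r F | F d. F \<in> multiforms I r d},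
      stalk = (\<lambda>P. \<lparr>carrier = degree_zero_fractions I r P,
                    mult = (*), one = 1, zero = 0, add = (+)\<rparr>),
      scal = (\<lambda>P c. Fract (Cst c) 1),
      sects = (\<lambda>U. {s \<in> extensional U.
        \<forall>P\<in>U. \<exists>a f d. a \<in> multiforms I r d \<and> f \<in> multiforms I r d \<and> f \<notin> P \<and>
          (\<forall>Q \<in> U \<inter> basic_open I r f. s Q = Fract a f)})\<rparr>"

text \<open>
  The map from \<open>multiproj I r\<close> to \<open>multiproj I' r'\<close> given by \<open>\<phi>\<close>, a homomorphism from the
  coordinate ring of the latter to that of the former: \<open>P\<close> goes to its contraction, and
  \<open>a / f\<close> to \<open>\<phi> a / \<phi> f\<close>.
\<close>

definition multiproj_map ::
  "nat set \<Rightarrow> (nat \<Rightarrow> nat) \<Rightarrow> ('k::field mpoly \<Rightarrow> 'k mpoly)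
     \<Rightarrow> ('k mpoly set, 'k mpoly set, 'k mpoly fract, 'k mpoly fract) lrmap" where
  "multiproj_map I' r' \<phi> =
     \<lparr>pt = (\<lambda>P. {F \<in> polys I' r'. \<phi> F \<in> P}),
      germ = (\<lambda>P z. THE w. \<exists>a f d. a \<in> multiforms I' r' d \<and> f \<in> multiforms I' r' d \<and>
                \<phi> f \<notin> P \<and> z = Fract a f \<and> w = Fract (\<phi> a) (\<phi> f))\<rparr>"

text \<open>The stalks of the ideal sheaf on \<open>multiproj I r\<close> attached to a multihomogeneous ideal.\<close>

definition ideal_sheaf ::
  "nat set \<Rightarrow> (nat \<Rightarrow> nat) \<Rightarrow> 'k::field mpoly set \<Rightarrow> 'k mpoly set \<Rightarrow> 'k mpoly fract set" where
  "ideal_sheaf I r A P =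
     {Fract a f | a f d. a \<in> A \<and> a \<in> multiforms I r d \<and> f \<in> multiforms I r d \<and> f \<notin> P}"


section \<open>The discriminant scheme and its inverse image\<close>

text \<open>Projective space is the product with a single factor, with coordinates \<open>Var 1 j\<close>.\<close>

definition projective_space ::
  "nat \<Rightarrow> ('k::field, 'k mpoly set, 'k mpoly fract) lrspace" where
  "projective_space n = multiproj {1} (\<lambda>_. n)"

definition P1_power :: "nat \<Rightarrow> ('k::field, 'k mpoly set, 'k mpoly fract) lrspace" where
  "P1_power n = multiproj {1..n} (\<lambda>_. 1)"

text \<open>
  In \<open>split_form\<close> the outer polynomial variable is \<open>X\<close> and the inner one \<open>Y\<close>; the coefficient
  of \<open>X ^ (n - j) * Y ^ j\<close> is \<open>(-1) ^ j * elem_hom n j\<close>.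
\<close>

definition split_form :: "nat \<Rightarrow> 'k::field mpoly poly poly" where
  "split_form n = (\<Prod>i=1..n. monom [:Var i 0:] 1 - [:monom (Var i 1) 1:])"

definition elem_hom :: "nat \<Rightarrow> nat \<Rightarrow> 'k::field mpoly" where
  "elem_hom n j = (-1) ^ j * coeff (coeff (split_form n) (n - j)) j"

definition pi_map ::
  "nat \<Rightarrow> ('k::field mpoly set, 'k mpoly set, 'k mpoly fract, 'k mpoly fract) lrmap" where
  "pi_map n = multiproj_map {1} (\<lambda>_. n) (psubst (\<lambda>(_, j). elem_hom n j))"

text \<open>
  The action on points is \<open>(\<sigma> x)\<^sub>i = x\<^sub>j\<close> with \<open>j = inv \<sigma> i\<close>, which makes it a left action.
\<close>

definition permute_factors ::
  "nat \<Rightarrow> (nat \<Rightarrow> nat)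
     \<Rightarrow> ('k::field mpoly set, 'k mpoly set, 'k mpoly fract, 'k mpoly fract) lrmap" where
  "permute_factors n \<sigma> =
     multiproj_map {1..n} (\<lambda>_. 1) (psubst (\<lambda>(i, j). Var (Hilbert_Choice.inv \<sigma> i) j))"

definition generic_poly :: "nat \<Rightarrow> 'k::field mpoly poly" where
  "generic_poly n = (\<Sum>j\<le>n. monom (Var 1 j) (n - j))"

text \<open>
  The Sylvester matrix is formed with the formal degrees \<open>n\<close> and \<open>n - 1\<close>.
\<close>

definition disc_resultant :: "nat \<Rightarrow> 'k::field mpoly" where
  "disc_resultant n =
     det (sylvester_mat_sub n (n - 1) (generic_poly n) (pderiv (generic_poly n)))"

definition disc_poly :: "nat \<Rightarrow> 'k::field mpoly" where
  "disc_poly n = (THE F. Var 1 0 * F = disc_resultant n)"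

definition disc_ideal :: "nat \<Rightarrow> 'k::field mpoly set \<Rightarrow> 'k mpoly fract set" where
  "disc_ideal n = ideal_sheaf {1} (\<lambda>_. n) (Idl\<^bsub>coord_ring {1} (\<lambda>_. n)\<^esub> {disc_poly n})"

definition disc_scheme ::
  "nat \<Rightarrow> ('k::field, 'k mpoly set, 'k mpoly fract set) lrspace" where
  "disc_scheme n = closed_subspace (projective_space n) (disc_ideal n)"

definition X_ideal :: "nat \<Rightarrow> 'k::field mpoly set \<Rightarrow> 'k mpoly fract set" where
  "X_ideal n = inverse_image_ideal (P1_power n) (pi_map n) (disc_ideal n)"

definition X_scheme ::
  "nat \<Rightarrow> ('k::field, 'k mpoly set, 'k mpoly fract set) lrspace" where
  "X_scheme n = closed_subspace (P1_power n) (X_ideal n)"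

definition pi_tilde ::
  "nat \<Rightarrow> ('k::field mpoly set, 'k mpoly set, 'k mpoly fract set, 'k mpoly fract set) lrmap" where
  "pi_tilde n = induced_map (P1_power n) (X_ideal n) (pi_map n)"

definition X_action ::
  "nat \<Rightarrow> (nat \<Rightarrow> nat)
     \<Rightarrow> ('k::field mpoly set, 'k mpoly set, 'k mpoly fract set, 'k mpoly fract set) lrmap" where
  "X_action n \<sigma> = induced_map (P1_power n) (X_ideal n) (permute_factors n \<sigma>)"


section \<open>Consistency of the definitions\<close>

lemma mpoly_as_sum:
  fixes F :: "'k::field mpoly"
  shows "F = (\<Sum>m\<in>Poly_Mapping.keys F. Poly_Mapping.single m (Poly_Mapping.lookup F m))"
  by (rule poly_mapping_eqI)
    (auto simp: lookup_sum lookup_single when_def not_in_keys_iff_lookup_eq_zero)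

lemma mpoly_sum_induct [case_names single add]:
  fixes F :: "'k::field mpoly"
  assumes "\<And>m c. P (Poly_Mapping.single m c)" "\<And>F G. P F \<Longrightarrow> P G \<Longrightarrow> P (F + G)"
  shows "P F"
proof -
  have "P (\<Sum>m\<in>A. Poly_Mapping.single m (Poly_Mapping.lookup F m))" if "finite A" for A
    using that
  proof (induction A)
    case empty
    show ?case using assms(1)[of 0 0] by simp
  qed (simp add: assms)
  from this[of "Poly_Mapping.keys F"] show ?thesis
    by (simp add: mpoly_as_sum[symmetric])
qed

lemma Cst_add: "Cst (a + b) = Cst a + Cst b"
  and Cst_mult: "Cst (a * b) = Cst a * Cst b"
  and Cst_0: "Cst 0 = 0" and Cst_1: "Cst 1 = 1"
  by (simp_all add: Cst_def single_add mult_single)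

lemma psubst_superset:
  assumes "finite A" "Poly_Mapping.keys F \<subseteq> A"
  shows "psubst g F = (\<Sum>m\<in>A. Cst (Poly_Mapping.lookup F m) *
           (\<Prod>v\<in>Poly_Mapping.keys m. g v ^ Poly_Mapping.lookup m v))"
  unfolding psubst_def
  by (rule sum.mono_neutral_left) (use assms in \<open>auto simp: not_in_keys_iff_lookup_eq_zero Cst_0\<close>)

lemma psubst_add: "psubst g (F + G) = psubst g F + psubst g G"
proof -
  let ?A = "Poly_Mapping.keys F \<union> Poly_Mapping.keys G"
  have "Poly_Mapping.keys (F + G) \<subseteq> ?A" by (rule keys_add)
  then show ?thesis
    by (subst (1 2 3) psubst_superset[of ?A])
      (auto simp: lookup_add Cst_add distrib_right sum.distrib)
qed

lemma psubst_0: "psubst g 0 = 0" by (simp add: psubst_def)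

lemma psubst_single:
  "psubst g (Poly_Mapping.single m c) =
     Cst c * (\<Prod>v\<in>Poly_Mapping.keys m. g v ^ Poly_Mapping.lookup m v)"
  by (simp add: psubst_def Cst_0)

lemma prod_keys_superset:
  fixes g :: "nat \<times> nat \<Rightarrow> 'k::field mpoly"
  assumes "finite A" "Poly_Mapping.keys m \<subseteq> A"
  shows "(\<Prod>v\<in>Poly_Mapping.keys m. g v ^ Poly_Mapping.lookup m v) =
         (\<Prod>v\<in>A. g v ^ Poly_Mapping.lookup m v)"
  by (rule prod.mono_neutral_left) (use assms in \<open>auto simp: not_in_keys_iff_lookup_eq_zero\<close>)

lemma prod_keys_add:
  fixes g :: "nat \<times> nat \<Rightarrow> 'k::field mpoly"
  shows "(\<Prod>v\<in>Poly_Mapping.keys (m + m'). g v ^ Poly_Mapping.lookup (m + m') v) =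
         (\<Prod>v\<in>Poly_Mapping.keys m. g v ^ Poly_Mapping.lookup m v) *
         (\<Prod>v\<in>Poly_Mapping.keys m'. g v ^ Poly_Mapping.lookup m' v)"
proof -
  let ?A = "Poly_Mapping.keys m \<union> Poly_Mapping.keys m'"
  have "Poly_Mapping.keys (m + m') \<subseteq> ?A" by (rule keys_add)
  then show ?thesis
    by (subst (1 2 3) prod_keys_superset[of ?A])
      (auto simp: lookup_add power_add prod.distrib)
qed

lemma psubst_mult: "psubst g (F * G) = psubst g F * psubst g G"
proof (induction F rule: mpoly_sum_induct)
  case (single m c)
  show ?case
  proof (induction G rule: mpoly_sum_induct)
    case (single m' c')
    show ?case by (simp add: mult_single psubst_single prod_keys_add Cst_mult mult_ac)
  qed (simp add: distrib_left psubst_add)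
qed (simp add: distrib_right psubst_add)

lemma psubst_Cst: "psubst g (Cst c) = Cst c"
  by (simp add: Cst_def psubst_single)

lemma psubst_1: "psubst g 1 = 1"
  using psubst_Cst[of g 1] by (simp add: Cst_1)

lemma psubst_power: "psubst g (F ^ k) = psubst g F ^ k"
  by (induction k) (simp_all add: psubst_1 psubst_mult)

lemma psubst_prod: "psubst g (\<Prod>x\<in>A. h x) = (\<Prod>x\<in>A. psubst g (h x))"
  by (induction A rule: infinite_finite_induct) (simp_all add: psubst_1 psubst_mult)

lemma psubst_sum: "psubst g (\<Sum>x\<in>A. h x) = (\<Sum>x\<in>A. psubst g (h x))"
  by (induction A rule: infinite_finite_induct) (simp_all add: psubst_0 psubst_add)

lemma psubst_Var: "psubst g (Var i j) = g (i, j)"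
  by (simp add: Var_def psubst_single Cst_1)

lemma psubst_psubst: "psubst g (psubst h F) = psubst (\<lambda>v. psubst g (h v)) F"
  by (simp add: psubst_def[of h] psubst_def[of "\<lambda>v. psubst g (h v)"]
      psubst_sum psubst_mult psubst_prod psubst_power psubst_Cst)

lemma psubst_cong:
  assumes "\<And>v. v \<in> (\<Union>m\<in>Poly_Mapping.keys F. Poly_Mapping.keys m) \<Longrightarrow> g v = h v"
  shows "psubst g F = psubst h F"
  unfolding psubst_def
  by (intro sum.cong prod.cong arg_cong2[of _ _ _ _ "(*)"] refl arg_cong[of _ _ "\<lambda>x. x ^ _"] assms)
    auto

text \<open>The defining property of the discriminant polynomial.\<close>

lemma generic_poly_coeff: "j \<le> n \<Longrightarrow> coeff (generic_poly n) j = Var 1 (n - j)"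
proof -
  assume "j \<le> n"
  then have "coeff (generic_poly n) j = (\<Sum>i\<le>n. if i = n - j then Var 1 i else 0)"
    unfolding generic_poly_def coeff_sum coeff_monom by (intro sum.cong) auto
  then show ?thesis by simp
qed

lemma disc_poly:
  assumes "n \<ge> 1"
  shows "Var 1 0 * disc_poly n = (disc_resultant n :: 'k::field_char_0 mpoly)"
proof -
  let ?A = "sylvester_mat_sub n (n - 1) (generic_poly n) (pderiv (generic_poly n)) :: 'k mpoly mat"
  have A: "?A \<in> carrier_mat (n + (n - 1)) (n + (n - 1))" by (rule sylvester_mat_sub_carrier)
  have "Var 1 0 dvd ?A $$ (i, 0)" if "i < n + (n - 1)" for i
    using that assms
    by (auto simp: sylvester_mat_sub_def generic_poly_coeff coeff_pderiv)
  then have "Var 1 0 dvd det ?A"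
    using assms by (subst laplace_expansion_column[OF A, of 0]) (auto intro!: dvd_sum dvd_mult2)
  then obtain F where F: "disc_resultant n = Var 1 0 * (F :: 'k mpoly)"
    unfolding disc_resultant_def by (auto simp: dvd_def)
  have "Var 1 0 \<noteq> (0 :: 'k mpoly)"
    unfolding Var_def by (metis lookup_single_eq lookup_zero zero_neq_one)
  then have "disc_poly n = F"
    unfolding disc_poly_def F by (intro the_equality) (auto simp only: mult_cancel_left)
  then show ?thesis unfolding F by (simp only:)
qed


text \<open>Multihomogeneous parts.\<close>

lemma lookup_multihom_part:
  "Poly_Mapping.lookup (multihom_part d F) m = (Poly_Mapping.lookup F m when multideg m = d)"
  unfolding multihom_part_def
  by (auto simp: lookup_sum lookup_single when_def not_in_keys_iff_lookup_eq_zero)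

lemma multideg_superset:
  assumes "finite A" "Poly_Mapping.keys m \<subseteq> A"
  shows "multideg m i = (\<Sum>v \<in> {v \<in> A. fst v = i}. Poly_Mapping.lookup m v)"
  unfolding multideg_def
  by (rule sum.mono_neutral_left) (use assms in \<open>auto simp: in_keys_iff\<close>)

lemma multideg_add: "multideg (m + m') i = multideg m i + multideg m' i"
proof -
  let ?A = "Poly_Mapping.keys m \<union> Poly_Mapping.keys m'"
  have "Poly_Mapping.keys (m + m') \<subseteq> ?A" by (rule keys_add)
  then show ?thesis
    by (subst (1 2 3) multideg_superset[of ?A]) (auto simp: lookup_add sum.distrib)
qed

lemma multiforms_0: "0 \<in> multiforms I r d"
  by (simp add: multiforms_def polys_def)

lemma multiforms_Cst: "Cst c \<in> multiforms I r (\<lambda>_. 0)"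
  by (auto simp: multiforms_def polys_def Cst_def multideg_def)

lemma multiforms_add:
  "F \<in> multiforms I r d \<Longrightarrow> G \<in> multiforms I r d \<Longrightarrow> F + G \<in> multiforms I r d"
  using keys_add[of F G] unfolding multiforms_def polys_def by blast

lemma multiforms_mult:
  assumes "F \<in> multiforms I r d" "G \<in> multiforms I r e"
  shows "F * G \<in> multiforms I r (\<lambda>i. d i + e i)"
proof -
  have "Poly_Mapping.keys m \<subseteq> coords I r \<and> multideg m = (\<lambda>i. d i + e i)"
    if m: "m \<in> Poly_Mapping.keys (F * G)" for m
  proof -
    obtain a b where "a \<in> Poly_Mapping.keys F" "b \<in> Poly_Mapping.keys G" "m = a + b"
      using m keys_mult[of F G] by blast
    then show ?thesis
      using assms keys_add[of a b]
      by (fastforce simp: multiforms_def polys_def multideg_add fun_eq_iff)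
  qed
  then show ?thesis by (simp add: multiforms_def polys_def)
qed

lemma multiforms_Cst_mult: "F \<in> multiforms I r d \<Longrightarrow> Cst c * F \<in> multiforms I r d"
  using multiforms_mult[OF multiforms_Cst] by fastforce

lemma multiforms_sum:
  "(\<And>x. x \<in> A \<Longrightarrow> h x \<in> multiforms I r d) \<Longrightarrow> (\<Sum>x\<in>A. h x) \<in> multiforms I r d"
  by (induction A rule: infinite_finite_induct) (simp_all add: multiforms_0 multiforms_add)

lemma multiforms_power:
  "F \<in> multiforms I r d \<Longrightarrow> F ^ k \<in> multiforms I r (\<lambda>i. k * d i)"
proof (induction k)
  case 0
  show ?case using multiforms_Cst[of 1] by (simp add: Cst_1)
next
  case (Suc k)
  then show ?case using multiforms_mult[OF Suc.prems Suc.IH[OF Suc.prems]] by simp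
qed

lemma multiforms_prod:
  "finite A \<Longrightarrow> (\<And>x. x \<in> A \<Longrightarrow> h x \<in> multiforms I r (d x))
     \<Longrightarrow> (\<Prod>x\<in>A. h x) \<in> multiforms I r (\<lambda>i. \<Sum>x\<in>A. d x i)"
proof (induction A rule: finite_induct)
  case empty
  show ?case using multiforms_Cst[of 1] by (simp add: Cst_1)
next
  case (insert x A)
  then have "h x * (\<Prod>x\<in>A. h x) \<in> multiforms I r (\<lambda>i. d x i + (\<Sum>x\<in>A. d x i))"
    by (intro multiforms_mult) auto
  with insert show ?case by simp
qed

lemma multiforms_Var:
  "i \<in> I \<Longrightarrow> j \<le> r i \<Longrightarrow> Var i j \<in> multiforms I r (\<lambda>i'. if i' = i then 1 else 0)"
proof -
  assume a: "i \<in> I" "j \<le> r i"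
  have "{v \<in> {(i, j)}. fst v = i'} = (if i' = i then {(i, j)} else {})" for i'
    by auto
  with a show ?thesis
    by (auto simp: multiforms_def polys_def Var_def coords_def multideg_def fun_eq_iff)
qed

lemma multihom_part_multiforms:
  "F \<in> multiforms I r d \<Longrightarrow> multihom_part e F = (if e = d then F else 0)"
  by (rule poly_mapping_eqI)
    (auto simp: lookup_multihom_part when_def multiforms_def not_in_keys_iff_lookup_eq_zero)

lemma multihom_part_in_multiforms: "F \<in> polys I r \<Longrightarrow> multihom_part d F \<in> multiforms I r d"
  by (auto simp: multiforms_def polys_def in_keys_iff lookup_multihom_part)

lemma multihom_part_sum: "multihom_part d (\<Sum>x\<in>A. h x) = (\<Sum>x\<in>A. multihom_part d (h x))"
  by (rule poly_mapping_eqI) (simp add: lookup_multihom_part lookup_sum when_def)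

text \<open>The defining property of the elementary homogeneous symmetric polynomials.\<close>

lemma split_form_coeff:
  fixes n :: nat
  assumes "finite A" "A \<subseteq> {1..n}"
  defines "S \<equiv> (\<Prod>i\<in>A. monom [:Var i 0:] 1 - [:monom (Var i 1) 1:]) :: 'k::field mpoly poly poly"
  shows "coeff (coeff S s) t \<in> multiforms {1..n} (\<lambda>_. 1) (\<lambda>i. if i \<in> A then 1 else 0)
         \<and> (s + t \<noteq> card A \<longrightarrow> coeff (coeff S s) t = 0)"
  unfolding S_def using assms(1,2)
proof (induction A arbitrary: s t rule: finite_induct)
  case empty
  have "(1 :: 'k mpoly) \<in> multiforms {1..n} (\<lambda>_. 1) (\<lambda>i. 0)"
    using multiforms_Cst[of 1] by (simp add: Cst_1)
  then show ?case by (cases "s = 0"; cases "t = 0") (simp_all add: multiforms_0)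
next
  case (insert i A)
  define Q :: "'k mpoly poly poly"
    where "Q = (\<Prod>i\<in>A. monom [:Var i 0:] 1 - [:monom (Var i 1) 1:])"
  have eq: "(\<Prod>i\<in>insert i A. monom [:Var i 0:] 1 - [:monom (Var i 1) 1:]) =
        (monom [:Var i 0:] 1 - [:monom (Var i 1) 1:]) * Q"
    using insert by (simp add: Q_def)
  have c: "coeff (coeff ((monom [:Var i 0:] 1 - [:monom (Var i 1) 1:]) * Q) s) t =
      (if s = 0 then 0 else Var i 0 * coeff (coeff Q (s - 1)) t)
      + (if t = 0 then 0 else Cst (-1) * Var i 1 * coeff (coeff Q s) (t - 1))"
  proof -
    have "coeff (monom [:Var i 0:] 1 * Q) s = (if s = 0 then 0 else Polynomial.smult (Var i 0) (coeff Q (s - 1)))"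
      by (simp add: coeff_monom_mult)
    moreover have "coeff ([:monom (Var i 1) 1:] * Q) s = monom (Var i 1) 1 * coeff Q s"
      by simp
    moreover have "Cst (-1) = (-1 :: 'k mpoly)"
      by (simp add: Cst_def single_uminus)
    ultimately show ?thesis
      by (simp add: left_diff_distrib coeff_monom_mult)
  qed
  have IH: "coeff (coeff Q s) t \<in> multiforms {1..n} (\<lambda>_. 1) (\<lambda>i. if i \<in> A then 1 else 0)"
     "s + t \<noteq> card A \<Longrightarrow> coeff (coeff Q s) t = 0" for s t
    using insert unfolding Q_def by auto
  have deg: "(\<lambda>i'. (if i' = i then 1 else 0) + (if i' \<in> A then 1 else 0)) =
      (\<lambda>i'. if i' \<in> insert i A then 1 else 0 :: nat)"
    using insert by auto
  have V: "Var i j * coeff (coeff Q s) t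
      \<in> multiforms {1..n} (\<lambda>_. 1) (\<lambda>i'. if i' \<in> insert i A then 1 else 0)" if "j \<le> 1" for j s t
    using multiforms_mult[OF multiforms_Var[of i "{1..n}" j "\<lambda>_. 1"] IH(1)[of s t]] that insert.prems
    unfolding deg by simp
  show ?case
    unfolding eq c
  proof (intro conjI impI multiforms_add)
    assume "s + t \<noteq> card (insert i A)"
    then show "(if s = 0 then 0 else Var i 0 * coeff (coeff Q (s - 1)) t)
      + (if t = 0 then 0 else Cst (-1) * Var i 1 * coeff (coeff Q s) (t - 1)) = 0"
      using insert.hyps by (auto simp: IH(2))
  next
    show "(if s = 0 then 0 else Var i 0 * coeff (coeff Q (s - 1)) t)
        \<in> multiforms {1..n} (\<lambda>_. 1) (\<lambda>i'. if i' \<in> insert i A then 1 else 0)"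
      by (cases "s = 0") (use V[of 0 "s - 1" t] multiforms_0 in simp_all)
    show "(if t = 0 then 0 else Cst (-1) * Var i 1 * coeff (coeff Q s) (t - 1))
        \<in> multiforms {1..n} (\<lambda>_. 1) (\<lambda>i'. if i' \<in> insert i A then 1 else 0)"
      by (cases "t = 0")
        (use multiforms_Cst_mult[OF V[of 1 s "t - 1"], of "-1"] multiforms_0 in \<open>simp_all add: mult.assoc\<close>)
  qed
qed

lemma split_form_eq:
  "split_form n = (\<Sum>j\<le>n. monom (monom ((-1) ^ j * elem_hom n j) j) (n - j))"
proof (intro poly_eqI)
  fix s t
  have z: "coeff (coeff (split_form n) s) t = 0" if "s + t \<noteq> n"
    using split_form_coeff[of "{1..n}" n s t, THEN conjunct2] that by (simp add: split_form_def)
  have "coeff (coeff (\<Sum>j\<le>n. monom (monom ((-1) ^ j * elem_hom n j) j) (n - j)) s) t =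
     (\<Sum>j\<le>n. if j = t \<and> n - t = s then coeff (coeff (split_form n) s) t else 0)"
    unfolding coeff_sum
    by (intro sum.cong)
      (auto simp: elem_hom_def mult.assoc[symmetric] power_add[symmetric] mult_2[symmetric])
  also have "\<dots> = coeff (coeff (split_form n) s) t"
    using z by (cases "t \<le> n \<and> n - t = s") auto
  finally show "coeff (coeff (split_form n) s) t =
    coeff (coeff (\<Sum>j\<le>n. monom (monom ((-1) ^ j * elem_hom n j) j) (n - j)) s) t" ..
qed

lemma elem_hom_multiform:
  "(elem_hom n j :: 'k::field mpoly)
     \<in> multiforms {1..n} (\<lambda>_. 1) (\<lambda>i. if i \<in> {1..n} then 1 else 0 :: nat)"
proof -
  have mem: "(coeff (coeff (split_form n) (n - j)) j :: 'k mpoly)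
      \<in> multiforms {1..n} (\<lambda>_. 1) (\<lambda>i. if i \<in> {1..n} then 1 else 0)"
    using split_form_coeff[of "{1..n}" n "n - j" j, THEN conjunct1] by (simp add: split_form_def)
  have sgn: "(- 1 :: 'k mpoly) ^ j = Cst ((- 1) ^ j)"
    by (induction j) (simp_all add: Cst_1 Cst_mult, simp add: Cst_def single_uminus)
  show ?thesis
    unfolding elem_hom_def sgn by (rule multiforms_Cst_mult[OF mem])
qed

text \<open>
  The closed point with homogeneous coordinates \<open>a\<close>: the ideal of all polynomials whose
  multihomogeneous parts vanish at \<open>a\<close>.
\<close>

definition closed_point ::
  "nat set \<Rightarrow> (nat \<Rightarrow> nat) \<Rightarrow> (nat \<times> nat \<Rightarrow> 'k::field) \<Rightarrow> 'k mpoly set" where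
  "closed_point I r a = {F \<in> polys I r. \<forall>d. psubst (\<lambda>v. Cst (a v)) (multihom_part d F) = 0}"

lemma multideg_single_factor:
  assumes "Poly_Mapping.keys m \<subseteq> coords {1} r"
  shows "multideg m = (\<lambda>i. if i = 1 then multideg m 1 else 0)"
  using assms by (fastforce simp: multideg_def coords_def fun_eq_iff intro!: sum.neutral)

lemma psubst_elem_hom_monomial:
  fixes n :: nat
  assumes "Poly_Mapping.keys m \<subseteq> coords {1} (\<lambda>_. n)"
  shows "psubst (\<lambda>(_, j). elem_hom n j) (Poly_Mapping.single m c)
    \<in> multiforms {1..n} (\<lambda>_. 1) (\<lambda>i. if i \<in> {1..n} then multideg m 1 else 0)"
proof -
  have "(\<Prod>v\<in>Poly_Mapping.keys m. (case v of (_, j) \<Rightarrow> elem_hom n j) ^ Poly_Mapping.lookup m v)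
    \<in> multiforms {1..n} (\<lambda>_. 1)
        (\<lambda>i. \<Sum>v\<in>Poly_Mapping.keys m. Poly_Mapping.lookup m v * (if i \<in> {1..n} then 1 else 0))"
  proof (intro multiforms_prod multiforms_power finite_keys)
    fix v :: "nat \<times> nat"
    show "(case v of (_, j) \<Rightarrow> elem_hom n j) \<in>
        multiforms {1..n} (\<lambda>_. 1) (\<lambda>i. if i \<in> {1..n} then 1 else 0)"
      by (cases v) (simp only: prod.case elem_hom_multiform)
  qed
  also have "(\<lambda>i. \<Sum>v\<in>Poly_Mapping.keys m. Poly_Mapping.lookup m v * (if i \<in> {1..n} then 1 else 0)) =
      (\<lambda>i. if i \<in> {1..n} then multideg m 1 else 0)"
    using assms
    by (fastforce simp: multideg_def coords_def fun_eq_iff intro!: sum.cong)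
  finally show ?thesis
    unfolding psubst_single by (rule multiforms_Cst_mult)
qed

lemma psubst_elem_hom_part:
  fixes n e :: nat
  assumes "F \<in> polys {1} (\<lambda>_. n)" "n \<ge> 1"
  shows "multihom_part (\<lambda>i. if i \<in> {1..n} then e else 0) (psubst (\<lambda>(_, j). elem_hom n j) F) =
         psubst (\<lambda>(_, j). elem_hom n j) (multihom_part (\<lambda>i. if i = 1 then e else 0) F)"
proof -
  let ?p = "psubst (\<lambda>(_, j). elem_hom n j)"
  let ?M = "\<lambda>m. Poly_Mapping.single m (Poly_Mapping.lookup F m)"
  let ?d = "\<lambda>e i. if i \<in> {1..n} then e else 0 :: nat"
  have d: "?d e = ?d e' \<longleftrightarrow> e = e'" for e e'
    using assms(2) by (auto simp: fun_eq_iff dest!: spec[of _ 1])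
  have "multihom_part (?d e) (?p F) = (\<Sum>m\<in>Poly_Mapping.keys F. multihom_part (?d e) (?p (?M m)))"
    by (subst mpoly_as_sum[of F]) (simp add: psubst_sum multihom_part_sum)
  also have "\<dots> = (\<Sum>m\<in>Poly_Mapping.keys F. if multideg m 1 = e then ?p (?M m) else 0)"
  proof (intro sum.cong refl)
    fix m assume "m \<in> Poly_Mapping.keys F"
    then have "Poly_Mapping.keys m \<subseteq> coords {1} (\<lambda>_. n)" using assms(1) by (auto simp: polys_def)
    from multihom_part_multiforms[OF psubst_elem_hom_monomial[OF this], of "?d e" "Poly_Mapping.lookup F m"]
    show "multihom_part (?d e) (?p (?M m)) = (if multideg m 1 = e then ?p (?M m) else 0)"
      unfolding d by auto
  qed
  also have "\<dots> = (\<Sum>m | m \<in> Poly_Mapping.keys F \<and> multideg m 1 = e. ?p (?M m))"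
    by (simp add: sum.inter_filter)
  also have "\<dots> = ?p (\<Sum>m | m \<in> Poly_Mapping.keys F \<and> multideg m 1 = e. ?M m)"
    by (simp add: psubst_sum)
  also have "{m \<in> Poly_Mapping.keys F. multideg m 1 = e} =
      {m \<in> Poly_Mapping.keys F. multideg m = (\<lambda>i. if i = 1 then e else 0)}"
  proof -
    have "multideg m 1 = e \<longleftrightarrow> multideg m = (\<lambda>i. if i = 1 then e else 0)"
      if "m \<in> Poly_Mapping.keys F" for m
    proof -
      have "Poly_Mapping.keys m \<subseteq> coords {1} (\<lambda>_. n)" using that assms(1) by (auto simp: polys_def)
      then show ?thesis using multideg_single_factor[of m "\<lambda>_. n"] by (metis (full_types))
    qed
    then show ?thesis by auto
  qed
  finally show ?thesis by (simp add: multihom_part_def)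
qed

lemma psubst_elem_hom_part_other:
  fixes n :: nat
  assumes "F \<in> polys {1} (\<lambda>_. n)" "\<nexists>e. d = (\<lambda>i. if i \<in> {1..n} then e else 0)"
  shows "multihom_part d (psubst (\<lambda>(_, j). elem_hom n j) F) = 0"
proof -
  let ?p = "psubst (\<lambda>(_, j). elem_hom n j)"
  let ?M = "\<lambda>m. Poly_Mapping.single m (Poly_Mapping.lookup F m)"
  have "multihom_part d (?p F) = (\<Sum>m\<in>Poly_Mapping.keys F. multihom_part d (?p (?M m)))"
    by (subst mpoly_as_sum[of F]) (simp add: psubst_sum multihom_part_sum)
  also have "\<dots> = 0"
  proof (intro sum.neutral ballI)
    fix m assume "m \<in> Poly_Mapping.keys F"
    then have "Poly_Mapping.keys m \<subseteq> coords {1} (\<lambda>_. n)" using assms(1) by (auto simp: polys_def)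
    from multihom_part_multiforms[OF psubst_elem_hom_monomial[OF this], of d "Poly_Mapping.lookup F m"]
    show "multihom_part d (?p (?M m)) = 0" using assms(2) by auto
  qed
  finally show ?thesis .
qed

lemma psubst_elem_hom_polys:
  fixes n :: nat
  assumes "F \<in> polys {1} (\<lambda>_. n)"
  shows "psubst (\<lambda>(_, j). elem_hom n j) F \<in> polys {1..n} (\<lambda>_. 1)"
proof -
  let ?p = "psubst (\<lambda>(_, j). elem_hom n j)"
  have "?p (Poly_Mapping.single m (Poly_Mapping.lookup F m)) \<in> polys {1..n} (\<lambda>_. 1)"
    if "m \<in> Poly_Mapping.keys F" for m
    using psubst_elem_hom_monomial[of m n] that assms by (auto simp: polys_def multiforms_def)
  then have "(\<Sum>m\<in>Poly_Mapping.keys F. ?p (Poly_Mapping.single m (Poly_Mapping.lookup F m)))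
      \<in> polys {1..n} (\<lambda>_. 1)"
    using keys_sum[of "\<lambda>m. ?p (Poly_Mapping.single m (Poly_Mapping.lookup F m))" "Poly_Mapping.keys F"]
    unfolding polys_def by blast
  then show ?thesis by (subst mpoly_as_sum[of F]) (simp add: psubst_sum)
qed

text \<open>
  On closed points \<open>pi_map n\<close> is given by the values of the elementary homogeneous symmetric
  polynomials.
\<close>

lemma pi_map_closed_point:
  fixes a b :: "nat \<times> nat \<Rightarrow> 'k::field"
  assumes "n \<ge> 1"
    and "\<And>j. j \<le> n \<Longrightarrow> Cst (b (1, j)) = psubst (\<lambda>v. Cst (a v)) (elem_hom n j)"
  shows "pt (pi_map n) (closed_point {1..n} (\<lambda>_. 1) a) = closed_point {1} (\<lambda>_. n) b"
proof -
  let ?p = "psubst (\<lambda>(_, j). elem_hom n j) :: 'k mpoly \<Rightarrow> 'k mpoly"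
  let ?a = "psubst (\<lambda>v. Cst (a v))" and ?b = "psubst (\<lambda>v. Cst (b v))"
  have ab: "?a (?p F) = ?b F" if "F \<in> polys {1} (\<lambda>_. n)" for F
    unfolding psubst_psubst
    using that assms(2) by (intro psubst_cong) (fastforce simp: polys_def coords_def)
  have hp: "multihom_part d F \<in> polys {1} (\<lambda>_. n)" if "F \<in> polys {1} (\<lambda>_. n)" for d and F :: "'k mpoly"
    using multihom_part_in_multiforms[OF that, of d] by (simp add: multiforms_def)
  have "(\<forall>d. ?a (multihom_part d (?p F)) = 0) \<longleftrightarrow> (\<forall>d. ?b (multihom_part d F) = 0)"
    if F: "F \<in> polys {1} (\<lambda>_. n)" for F
  proof -
    have 1: "?a (multihom_part (\<lambda>i. if i \<in> {1..n} then e else 0) (?p F)) =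
        ?b (multihom_part (\<lambda>i. if i = 1 then e else 0) F)" for e
      unfolding psubst_elem_hom_part[OF F assms(1)] by (rule ab[OF hp[OF F]])
    have 2: "multihom_part d F = 0" if "\<nexists>e. d = (\<lambda>i. if i = 1 then e else 0)" for d
    proof (rule poly_mapping_eqI)
      fix m
      show "Poly_Mapping.lookup (multihom_part d F) m = Poly_Mapping.lookup 0 m"
      proof (cases "m \<in> Poly_Mapping.keys F")
        case True
        then have "Poly_Mapping.keys m \<subseteq> coords {1} (\<lambda>_. n)" using F by (auto simp: polys_def)
        then show ?thesis
          using multideg_single_factor[of m "\<lambda>_. n"] that
          by (auto simp: lookup_multihom_part when_def)
      qed (simp add: lookup_multihom_part when_def not_in_keys_iff_lookup_eq_zero)
    qed
    show ?thesis
    proof (intro iffI allI)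
      fix d assume "\<forall>d. ?a (multihom_part d (?p F)) = 0"
      then show "?b (multihom_part d F) = 0"
        using 1 2[of d] by (cases "\<exists>e. d = (\<lambda>i. if i = 1 then e else 0)") (auto simp: psubst_0)
    next
      fix d assume "\<forall>d. ?b (multihom_part d F) = 0"
      then show "?a (multihom_part d (?p F)) = 0"
        using 1 psubst_elem_hom_part_other[OF F, of d]
        by (cases "\<exists>e. d = (\<lambda>i. if i \<in> {1..n} then e else 0)") (auto simp: psubst_0)
    qed
  qed
  then have "{F \<in> polys {1} (\<lambda>_. n). ?p F \<in> closed_point {1..n} (\<lambda>_. 1) a} = closed_point {1} (\<lambda>_. n) b"
    unfolding closed_point_def using psubst_elem_hom_polys by blast
  moreover have "pt (pi_map n) P = {F \<in> polys {1} (\<lambda>_. n). ?p F \<in> P}" for P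
    unfolding pi_map_def multiproj_map_def by (simp only: lrmap.simps)
  ultimately show ?thesis by (simp only:)
qed

end

theory Submission
  imports Defs
begin

text \<open>
  Let \<open>S\<close> and \<open>R\<close> be the coordinate rings of the source and the target of \<open>\<pi>\<close>, with \<open>R\<close> mapped to
  \<open>S\<close> by \<open>\<phi>\<close>. The key fact is that the symmetric elements of \<open>S\<close> of multidegree \<open>(m, \<dots>, m)\<close> are
  the images of the forms of degree \<open>m\<close> in \<open>R\<close>: by averaging and Ryser's formula for permanents
  they are combinations of products \<open>\<Prod>\<^sub>i g (x\<^sub>i)\<close> with a single binary form \<open>g\<close>, the form \<open>g\<close> splits
  into linear factors, and \<open>\<Prod>\<^sub>i (\<alpha> x\<^sub>i\<^sub>0 - \<beta> x\<^sub>i\<^sub>1)\<close> is linear in the elementary symmetric polynomials.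

  The discriminant enters only as a form \<open>D\<close> on projective space, and the result holds for every
  hypersurface. Averaging shows that an element of \<open>R\<close> that becomes a multiple of \<open>\<phi> D\<close> in \<open>S\<close> is a
  multiple of \<open>D\<close>, so functions on the hypersurface inject. If no translate of a family
  \<open>w\<^sub>0, w\<^sub>1, \<dots>\<close> of forms lies in a prime, then some coefficient of \<open>\<Prod>\<^sub>\<sigma> \<sigma> (\<Sum>\<^sub>a w\<^sub>a T\<^sup>a)\<close> is a symmetric
  element of the ideal of the family outside the prime. This makes the fibres of \<open>\<pi>\<close> orbits, makes
  the orbit topology the right one, and provides the symmetric denominators with which an invariant
  section can be glued along an orbit and averaged to a fraction over \<open>R\<close>.
\<close>

section \<open>Multigraded polynomial rings\<close>

text \<open>The source is a multigraded Proj, and a permutation of the factors changes multidegrees.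
  Only the diagonal degrees (m, ..., m) are stable, so every fraction is first expanded, near a
  given prime, until numerator and denominator have such a degree; a coordinate of each factor
  outside the prime makes this possible. Functions cannot be compared by their values at points: for
  n at least 2 the pullback of the discriminant is, up to sign, the square of the product of the
  minors of pairs of factors, so the inverse image is not reduced. Comparisons are therefore
  statements of membership in the ideal of \<open>esym n D\<close>, up to a multiplier outside the
  prime. Characteristic zero enters through division by n!, which makes averaging a projection that
  is linear over the invariants; hence taking invariants commutes with passing to the quotient by
  \<open>esym n D\<close>. Algebraic closedness serves to split binary forms and to realise
  prescribed values of the elementary symmetric polynomials, which gives their algebraic
  independence.\<close>

lemma coord_ring_simps:
  "carrier (coord_ring I r) = polys I r" "mult (coord_ring I r) = (*)"
  "one (coord_ring I r) = 1" "zero (coord_ring I r) = 0" "add (coord_ring I r) = (+)"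
  by (simp_all add: coord_ring_def)

lemma polys_0: "0 \<in> polys I r"
  by (simp add: polys_def)

lemma polys_Cst: "Cst c \<in> polys I r"
  using multiforms_Cst[of c I r] by (simp add: multiforms_def)

lemma polys_1: "1 \<in> polys I r"
  using polys_Cst[of 1 I r] by (simp add: Cst_1)

lemma polys_add: "F \<in> polys I r \<Longrightarrow> G \<in> polys I r \<Longrightarrow> F + G \<in> polys I r"
  using keys_add[of F G] unfolding polys_def by blast

lemma polys_mult: "F \<in> polys I r \<Longrightarrow> G \<in> polys I r \<Longrightarrow> F * G \<in> polys I r"
proof -
  assume a: "F \<in> polys I r" "G \<in> polys I r"
  have "Poly_Mapping.keys m \<subseteq> coords I r" if m: "m \<in> Poly_Mapping.keys (F * G)" for m
  proof -
    obtain a b where "a \<in> Poly_Mapping.keys F" "b \<in> Poly_Mapping.keys G" "m = a + b"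
      using m keys_mult[of F G] by blast
    then show ?thesis
      using a keys_add[of a b] by (fastforce simp: polys_def)
  qed
  then show ?thesis by (simp add: polys_def)
qed

lemma Cst_uminus_1: "Cst (-1) = (-1)"
  by (simp add: Cst_def single_uminus)

lemma Cst_uminus: "Cst (- c) = - Cst c"
  by (simp add: Cst_def single_uminus)

lemma Cst_diff: "Cst (a - b) = Cst a - Cst b"
  by (simp add: Cst_def single_diff)

lemma Cst_power: "Cst (a ^ k) = Cst a ^ k"
  by (induction k) (simp_all add: Cst_1 Cst_mult)

lemma Cst_sum: "Cst (\<Sum>x\<in>A. f x) = (\<Sum>x\<in>A. Cst (f x))"
  by (induction A rule: infinite_finite_induct) (simp_all add: Cst_0 Cst_add)

lemma Cst_prod: "Cst (\<Prod>x\<in>A. f x) = (\<Prod>x\<in>A. Cst (f x))"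
  by (induction A rule: infinite_finite_induct) (simp_all add: Cst_1 Cst_mult)

lemma Cst_inject: "Cst a = Cst b \<longleftrightarrow> a = b"
  unfolding Cst_def by (metis lookup_single_eq)

lemma Cst_of_nat: "Cst (of_nat k) = of_nat k"
  by (induction k) (simp_all add: Cst_0 Cst_1 Cst_add)

lemma polys_uminus: "F \<in> polys I r \<Longrightarrow> - F \<in> polys I r"
  by (simp add: polys_def)

lemma polys_diff: "F \<in> polys I r \<Longrightarrow> G \<in> polys I r \<Longrightarrow> F - G \<in> polys I r"
  using polys_add[of F I r "- G"] polys_uminus[of G] by simp

lemma polys_sum: "(\<And>x. x \<in> A \<Longrightarrow> f x \<in> polys I r) \<Longrightarrow> (\<Sum>x\<in>A. f x) \<in> polys I r"
  by (induction A rule: infinite_finite_induct) (simp_all add: polys_0 polys_add)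

lemma polys_prod: "(\<And>x. x \<in> A \<Longrightarrow> f x \<in> polys I r) \<Longrightarrow> (\<Prod>x\<in>A. f x) \<in> polys I r"
  by (induction A rule: infinite_finite_induct) (simp_all add: polys_1 polys_mult)

lemma polys_power: "F \<in> polys I r \<Longrightarrow> F ^ k \<in> polys I r"
  by (induction k) (simp_all add: polys_1 polys_mult)

lemma polys_Var: "i \<in> I \<Longrightarrow> j \<le> r i \<Longrightarrow> Var i j \<in> polys I r"
  using multiforms_Var[of i I j r] unfolding multiforms_def by blast

lemma multiforms_polys: "F \<in> multiforms I r d \<Longrightarrow> F \<in> polys I r"
  by (simp add: multiforms_def)

lemma multiforms_uminus: "F \<in> multiforms I r d \<Longrightarrow> - F \<in> multiforms I r d"
  by (simp add: multiforms_def polys_def)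

lemma multiforms_1: "1 \<in> multiforms I r (\<lambda>_. 0)"
  using multiforms_Cst[of 1 I r] by (simp add: Cst_1)

lemma cring_coord_ring: "cring (coord_ring I r :: 'k::field mpoly ring)"
proof (rule cringI)
  show "abelian_group (coord_ring I r :: 'k mpoly ring)"
  proof (rule abelian_groupI)
    fix x :: "'k mpoly" assume "x \<in> carrier (coord_ring I r)"
    then show "\<exists>y\<in>carrier (coord_ring I r). y \<oplus>\<^bsub>coord_ring I r\<^esub> x = \<zero>\<^bsub>coord_ring I r\<^esub>"
      by (intro bexI[of _ "- x"]) (auto simp: coord_ring_simps polys_uminus)
  qed (auto simp: coord_ring_simps polys_0 polys_add algebra_simps)
  show "comm_monoid (coord_ring I r :: 'k mpoly ring)"
    by (rule comm_monoidI) (auto simp: coord_ring_simps polys_1 polys_mult algebra_simps)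
qed (auto simp: coord_ring_simps algebra_simps)

text \<open>An elementwise form of ideals, so that proofs use plain \<open>+\<close> and
  \<open>*\<close> in place of the operations of \<open>coord_ring\<close>. Negation is
  multiplication by -1 and needs no clause of its own.\<close>

definition poly_ideal :: "nat set \<Rightarrow> (nat \<Rightarrow> nat) \<Rightarrow> 'k::field mpoly set \<Rightarrow> bool" where
  "poly_ideal I r A \<longleftrightarrow> A \<subseteq> polys I r \<and> 0 \<in> A \<and> (\<forall>F\<in>A. \<forall>G\<in>A. F + G \<in> A) \<and>
     (\<forall>F\<in>A. \<forall>G\<in>polys I r. G * F \<in> A)"

lemma poly_idealD:
  assumes "poly_ideal I r A"
  shows "F \<in> A \<Longrightarrow> F \<in> polys I r" "0 \<in> A" "F \<in> A \<Longrightarrow> G \<in> A \<Longrightarrow> F + G \<in> A"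
    "F \<in> A \<Longrightarrow> G \<in> polys I r \<Longrightarrow> G * F \<in> A" "F \<in> A \<Longrightarrow> G \<in> polys I r \<Longrightarrow> F * G \<in> A"
    "F \<in> A \<Longrightarrow> - F \<in> A" "F \<in> A \<Longrightarrow> G \<in> A \<Longrightarrow> F - G \<in> A"
proof -
  show *: "F \<in> A \<Longrightarrow> F \<in> polys I r" "0 \<in> A" "F \<in> A \<Longrightarrow> G \<in> A \<Longrightarrow> F + G \<in> A"
    "F \<in> A \<Longrightarrow> G \<in> polys I r \<Longrightarrow> G * F \<in> A" for F G
    using assms by (auto simp: poly_ideal_def)
  show "F \<in> A \<Longrightarrow> G \<in> polys I r \<Longrightarrow> F * G \<in> A"
    using *(4) by (simp add: mult.commute)
  show **: "F \<in> A \<Longrightarrow> - F \<in> A" for F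
    using *(4)[of F "-1"] polys_uminus[OF polys_1[of I r]] by simp
  show "F \<in> A \<Longrightarrow> G \<in> A \<Longrightarrow> F - G \<in> A"
    using *(3)[of F "- G"] **[of G] by simp
qed

lemma poly_ideal_add_iff:
  assumes "poly_ideal I r A" "G \<in> A"
  shows "F + G \<in> A \<longleftrightarrow> F \<in> A"
proof
  assume "F + G \<in> A"
  then have "F + G - G \<in> A" by (rule poly_idealD(7)[OF assms(1) _ assms(2)])
  then show "F \<in> A" by (simp only: add_diff_cancel_right')
qed (rule poly_idealD(3)[OF assms(1) _ assms(2)])

lemma poly_ideal_sum:
  assumes "poly_ideal I r A" "\<And>x. x \<in> B \<Longrightarrow> f x \<in> A"
  shows "(\<Sum>x\<in>B. f x) \<in> A"
  using assms(2)
  by (induction B rule: infinite_finite_induct) (auto intro: poly_idealD[OF assms(1)])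

lemma poly_ideal_iff: "poly_ideal I r A \<longleftrightarrow> ideal A (coord_ring I r)"
proof
  assume A: "poly_ideal I r A"
  interpret cring "coord_ring I r" by (rule cring_coord_ring)
  show "ideal A (coord_ring I r)"
  proof (rule idealI)
    show "ring (coord_ring I r)" by (rule ring_axioms)
    show "subgroup A (add_monoid (coord_ring I r))"
    proof (rule group.subgroupI)
      show "Group.group (add_monoid (coord_ring I r))" by (rule a_group)
      show "A \<subseteq> carrier (add_monoid (coord_ring I r))"
        using poly_idealD[OF A] by (auto simp: coord_ring_simps)
      show "A \<noteq> {}" using poly_idealD(2)[OF A] by auto
      show "inv\<^bsub>add_monoid (coord_ring I r)\<^esub> a \<in> A" if "a \<in> A" for a
      proof -
        have a: "a \<in> polys I r" using poly_idealD[OF A] that by auto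
        have "inv\<^bsub>add_monoid (coord_ring I r)\<^esub> a = - a"
          using minus_equality[of "-a" a] a polys_uminus[OF a]
          unfolding a_inv_def by (simp add: coord_ring_simps)
        then show ?thesis using poly_idealD[OF A] that by simp
      qed
      show "a \<otimes>\<^bsub>add_monoid (coord_ring I r)\<^esub> b \<in> A" if "a \<in> A" "b \<in> A" for a b
        using poly_idealD(3)[OF A] that by (auto simp: coord_ring_simps)
    qed
  qed (use poly_idealD[OF A] in \<open>auto simp: coord_ring_simps\<close>)
next
  assume "ideal A (coord_ring I r)"
  then interpret ideal A "coord_ring I r" .
  show "poly_ideal I r A"
    unfolding poly_ideal_def
    using a_subset additive_subgroup.a_closed[OF is_additive_subgroup] I_l_closed
      additive_subgroup.zero_closed[OF is_additive_subgroup]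
    by (auto simp: coord_ring_simps)
qed

section \<open>Prime ideals of the coordinate ring\<close>

lemma primeideal_iff:
  "primeideal P (coord_ring I r) \<longleftrightarrow> poly_ideal I r P \<and> 1 \<notin> P \<and>
     (\<forall>F\<in>polys I r. \<forall>G\<in>polys I r. F * G \<in> P \<longrightarrow> F \<in> P \<or> G \<in> P)"
proof
  assume "primeideal P (coord_ring I r)"
  then interpret primeideal P "coord_ring I r" .
  have "poly_ideal I r P" unfolding poly_ideal_iff by (rule ideal_axioms)
  moreover have "1 \<notin> P"
    using I_notcarr one_imp_carrier by (auto simp: coord_ring_simps)
  ultimately show "poly_ideal I r P \<and> 1 \<notin> P \<and>
     (\<forall>F\<in>polys I r. \<forall>G\<in>polys I r. F * G \<in> P \<longrightarrow> F \<in> P \<or> G \<in> P)"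
    using I_prime by (auto simp: coord_ring_simps)
next
  assume "poly_ideal I r P \<and> 1 \<notin> P \<and>
     (\<forall>F\<in>polys I r. \<forall>G\<in>polys I r. F * G \<in> P \<longrightarrow> F \<in> P \<or> G \<in> P)"
  then show "primeideal P (coord_ring I r)"
    unfolding poly_ideal_iff
    by (intro primeidealI cring_coord_ring) (auto simp: coord_ring_simps polys_1)
qed

lemma primeidealD_poly:
  assumes "primeideal P (coord_ring I r)"
  shows "poly_ideal I r P" "1 \<notin> P"
    "F \<in> polys I r \<Longrightarrow> G \<in> polys I r \<Longrightarrow> F * G \<in> P \<longleftrightarrow> F \<in> P \<or> G \<in> P"
  using assms poly_idealD(4,5)[of I r P] unfolding primeideal_iff by blast+

lemma prime_prod_iff:
  assumes "primeideal P (coord_ring I r)" "finite A" "\<And>x. x \<in> A \<Longrightarrow> f x \<in> polys I r"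
  shows "(\<Prod>x\<in>A. f x) \<in> P \<longleftrightarrow> (\<exists>x\<in>A. f x \<in> P)"
  using assms(2,3)
  by (induction A rule: finite_induct)
    (simp_all add: primeidealD_poly[OF assms(1)] polys_prod)

lemma prime_power:
  assumes "primeideal P (coord_ring I r)" "F \<in> polys I r" "F \<notin> P"
  shows "F ^ k \<notin> P"
  by (induction k) (use assms in \<open>simp_all add: primeidealD_poly[OF assms(1)] polys_power\<close>)

text \<open>Gauss's argument: modulo \<open>P\<close>, the coefficient of \<open>f * g\<close> at
  \<open>i + j\<close> is the product of the lowest coefficients of \<open>f\<close> and
  \<open>g\<close> outside \<open>P\<close>.\<close>

lemma prime_poly_mult:
  fixes f g :: "'k::field mpoly poly"
  assumes P: "primeideal P (coord_ring I r)"
    and f: "\<And>i. coeff f i \<in> polys I r" "\<exists>i. coeff f i \<notin> P"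
    and g: "\<And>i. coeff g i \<in> polys I r" "\<exists>i. coeff g i \<notin> P"
  shows "\<exists>k. coeff (f * g) k \<notin> P"
proof -
  note PD = primeidealD_poly[OF P]
  define i where "i = (LEAST i. coeff f i \<notin> P)"
  define j where "j = (LEAST j. coeff g j \<notin> P)"
  have i: "coeff f i \<notin> P" "\<And>a. a < i \<Longrightarrow> coeff f a \<in> P"
    unfolding i_def using LeastI_ex[OF f(2)] not_less_Least by blast+
  have j: "coeff g j \<notin> P" "\<And>a. a < j \<Longrightarrow> coeff g a \<in> P"
    unfolding j_def using LeastI_ex[OF g(2)] not_less_Least by blast+
  have "coeff (f * g) (i + j) = coeff f i * coeff g j + (\<Sum>a\<in>{..i+j} - {i}. coeff f a * coeff g (i + j - a))"
    unfolding coeff_mult by (subst sum.remove[of _ i]) auto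
  moreover have "(\<Sum>a\<in>{..i+j} - {i}. coeff f a * coeff g (i + j - a)) \<in> P"
  proof (rule poly_ideal_sum[OF PD(1)])
    fix a assume a: "a \<in> {..i+j} - {i}"
    show "coeff f a * coeff g (i + j - a) \<in> P"
    proof (cases "a < i")
      case True
      then show ?thesis using i(2) g(1) poly_idealD(5)[OF PD(1)] by auto
    next
      case False
      then have "i + j - a < j" using a by auto
      then show ?thesis using j(2) f(1) poly_idealD(4)[OF PD(1)] by auto
    qed
  qed
  moreover have "coeff f i * coeff g j \<notin> P" using i(1) j(1) f(1) g(1) PD(3) by blast
  ultimately have "coeff (f * g) (i + j) \<notin> P"
    by (simp only: poly_ideal_add_iff[OF PD(1)] not_False_eq_True)
  then show ?thesis by blast
qed

text \<open>The second conjunct carries the induction, because \<open>prime_poly_mult\<close> asks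
  for the coefficients of both factors to lie in the coordinate ring.\<close>

lemma prime_poly_prod:
  fixes f :: "'a \<Rightarrow> 'k::field mpoly poly"
  assumes P: "primeideal P (coord_ring I r)" and "finite A"
    and f: "\<And>x i. x \<in> A \<Longrightarrow> coeff (f x) i \<in> polys I r" "\<And>x. x \<in> A \<Longrightarrow> \<exists>i. coeff (f x) i \<notin> P"
  shows "(\<exists>k. coeff (\<Prod>x\<in>A. f x) k \<notin> P) \<and> (\<forall>k. coeff (\<Prod>x\<in>A. f x) k \<in> polys I r)"
  using assms(2-)
proof (induction A rule: finite_induct)
  case empty
  have "coeff (1 :: 'k mpoly poly) 0 \<notin> P" using primeidealD_poly(2)[OF P] by simp
  moreover have "\<forall>k. coeff (1 :: 'k mpoly poly) k \<in> polys I r"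
    by (auto simp: polys_0 polys_1)
  ultimately show ?case by (metis prod.empty)
next
  case (insert x A)
  then have "coeff (f x * (\<Prod>x\<in>A. f x)) k \<in> polys I r" for k
    unfolding coeff_mult by (intro polys_sum polys_mult) auto
  moreover have "\<exists>k. coeff (f x * (\<Prod>x\<in>A. f x)) k \<notin> P"
    by (rule prime_poly_mult[OF P]) (use insert in auto)
  ultimately show ?case using insert.hyps by auto
qed

subsection \<open>Multihomogeneous parts\<close>

lemma multihom_part_add: "multihom_part d (F + G) = multihom_part d F + multihom_part d G"
  by (rule poly_mapping_eqI) (simp add: lookup_multihom_part lookup_add when_def)

lemma multihom_part_0: "multihom_part d 0 = 0"
  by (simp add: multihom_part_def)

lemma multihom_part_decomp:
  "F = (\<Sum>d\<in>multideg ` Poly_Mapping.keys F. multihom_part d F)"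
proof (rule poly_mapping_eqI)
  fix m
  show "Poly_Mapping.lookup F m = Poly_Mapping.lookup (\<Sum>d\<in>multideg ` Poly_Mapping.keys F. multihom_part d F) m"
    by (cases "m \<in> Poly_Mapping.keys F")
      (auto simp: lookup_sum lookup_multihom_part when_def not_in_keys_iff_lookup_eq_zero)
qed

lemma multihom_part_eq_0: "d \<notin> multideg ` Poly_Mapping.keys F \<Longrightarrow> multihom_part d F = 0"
  by (rule poly_mapping_eqI)
    (auto simp: lookup_multihom_part when_def image_iff in_keys_iff)

lemma multihom_part_homogeneous:
  "\<forall>m\<in>Poly_Mapping.keys F. multideg m = d \<Longrightarrow> multihom_part e F = (if e = d then F else 0)"
  by (rule poly_mapping_eqI)
    (auto simp: lookup_multihom_part when_def not_in_keys_iff_lookup_eq_zero)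

lemma multihom_part_mult_multiform:
  assumes G: "G \<in> multiforms I r e"
  shows "multihom_part (\<lambda>i. d i + e i) (F * G) = multihom_part d F * G"
proof (induction F rule: mpoly_sum_induct)
  case (single m c)
  have "\<forall>m'\<in>Poly_Mapping.keys (Poly_Mapping.single m c * G). multideg m' = (\<lambda>i. multideg m i + e i)"
    using keys_mult[of "Poly_Mapping.single m c" G] G
    by (fastforce simp: multiforms_def multideg_add fun_eq_iff split: if_splits)
  note 1 = multihom_part_homogeneous[OF this, of "\<lambda>i. d i + e i"]
  have "\<forall>m'\<in>Poly_Mapping.keys (Poly_Mapping.single m c). multideg m' = multideg m"
    by auto
  note 2 = multihom_part_homogeneous[OF this, of d]
  show ?case unfolding 1 2 by (auto simp: fun_eq_iff)
qed (simp add: distrib_right multihom_part_add)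

lemma multihom_part_mult_multiform_0:
  assumes G: "G \<in> multiforms I r e" and "\<not> (\<forall>i. e i \<le> d i)"
  shows "multihom_part d (F * G) = 0"
proof (induction F rule: mpoly_sum_induct)
  case (single m c)
  have "\<forall>m'\<in>Poly_Mapping.keys (Poly_Mapping.single m c * G). multideg m' = (\<lambda>i. multideg m i + e i)"
    using keys_mult[of "Poly_Mapping.single m c" G] G
    by (fastforce simp: multiforms_def multideg_add fun_eq_iff split: if_splits)
  note 1 = multihom_part_homogeneous[OF this, of d]
  show ?case unfolding 1 using assms(2) by auto
qed (simp add: distrib_right multihom_part_add)

text \<open>Subtraction of naturals truncates, hence the guard: without it \<open>d i - e i\<close>
  would name a degree even where no term of \<open>F * G\<close> can have degree
  \<open>d\<close>.\<close>

lemma multihom_part_mult_multiform':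
  assumes G: "G \<in> multiforms I r e"
  shows "multihom_part d (F * G) =
    (if \<forall>i. e i \<le> d i then multihom_part (\<lambda>i. d i - e i) F * G else 0)"
  using multihom_part_mult_multiform[OF G, of "\<lambda>i. d i - e i" F]
    multihom_part_mult_multiform_0[OF G, of d F]
  by (auto intro!: arg_cong2[of _ _ _ _ multihom_part])

lemma multihom_part_mult_decomp:
  "multihom_part d (G * F) = (\<Sum>a\<in>multideg ` Poly_Mapping.keys G. multihom_part d (F * multihom_part a G))"
proof -
  have "G * F = F * (\<Sum>a\<in>multideg ` Poly_Mapping.keys G. multihom_part a G)"
    using multihom_part_decomp[of G] by (simp only: mult.commute[of G])
  then show ?thesis by (simp only: sum_distrib_left multihom_part_sum)
qed

definition multihom :: "'k::field mpoly set \<Rightarrow> bool" where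
  "multihom A \<longleftrightarrow> (\<forall>F\<in>A. \<forall>d. multihom_part d F \<in> A)"

text \<open>For an ideal \<open>A\<close> this is the largest multihomogeneous ideal contained in
  \<open>A\<close>.\<close>

definition multihom_core :: "nat set \<Rightarrow> (nat \<Rightarrow> nat) \<Rightarrow> 'k::field mpoly set \<Rightarrow> 'k mpoly set" where
  "multihom_core I r A = {F \<in> polys I r. \<forall>d. multihom_part d F \<in> A}"

lemma multihom_part_polys: "F \<in> polys I r \<Longrightarrow> multihom_part d F \<in> polys I r"
  using multihom_part_in_multiforms multiforms_polys by blast

lemma multihom_part_part:
  "multihom_part d (multihom_part e F) = (if d = e then multihom_part e F else 0)"
  by (rule poly_mapping_eqI) (auto simp: lookup_multihom_part when_def)

text \<open>
  Primality of the core is the usual leading-form argument, with degrees compared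
  lexicographically.
\<close>

lemma primeideal_core:
  fixes P :: "'k::field mpoly set"
  assumes P: "primeideal P (coord_ring I r)"
  shows "primeideal (multihom_core I r P) (coord_ring I r)"
proof -
  note PD = primeidealD_poly[OF P]
  let ?C = "multihom_core I r P"
  define lt :: "(nat \<Rightarrow> nat) \<Rightarrow> (nat \<Rightarrow> nat) \<Rightarrow> bool"
    where "lt f g \<longleftrightarrow> (\<exists>k. f k < g k \<and> (\<forall>j<k. f j = g j))" for f g
  have tot: "lt f g \<or> lt g f" if ne: "f \<noteq> g" for f g
  proof -
    define k where "k = (LEAST x. f x \<noteq> g x)"
    from ne obtain x where "f x \<noteq> g x" by auto
    then have "f k \<noteq> g k" unfolding k_def by (rule LeastI)
    moreover have eq: "f j = g j" if "j < k" for j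
      using not_less_Least[of j "\<lambda>x. f x \<noteq> g x"] that unfolding k_def by simp
    ultimately consider "f k < g k" | "g k < f k" by linarith
    then show ?thesis
    proof cases
      case 1 then show ?thesis unfolding lt_def using eq by blast
    next
      case 2 then show ?thesis unfolding lt_def using eq by (intro disjI2 exI[of _ k]) simp
    qed
  qed
  have trans: "lt f h" if fg: "lt f g" and gh: "lt g h" for f g h
  proof -
    obtain a b where ab: "f a < g a" "\<forall>j<a. f j = g j" "g b < h b" "\<forall>j<b. g j = h j"
      using fg gh unfolding lt_def by blast
    show ?thesis
      unfolding lt_def
      by (rule exI[of _ "min a b"], cases a b rule: linorder_cases) (use ab in auto)
  qed
  have irr: "\<not> lt f f" for f unfolding lt_def by auto
  \<comment> \<open>The lexicographic comparison of all functions on the naturals is not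
    well-founded, but only finitely many degrees occur in one polynomial.\<close>
  have minel: "\<exists>m\<in>A. \<forall>x\<in>A. x \<noteq> m \<longrightarrow> \<not> lt x m" if "finite A" "A \<noteq> {}" for A
    using Finite_Set.bex_min_element[OF that(1) _ _ that(2), of lt] trans irr
    unfolding asymp_on_def transp_on_def by blast
  have ideal: "poly_ideal I r ?C"
    unfolding poly_ideal_def
  proof (intro conjI ballI)
    show "?C \<subseteq> polys I r" by (auto simp: multihom_core_def)
    show "0 \<in> ?C" by (simp add: multihom_core_def polys_0 multihom_part_0 poly_idealD(2)[OF PD(1)])
    fix F assume F: "F \<in> ?C"
    show "F + G \<in> ?C" if "G \<in> ?C" for G
      using F that poly_idealD(3)[OF PD(1)]
      by (auto simp: multihom_core_def polys_add multihom_part_add)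
    fix G :: "'k mpoly" assume G: "G \<in> polys I r"
    have "multihom_part d (G * F) \<in> P" for d
    proof -
      have "multihom_part d (G * F) = (\<Sum>a\<in>multideg ` Poly_Mapping.keys G. multihom_part d (F * multihom_part a G))"
        by (rule multihom_part_mult_decomp)
      also have "\<dots> \<in> P"
      proof (rule poly_ideal_sum[OF PD(1)])
        fix a
        have "multihom_part b F * multihom_part a G \<in> P" for b
          using F multihom_part_polys[OF G] poly_idealD(5)[OF PD(1)] by (auto simp: multihom_core_def)
        then show "multihom_part d (F * multihom_part a G) \<in> P"
          unfolding multihom_part_mult_multiform'[OF multihom_part_in_multiforms[OF G]]
          using poly_idealD(2)[OF PD(1)] by auto
      qed
      finally show ?thesis .
    qed
    then show "G * F \<in> ?C"
      using F G by (auto simp: multihom_core_def polys_mult)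
  qed
  have "1 \<notin> ?C"
  proof
    assume "1 \<in> ?C"
    then have "multihom_part (\<lambda>_. 0) 1 \<in> P" by (auto simp: multihom_core_def)
    then show False
      using PD(2) by (simp add: multihom_part_multiforms[OF multiforms_1[of I r]])
  qed
  moreover have "F \<in> ?C \<or> G \<in> ?C"
    if F: "F \<in> polys I r" and G: "G \<in> polys I r" and FG: "F * G \<in> ?C" for F G
  proof (rule ccontr)
    assume no: "\<not> (F \<in> ?C \<or> G \<in> ?C)"
    have ex: "\<exists>d. multihom_part d H \<notin> P \<and> (\<forall>e. lt e d \<longrightarrow> multihom_part e H \<in> P)"
      if H: "H \<in> polys I r" "H \<notin> ?C" for H
    proof -
      let ?A = "{d \<in> multideg ` Poly_Mapping.keys H. multihom_part d H \<notin> P}"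
      have "?A \<noteq> {}"
        using H multihom_part_eq_0[of _ H] poly_idealD(2)[OF PD(1)]
        by (force simp: multihom_core_def)
      moreover have "finite ?A" by (rule finite_subset[of _ "multideg ` Poly_Mapping.keys H"]) auto
      ultimately obtain d where d: "d \<in> ?A" "\<forall>x\<in>?A. x \<noteq> d \<longrightarrow> \<not> lt x d"
        using minel by blast
      have "multihom_part e H \<in> P" if e: "lt e d" for e
      proof (cases "e \<in> multideg ` Poly_Mapping.keys H")
        case True
        moreover have "e \<noteq> d" using e irr[of d] by auto
        ultimately show ?thesis using d(2) e by auto
      next
        case False
        then show ?thesis using multihom_part_eq_0[of e H] poly_idealD(2)[OF PD(1)] by simp
      qed
      then show ?thesis using d(1) by blast
    qed
    obtain d where d: "multihom_part d F \<notin> P" "\<And>e. lt e d \<Longrightarrow> multihom_part e F \<in> P"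
      using ex[OF F] no by blast
    obtain d' where d': "multihom_part d' G \<notin> P" "\<And>e. lt e d' \<Longrightarrow> multihom_part e G \<in> P"
      using ex[OF G] no by blast
    let ?K = "multideg ` Poly_Mapping.keys F"
    let ?D = "\<lambda>i. d i + d' i"
    have dK: "d \<in> ?K" using d(1) multihom_part_eq_0[of d F] poly_idealD(2)[OF PD(1)] by force
    have "multihom_part ?D (F * G) = (\<Sum>a\<in>?K. multihom_part ?D (G * multihom_part a F))"
      by (rule multihom_part_mult_decomp)
    also have "\<dots> = multihom_part ?D (G * multihom_part d F) +
        (\<Sum>a\<in>?K - {d}. multihom_part ?D (G * multihom_part a F))"
      using dK by (subst sum.remove[of _ d]) auto
    also have "multihom_part ?D (G * multihom_part d F) = multihom_part d' G * multihom_part d F"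
      by (subst multihom_part_mult_multiform'[OF multihom_part_in_multiforms[OF F]]) simp
    finally have eq: "multihom_part ?D (F * G) = multihom_part d' G * multihom_part d F +
        (\<Sum>a\<in>?K - {d}. multihom_part ?D (G * multihom_part a F))" .
    have "(\<Sum>a\<in>?K - {d}. multihom_part ?D (G * multihom_part a F)) \<in> P"
    proof (rule poly_ideal_sum[OF PD(1)])
      fix a assume a: "a \<in> ?K - {d}"
      have "multihom_part (\<lambda>i. ?D i - a i) G * multihom_part a F \<in> P" if le: "\<forall>i. a i \<le> ?D i"
      proof (cases "lt a d")
        case True
        then show ?thesis
          using d(2) multihom_part_polys[OF G] poly_idealD(4)[OF PD(1)] by blast
      next
        case False
        then obtain k where k: "d k < a k" "\<forall>j<k. d j = a j"
          using tot[of a d] a unfolding lt_def by auto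
        \<comment> \<open>The two degrees add up to \<open>?D\<close>, which is also the sum of
          \<open>d\<close> and \<open>d'\<close>. Exceeding \<open>d\<close> at the first difference
          means staying below \<open>d'\<close> at the same place.\<close>
        have "lt (\<lambda>i. ?D i - a i) d'"
          unfolding lt_def
        proof (intro exI[of _ k] conjI allI impI)
          show "?D k - a k < d' k" using k(1) le[rule_format, of k] by linarith
          show "?D j - a j = d' j" if "j < k" for j using k(2) that by simp
        qed
        then show ?thesis
          using d'(2) multihom_part_polys[OF F] poly_idealD(5)[OF PD(1)] by blast
      qed
      then show "multihom_part ?D (G * multihom_part a F) \<in> P"
        unfolding multihom_part_mult_multiform'[OF multihom_part_in_multiforms[OF F]]
        using poly_idealD(2)[OF PD(1)] by auto
    qed
    moreover have "multihom_part ?D (F * G) \<in> P" using FG by (auto simp: multihom_core_def)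
    ultimately have "multihom_part d' G * multihom_part d F \<in> P"
      by (simp only: eq poly_ideal_add_iff[OF PD(1)])
    then show False
      using d(1) d'(1) PD(3)[OF multihom_part_polys[OF G] multihom_part_polys[OF F]] by blast
  qed
  ultimately show ?thesis unfolding primeideal_iff using ideal by blast
qed

text \<open>Krull's argument: Zorn's lemma gives an ideal that is maximal among those containing
  \<open>N\<close> and avoiding the multiplicative set \<open>T\<close>, and maximality makes it
  prime.\<close>

lemma exists_prime_disjoint:
  fixes N T :: "'k::field mpoly set"
  assumes N: "poly_ideal I r N"
    and T: "T \<subseteq> polys I r" "1 \<in> T" "\<And>a b. a \<in> T \<Longrightarrow> b \<in> T \<Longrightarrow> a * b \<in> T" "T \<inter> N = {}"
  shows "\<exists>P. primeideal P (coord_ring I r) \<and> N \<subseteq> P \<and> T \<inter> P = {}"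
proof -
  let ?Q = "{A. poly_ideal I r A \<and> N \<subseteq> A \<and> T \<inter> A = {}}"
  have "\<exists>M\<in>?Q. \<forall>X\<in>?Q. M \<subseteq> X \<longrightarrow> X = M"
  proof (rule subset_Zorn_nonempty)
    show "?Q \<noteq> {}" using N T(4) by blast
    fix C assume C: "C \<noteq> {}" "subset.chain ?Q C"
    have CQ: "A \<in> ?Q" if "A \<in> C" for A using C(2) that by (auto simp: subset.chain_def)
    have Ci: "poly_ideal I r A" if "A \<in> C" for A using CQ[OF that] by simp
    have lin: "A \<subseteq> B \<or> B \<subseteq> A" if "A \<in> C" "B \<in> C" for A B
      using C(2) that unfolding subset.chain_def by blast
    have "poly_ideal I r (\<Union>C)"
      unfolding poly_ideal_def
    proof (intro conjI ballI)
      show "\<Union>C \<subseteq> polys I r" using poly_idealD(1)[OF Ci] by blast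
      show "0 \<in> \<Union>C" using C(1) poly_idealD(2)[OF Ci] by blast
      fix F assume "F \<in> \<Union>C"
      then obtain A where A: "A \<in> C" "F \<in> A" by blast
      show "F + G \<in> \<Union>C" if "G \<in> \<Union>C" for G
      proof -
        obtain B where B: "B \<in> C" "G \<in> B" using \<open>G \<in> \<Union>C\<close> by blast
        show ?thesis
          using lin[OF A(1) B(1)] A B poly_idealD(3)[OF Ci] by blast
      qed
      show "G * F \<in> \<Union>C" if "G \<in> polys I r" for G
        using A that poly_idealD(4)[OF Ci] by blast
    qed
    then show "\<Union>C \<in> ?Q" using C(1) CQ by blast
  qed
  then obtain P where P_Q: "P \<in> ?Q" and P_max: "\<forall>X\<in>?Q. P \<subseteq> X \<longrightarrow> X = P"
    by (rule bexE)
  have P: "poly_ideal I r P" "N \<subseteq> P" "T \<inter> P = {}" using P_Q by simp_all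
  have max: "X = P" if "poly_ideal I r X" "N \<subseteq> X" "T \<inter> X = {}" "P \<subseteq> X" for X
    using P_max that by simp
  note PD = poly_idealD[OF P(1)]
  \<comment> \<open>By maximality, adjoining an element outside \<open>P\<close> makes the ideal
    meet \<open>T\<close>. If a product in \<open>P\<close> had both factors outside, the two
    elements of \<open>T\<close> so obtained would have their product in \<open>P\<close>.\<close>
  have ext: "\<exists>p\<in>P. \<exists>g\<in>polys I r. p + g * F \<in> T" if F: "F \<in> polys I r" "F \<notin> P" for F
  proof (rule ccontr)
    assume no: "\<not> ?thesis"
    let ?X = "{p + g * F | p g. p \<in> P \<and> g \<in> polys I r}"
    have "poly_ideal I r ?X"
      unfolding poly_ideal_def
    proof (intro conjI ballI)
      show "?X \<subseteq> polys I r" using PD(1) F(1) by (auto intro!: polys_add polys_mult)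
      have "0 = 0 + 0 * F" by simp
      then show "0 \<in> ?X" using PD(2) polys_0 by blast
      fix H assume "H \<in> ?X"
      then obtain p g where H: "H = p + g * F" "p \<in> P" "g \<in> polys I r" by blast
      show "H + G \<in> ?X" if "G \<in> ?X" for G
      proof -
        obtain p' g' where G: "G = p' + g' * F" "p' \<in> P" "g' \<in> polys I r" using \<open>G \<in> ?X\<close> by blast
        have "H + G = (p + p') + (g + g') * F" unfolding H G by (simp add: algebra_simps)
        then show ?thesis using H G PD(3) polys_add by blast
      qed
      show "G * H \<in> ?X" if "G \<in> polys I r" for G
      proof -
        have "G * H = G * p + (G * g) * F" unfolding H by (simp add: algebra_simps)
        then show ?thesis using H that PD(4) polys_mult by blast
      qed
    qed
    moreover have sub: "P \<subseteq> ?X"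
    proof
      fix p assume "p \<in> P"
      moreover have "p = p + 0 * F" by simp
      ultimately show "p \<in> ?X" using polys_0 by blast
    qed
    moreover have "T \<inter> ?X = {}" using no by blast
    ultimately have "?X = P" using max P(2) by blast
    moreover have "F = 0 + 1 * F" by simp
    then have "F \<in> ?X" using PD(2) polys_1 by blast
    ultimately show False using F(2) by blast
  qed
  have "F \<in> P \<or> G \<in> P" if F: "F \<in> polys I r" and G: "G \<in> polys I r" and FG: "F * G \<in> P" for F G
  proof (rule ccontr)
    assume no: "\<not> ?thesis"
    obtain p g where p: "p \<in> P" "g \<in> polys I r" "p + g * F \<in> T" using ext[OF F] no by blast
    obtain q h where q: "q \<in> P" "h \<in> polys I r" "q + h * G \<in> T" using ext[OF G] no by blast
    have "(p + g * F) * (q + h * G) = (q + h * G) * p + (g * F) * q + (g * h) * (F * G)"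
      by (simp add: algebra_simps)
    also have "\<dots> \<in> P"
    proof (intro PD(3))
      show "(q + h * G) * p \<in> P"
        by (rule PD(4)[OF p(1)]) (intro polys_add polys_mult q(2) G PD(1)[OF q(1)])
      show "(g * F) * q \<in> P"
        by (rule PD(4)[OF q(1)]) (intro polys_mult p(2) F)
      show "(g * h) * (F * G) \<in> P"
        by (rule PD(4)[OF FG]) (intro polys_mult p(2) q(2))
    qed
    finally show False using T(3)[OF p(3) q(3)] P(3) by blast
  qed
  moreover have "1 \<notin> P" using T(2) P(3) by blast
  ultimately show ?thesis using P unfolding primeideal_iff by blast
qed

text \<open>The homogeneous core of the prime found before is still prime. It contains
  \<open>N\<close> because \<open>N\<close> is multihomogeneous, and it avoids \<open>T\<close>
  because it is contained in that prime. This is the source of all points that are constructed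
  later.\<close>

lemma exists_multihom_prime_disjoint:
  fixes N T :: "'k::field mpoly set"
  assumes N: "poly_ideal I r N" "multihom N"
    and T: "\<And>a. a \<in> T \<Longrightarrow> \<exists>d. a \<in> multiforms I r d" "1 \<in> T"
      "\<And>a b. a \<in> T \<Longrightarrow> b \<in> T \<Longrightarrow> a * b \<in> T" "T \<inter> N = {}"
  shows "\<exists>P. primeideal P (coord_ring I r) \<and> multihom P \<and> N \<subseteq> P \<and> T \<inter> P = {}"
proof -
  have "T \<subseteq> polys I r" using T(1) multiforms_polys by blast
  then obtain P where P: "primeideal P (coord_ring I r)" "N \<subseteq> P" "T \<inter> P = {}"
    using exists_prime_disjoint[OF N(1) _ T(2-4)] by blast
  note PD = primeidealD_poly[OF P(1)]
  let ?C = "multihom_core I r P"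
  have "N \<subseteq> ?C" using N(2) P(2) poly_idealD(1)[OF N(1)] by (auto simp: multihom_core_def multihom_def)
  moreover have "?C \<subseteq> P"
  proof
    fix F assume F: "F \<in> ?C"
    have "(\<Sum>d\<in>multideg ` Poly_Mapping.keys F. multihom_part d F) \<in> P"
      by (rule poly_ideal_sum[OF PD(1)]) (use F in \<open>auto simp: multihom_core_def\<close>)
    then show "F \<in> P" using multihom_part_decomp[of F] by simp
  qed
  moreover have "multihom ?C"
    unfolding multihom_def
  proof (intro ballI allI)
    fix F d assume "F \<in> ?C"
    then show "multihom_part d F \<in> ?C"
      using poly_idealD(2)[OF PD(1)]
      by (auto simp: multihom_core_def multihom_part_polys multihom_part_part)
  qed
  ultimately show ?thesis using primeideal_core[OF P(1)] P(3) by blast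
qed

section \<open>Graded algebra homomorphisms\<close>

text \<open>The diagonal multidegree (m, ..., m). Degrees are functions on all naturals, so it has
  to be 0 off \<open>I\<close>.\<close>

definition udeg :: "nat set \<Rightarrow> nat \<Rightarrow> nat \<Rightarrow> nat" where
  "udeg I m = (\<lambda>i. if i \<in> I then m else 0)"

lemma udeg_add: "(\<lambda>i. udeg I a i + udeg I b i) = udeg I (a + b)"
  by (auto simp: udeg_def)

lemma udeg_0: "udeg I 0 = (\<lambda>_. 0)"
  by (auto simp: udeg_def)

lemma Var_udeg:
  assumes "j \<le> n"
  shows "Var 1 j \<in> multiforms {1} (\<lambda>_. n) (udeg {1} 1)"
proof -
  have "Var 1 j \<in> multiforms {1} (\<lambda>_. n) (\<lambda>i'. if i' = 1 then 1 else 0)"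
    using assms by (intro multiforms_Var) auto
  also have "(\<lambda>i'. if i' = 1 then 1 else 0) = udeg {1} 1" by (auto simp: udeg_def)
  finally show ?thesis .
qed

locale alg_hom =
  fixes \<phi> :: "'k::field mpoly \<Rightarrow> 'k mpoly"
  assumes hom_add: "\<phi> (F + G) = \<phi> F + \<phi> G"
    and hom_mult: "\<phi> (F * G) = \<phi> F * \<phi> G"
    and hom_Cst: "\<phi> (Cst c) = Cst c"
begin

lemma hom_0: "\<phi> 0 = 0" and hom_1: "\<phi> 1 = 1"
  using hom_Cst[of 0] hom_Cst[of 1] by (simp_all only: Cst_0 Cst_1)

lemma hom_uminus: "\<phi> (- F) = - \<phi> F"
proof -
  have "\<phi> (- F) + \<phi> F = 0" by (simp only: hom_add[symmetric] add.left_inverse hom_0)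
  then show ?thesis by (simp only: eq_neg_iff_add_eq_0)
qed

lemma hom_diff: "\<phi> (F - G) = \<phi> F - \<phi> G"
  by (simp only: diff_conv_add_uminus hom_add hom_uminus)

lemma hom_sum: "\<phi> (\<Sum>x\<in>A. f x) = (\<Sum>x\<in>A. \<phi> (f x))"
  by (induction A rule: infinite_finite_induct) (simp_all add: hom_0 hom_add)

lemma hom_prod: "\<phi> (\<Prod>x\<in>A. f x) = (\<Prod>x\<in>A. \<phi> (f x))"
  by (induction A rule: infinite_finite_induct) (simp_all add: hom_1 hom_mult)

lemma hom_power: "\<phi> (F ^ k) = \<phi> F ^ k"
  by (induction k) (simp_all add: hom_1 hom_mult)

end

lemma alg_hom_psubst: "alg_hom (psubst g)"
  by unfold_locales (simp_all only: psubst_add psubst_mult psubst_Cst)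

text \<open>The second hypothesis says that the degree of the image of a monomial depends only on
  its multidegree; then all monomials of a form land in one degree.\<close>

lemma psubst_multiforms:
  assumes g: "\<And>v. v \<in> coords I' r' \<Longrightarrow> g v \<in> multiforms I r (e v)"
    and D: "\<And>m. Poly_Mapping.keys m \<subseteq> coords I' r' \<Longrightarrow> multideg m = d \<Longrightarrow>
          (\<lambda>i. \<Sum>v\<in>Poly_Mapping.keys m. Poly_Mapping.lookup m v * e v i) = D"
    and F: "F \<in> multiforms I' r' d"
  shows "psubst g F \<in> multiforms I r D"
proof -
  have "psubst g F = (\<Sum>m\<in>Poly_Mapping.keys F.
      Cst (Poly_Mapping.lookup F m) * (\<Prod>v\<in>Poly_Mapping.keys m. g v ^ Poly_Mapping.lookup m v))"
    by (simp only: psubst_def)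
  also have "\<dots> \<in> multiforms I r D"
  proof (rule multiforms_sum, rule multiforms_Cst_mult)
    fix m assume m: "m \<in> Poly_Mapping.keys F"
    have k: "Poly_Mapping.keys m \<subseteq> coords I' r'" "multideg m = d"
      using F m by (auto simp: multiforms_def polys_def)
    have "(\<Prod>v\<in>Poly_Mapping.keys m. g v ^ Poly_Mapping.lookup m v) \<in>
        multiforms I r (\<lambda>i. \<Sum>v\<in>Poly_Mapping.keys m. Poly_Mapping.lookup m v * e v i)"
      by (rule multiforms_prod) (use k(1) in \<open>auto intro!: multiforms_power g\<close>)
    then show "(\<Prod>v\<in>Poly_Mapping.keys m. g v ^ Poly_Mapping.lookup m v) \<in> multiforms I r D"
      unfolding D[OF k] .
  qed
  finally show ?thesis .
qed

text \<open>\<open>\<delta>\<close> is the effect on degrees. \<open>deg_inj\<close> keeps different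
  homogeneous parts apart, so that contractions of multihomogeneous ideals are multihomogeneous. It
  is confined to degrees supported on \<open>I'\<close>, the only ones with nonzero forms, since for
  \<open>esym n\<close> the map \<open>\<delta>\<close> sees just one entry of the degree.\<close>

locale graded_hom = alg_hom \<phi> for \<phi> :: "'k::field mpoly \<Rightarrow> 'k mpoly" +
  fixes I :: "nat set" and r :: "nat \<Rightarrow> nat" and I' :: "nat set" and r' :: "nat \<Rightarrow> nat"
    and \<delta> :: "(nat \<Rightarrow> nat) \<Rightarrow> nat \<Rightarrow> nat"
  assumes hom_multiforms: "F \<in> multiforms I' r' d \<Longrightarrow> \<phi> F \<in> multiforms I r (\<delta> d)"
    and deg_inj: "\<delta> d = \<delta> e \<Longrightarrow> (\<And>i. i \<notin> I' \<Longrightarrow> d i = 0) \<Longrightarrow> (\<And>i. i \<notin> I' \<Longrightarrow> e i = 0) \<Longrightarrow> d = e"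
begin

lemma hom_polys: "F \<in> polys I' r' \<Longrightarrow> \<phi> F \<in> polys I r"
proof -
  assume F: "F \<in> polys I' r'"
  have "\<phi> F = (\<Sum>d\<in>multideg ` Poly_Mapping.keys F. \<phi> (multihom_part d F))"
    using arg_cong[OF multihom_part_decomp[of F], of \<phi>] by (simp only: hom_sum)
  also have "\<dots> \<in> polys I r"
    by (rule polys_sum) (rule multiforms_polys[OF hom_multiforms[OF multihom_part_in_multiforms[OF F]]])
  finally show ?thesis .
qed

lemma hom_part:
  assumes F: "F \<in> polys I' r'" and d: "\<And>i. i \<notin> I' \<Longrightarrow> d i = 0"
  shows "multihom_part (\<delta> d) (\<phi> F) = \<phi> (multihom_part d F)"
proof -
  let ?K = "multideg ` Poly_Mapping.keys F"
  have K: "e i = 0" if "e \<in> ?K" "i \<notin> I'" for e i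
    using that F by (fastforce simp: polys_def coords_def multideg_def intro!: sum.neutral)
  have "multihom_part (\<delta> d) (\<phi> F) = (\<Sum>e\<in>?K. multihom_part (\<delta> d) (\<phi> (multihom_part e F)))"
    using arg_cong[OF multihom_part_decomp[of F], of "\<lambda>F. multihom_part (\<delta> d) (\<phi> F)"]
    by (simp only: hom_sum multihom_part_sum)
  also have "\<dots> = (\<Sum>e\<in>?K. if e = d then \<phi> (multihom_part d F) else 0)"
  proof (rule sum.cong[OF refl])
    fix e assume e: "e \<in> ?K"
    have "\<delta> d = \<delta> e \<longleftrightarrow> e = d" using deg_inj[of d e] d K[OF e] by auto
    then show "multihom_part (\<delta> d) (\<phi> (multihom_part e F)) = (if e = d then \<phi> (multihom_part d F) else 0)"
      unfolding multihom_part_multiforms[OF hom_multiforms[OF multihom_part_in_multiforms[OF F]]]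
      by auto
  qed
  also have "\<dots> = \<phi> (multihom_part d F)"
    using multihom_part_eq_0[of d F] by (auto simp: hom_0)
  finally show ?thesis .
qed

lemma hom_part_support:
  assumes F: "F \<in> polys I' r'" and d: "\<not> (\<forall>i. i \<notin> I' \<longrightarrow> d i = 0)"
  shows "multihom_part d F = 0"
proof (rule multihom_part_eq_0)
  have "e i = 0" if "e \<in> multideg ` Poly_Mapping.keys F" "i \<notin> I'" for e i
    using that F by (fastforce simp: polys_def coords_def multideg_def intro!: sum.neutral)
  then show "d \<notin> multideg ` Poly_Mapping.keys F" using d by blast
qed

lemma contraction_ideal:
  assumes A: "poly_ideal I r A"
  shows "poly_ideal I' r' {F \<in> polys I' r'. \<phi> F \<in> A}"
  unfolding poly_ideal_def
  using poly_idealD[OF A]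
  by (auto simp: hom_add hom_mult hom_0 polys_0 polys_add polys_mult hom_polys)

text \<open>In degrees supported on \<open>I'\<close>, homogeneous parts of \<open>F\<close> become
  homogeneous parts of \<open>\<phi> F\<close>; in all other degrees \<open>F\<close> has no
  part.\<close>

lemma contraction_multihom:
  assumes A: "multihom A" "0 \<in> A"
  shows "multihom {F \<in> polys I' r'. \<phi> F \<in> A}"
  unfolding multihom_def
proof (intro ballI allI)
  fix F d assume F: "F \<in> {F \<in> polys I' r'. \<phi> F \<in> A}"
  have "\<phi> (multihom_part d F) \<in> A"
  proof (cases "\<forall>i. i \<notin> I' \<longrightarrow> d i = 0")
    case True
    then have "\<phi> (multihom_part d F) = multihom_part (\<delta> d) (\<phi> F)"
      using F hom_part[of F d] by simp
    then show ?thesis using A(1) F by (simp add: multihom_def)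
  next
    case False
    then show ?thesis using hom_part_support[of F d] F A(2) by (simp add: hom_0)
  qed
  then show "multihom_part d F \<in> {F \<in> polys I' r'. \<phi> F \<in> A}"
    using F by (simp add: multihom_part_polys)
qed

lemma contraction_prime:
  assumes P: "primeideal P (coord_ring I r)"
  shows "primeideal {F \<in> polys I' r'. \<phi> F \<in> P} (coord_ring I' r')"
  unfolding primeideal_iff
  using contraction_ideal[OF primeidealD_poly(1)[OF P]] primeidealD_poly(2,3)[OF P]
  by (auto simp: hom_mult hom_1 hom_polys)

end

text \<open>A monomial of positive degree in factor \<open>i\<close> is divisible by one of the
  coordinates of that factor. This is how constructed primes are seen to be relevant.\<close>

lemma multiform_in_ideal:
  assumes P: "poly_ideal I r P" and i: "d i > 0" "\<And>j. j \<le> r i \<Longrightarrow> Var i j \<in> P"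
    and F: "F \<in> multiforms I r d"
  shows "F \<in> P"
proof -
  note PD = poly_idealD[OF P]
  have "Poly_Mapping.single m c \<in> P"
    if m: "Poly_Mapping.keys m \<subseteq> coords I r" "multideg m = d" for m c
  proof -
    have "multideg m i \<noteq> 0" using m i by simp
    then obtain v where v: "v \<in> Poly_Mapping.keys m" "fst v = i"
      unfolding multideg_def by (elim sum.not_neutral_contains_not_neutral) blast
    define m' where "m' = m - Poly_Mapping.single v 1"
    have v1: "Poly_Mapping.lookup m v \<ge> 1" using v(1) by (simp add: in_keys_iff)
    have m': "m = m' + Poly_Mapping.single v 1"
      by (rule poly_mapping_eqI) (use v1 in \<open>auto simp: m'_def lookup_add lookup_minus lookup_single when_def\<close>)
    have "Poly_Mapping.keys m' \<subseteq> Poly_Mapping.keys m"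
      unfolding m' by (auto simp: in_keys_iff lookup_add)
    then have k: "Poly_Mapping.single m' c \<in> polys I r" using m by (auto simp: polys_def)
    obtain j where vj: "v = (i, j)" "j \<le> r i" using v m(1) by (cases v) (auto simp: coords_def)
    have "Poly_Mapping.single m c = Poly_Mapping.single m' c * Var i j"
      by (subst m') (simp add: Var_def mult_single vj)
    then show ?thesis using PD(4)[OF i(2)[OF vj(2)] k] by (simp only:)
  qed
  then have "(\<Sum>m\<in>Poly_Mapping.keys F. Poly_Mapping.single m (Poly_Mapping.lookup F m)) \<in> P"
    by (intro poly_ideal_sum[OF P]) (use F in \<open>auto simp: multiforms_def polys_def\<close>)
  then show ?thesis using mpoly_as_sum[of F] by (simp only:)
qed

section \<open>Elementary symmetric polynomials and permutations\<close>

definition esym :: "nat \<Rightarrow> 'k::field mpoly \<Rightarrow> 'k mpoly" where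
  "esym n = psubst (\<lambda>(_, j). elem_hom n j)"

definition perm_vars :: "(nat \<Rightarrow> nat) \<Rightarrow> 'k::field mpoly \<Rightarrow> 'k mpoly" where
  "perm_vars \<sigma> = psubst (\<lambda>(i, j). Var (Hilbert_Choice.inv \<sigma> i) j)"

interpretation esym: alg_hom "esym n :: 'k::field mpoly \<Rightarrow> _"
  unfolding esym_def by (rule alg_hom_psubst)

interpretation perm_vars: alg_hom "perm_vars \<sigma> :: 'k::field mpoly \<Rightarrow> _"
  unfolding perm_vars_def by (rule alg_hom_psubst)

lemma esym_Var: "esym n (Var i j) = elem_hom n j"
  by (simp add: esym_def psubst_Var)

lemma perm_vars_Var: "perm_vars \<sigma> (Var i j) = Var (Hilbert_Choice.inv \<sigma> i) j"
  by (simp add: perm_vars_def psubst_Var)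

lemma elem_hom_udeg: "elem_hom n j \<in> multiforms {1..n} (\<lambda>_. 1) (udeg {1..n} 1)"
  using elem_hom_multiform[of n j] by (simp only: udeg_def)

lemma esym_multiforms:
  assumes "F \<in> multiforms {1} (\<lambda>_. n) d"
  shows "esym n F \<in> multiforms {1..n} (\<lambda>_. 1) (udeg {1..n} (d 1))"
  unfolding esym_def
proof (rule psubst_multiforms[OF _ _ assms])
  fix v :: "nat \<times> nat"
  show "(case v of (_, j) \<Rightarrow> elem_hom n j) \<in> multiforms {1..n} (\<lambda>_. 1) (udeg {1..n} 1)"
    by (cases v) (simp only: prod.case elem_hom_udeg)
next
  fix m assume m: "Poly_Mapping.keys m \<subseteq> coords {1} (\<lambda>_. n)" "multideg m = d"
  have "{v \<in> Poly_Mapping.keys m. fst v = 1} = Poly_Mapping.keys m"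
    using m(1) by (auto simp: coords_def)
  then have "d 1 = (\<Sum>v\<in>Poly_Mapping.keys m. Poly_Mapping.lookup m v)"
    using m(2)[symmetric] by (simp add: multideg_def)
  then show "(\<lambda>i. \<Sum>v\<in>Poly_Mapping.keys m. Poly_Mapping.lookup m v * udeg {1..n} 1 i) = udeg {1..n} (d 1)"
    by (auto simp: udeg_def)
qed

lemma perm_vars_multiforms:
  assumes \<sigma>: "\<sigma> permutes {1..n}" and F: "F \<in> multiforms {1..n} (\<lambda>_. 1) d"
  shows "perm_vars \<sigma> F \<in> multiforms {1..n} (\<lambda>_. 1) (\<lambda>i. d (\<sigma> i))"
  unfolding perm_vars_def
proof (rule psubst_multiforms[OF _ _ F])
  fix v :: "nat \<times> nat" assume "v \<in> coords {1..n} (\<lambda>_. 1)"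
  then obtain i j where v: "v = (i, j)" "i \<in> {1..n}" "j \<le> 1" by (auto simp: coords_def)
  have "Hilbert_Choice.inv \<sigma> i \<in> {1..n}" using permutes_in_image[OF permutes_inv[OF \<sigma>]] v by blast
  then show "(case v of (i, j) \<Rightarrow> Var (Hilbert_Choice.inv \<sigma> i) j) \<in>
      multiforms {1..n} (\<lambda>_. 1) (\<lambda>i'. if i' = Hilbert_Choice.inv \<sigma> (fst v) then 1 else 0)"
    unfolding v prod.case fst_conv by (rule multiforms_Var) (use v in auto)
next
  fix m assume m: "Poly_Mapping.keys m \<subseteq> coords {1..n} (\<lambda>_. 1)" "multideg m = d"
  have iff: "i = Hilbert_Choice.inv \<sigma> k \<longleftrightarrow> k = \<sigma> i" for i k
    using permutes_inverses[OF \<sigma>] by metis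
  show "(\<lambda>i. \<Sum>v\<in>Poly_Mapping.keys m. Poly_Mapping.lookup m v *
      (if i = Hilbert_Choice.inv \<sigma> (fst v) then 1 else 0)) = (\<lambda>i. d (\<sigma> i))"
    unfolding m(2)[symmetric] multideg_def iff
    by (auto simp: sum.inter_filter intro!: ext sum.cong)
qed

lemma perm_vars_udeg:
  assumes \<sigma>: "\<sigma> permutes {1..n}" and F: "F \<in> multiforms {1..n} (\<lambda>_. 1) (udeg {1..n} m)"
  shows "perm_vars \<sigma> F \<in> multiforms {1..n} (\<lambda>_. 1) (udeg {1..n} m)"
proof -
  have "(\<lambda>i. udeg {1..n} m (\<sigma> i)) = udeg {1..n} m"
    using permutes_in_image[OF \<sigma>] by (auto simp: udeg_def fun_eq_iff)
  then show ?thesis using perm_vars_multiforms[OF assms] by (simp only:)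
qed

lemma graded_hom_perm_vars:
  assumes \<sigma>: "\<sigma> permutes {1..n}"
  shows "graded_hom (perm_vars \<sigma> :: 'k::field mpoly \<Rightarrow> _) {1..n} (\<lambda>_. 1) {1..n} (\<lambda>_. 1) (\<lambda>d i. d (\<sigma> i))"
proof unfold_locales
  fix d e :: "nat \<Rightarrow> nat" assume "(\<lambda>i. d (\<sigma> i)) = (\<lambda>i. e (\<sigma> i))"
  then have "d (\<sigma> (Hilbert_Choice.inv \<sigma> i)) = e (\<sigma> (Hilbert_Choice.inv \<sigma> i))" for i by meson
  then show "d = e" using permutes_inverses[OF \<sigma>] by auto
qed (rule perm_vars_multiforms[OF \<sigma>])

lemma graded_hom_esym:
  assumes "n \<ge> 1"
  shows "graded_hom (esym n :: 'k::field mpoly \<Rightarrow> _) {1..n} (\<lambda>_. 1) {1} (\<lambda>_. n) (\<lambda>d. udeg {1..n} (d 1))"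
proof unfold_locales
  fix d e :: "nat \<Rightarrow> nat"
  assume eq: "udeg {1..n} (d 1) = udeg {1..n} (e 1)" "\<And>i. i \<notin> {1} \<Longrightarrow> d i = 0" "\<And>i. i \<notin> {1} \<Longrightarrow> e i = 0"
  have "d 1 = e 1" using fun_cong[OF eq(1), of 1] assms by (simp add: udeg_def)
  then show "d = e" using eq(2,3) by (intro ext, case_tac "x = 1") auto
qed (rule esym_multiforms)

section \<open>Composition of permutations of the variables\<close>

lemma psubst_Var_id:
  fixes F :: "'k::field mpoly"
  shows "psubst (\<lambda>(i, j). Var i j) F = F"
proof (induction F rule: mpoly_sum_induct)
  case (single m c)
  have pow: "(Var i j :: 'k mpoly) ^ k = Poly_Mapping.single (Poly_Mapping.single (i, j) k) 1" for i j k
  proof (induction k)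
    case (Suc k)
    then show ?case
      by (simp add: Var_def mult_single single_add[symmetric])
  qed simp
  have "(\<Prod>v\<in>A. (case v of (i, j) \<Rightarrow> Var i j) ^ Poly_Mapping.lookup m v) =
      (Poly_Mapping.single (\<Sum>v\<in>A. Poly_Mapping.single v (Poly_Mapping.lookup m v)) 1 :: 'k mpoly)"
    if "finite A" for A
    using that by (induction A) (simp_all add: pow mult_single split: prod.split)
  from this[of "Poly_Mapping.keys m"]
  have "(\<Prod>v\<in>Poly_Mapping.keys m. (case v of (i, j) \<Rightarrow> Var i j) ^ Poly_Mapping.lookup m v) =
      (Poly_Mapping.single (\<Sum>v\<in>Poly_Mapping.keys m. Poly_Mapping.single v (Poly_Mapping.lookup m v)) 1 :: 'k mpoly)"
    by simp
  also have "(\<Sum>v\<in>Poly_Mapping.keys m. Poly_Mapping.single v (Poly_Mapping.lookup m v)) = m"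
    by (rule poly_mapping_eqI) (auto simp: lookup_sum lookup_single when_def not_in_keys_iff_lookup_eq_zero)
  finally show ?case by (simp add: psubst_single Cst_def mult_single)
qed (simp add: psubst_add)

lemma perm_vars_id: "perm_vars id F = F"
  unfolding perm_vars_def inv_id id_apply by (rule psubst_Var_id)

text \<open>Functions are pulled back, so the order of composition is reversed; the contraction
  \<open>perm_pt\<close> reverses it once more and gives a left action on points.\<close>

lemma perm_vars_comp:
  assumes "\<sigma> permutes S" "\<tau> permutes S"
  shows "perm_vars \<sigma> (perm_vars \<tau> F) = perm_vars (\<tau> \<circ> \<sigma>) F"
proof -
  have "Hilbert_Choice.inv (\<tau> \<circ> \<sigma>) = Hilbert_Choice.inv \<sigma> \<circ> Hilbert_Choice.inv \<tau>"
    by (rule o_inv_distrib) (use assms permutes_bij in auto)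
  then show ?thesis
    unfolding perm_vars_def psubst_psubst
    by (intro arg_cong2[of _ _ _ _ psubst] refl ext) (simp add: psubst_Var split: prod.split)
qed

lemma perm_vars_inv:
  assumes "\<sigma> permutes S"
  shows "perm_vars (Hilbert_Choice.inv \<sigma>) (perm_vars \<sigma> F) = F" "perm_vars \<sigma> (perm_vars (Hilbert_Choice.inv \<sigma>) F) = F"
  by (simp_all only: permutes_inv_o[OF assms] perm_vars_comp[OF assms permutes_inv[OF assms]]
    perm_vars_comp[OF permutes_inv[OF assms] assms] perm_vars_id)

text \<open>Evaluation of \<open>split_form\<close> at X = \<alpha> and Y = \<beta>. Apart from
  their degree, this is all that is used about the elementary symmetric polynomials below.\<close>

lemma elem_hom_identity:
  "(\<Sum>j\<le>n. Cst ((-1) ^ j * \<alpha> ^ (n - j) * \<beta> ^ j) * elem_hom n j) =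
     (\<Prod>i=1..n. Cst \<alpha> * Var i 0 - Cst \<beta> * Var i 1)"
proof -
  have "poly (poly (split_form n) [:Cst \<alpha>:]) (Cst \<beta>) = (\<Prod>i=1..n. Cst \<alpha> * Var i 0 - Cst \<beta> * Var i 1)"
    by (simp add: split_form_def poly_prod poly_monom mult.commute)
  moreover have "poly (poly (split_form n) [:Cst \<alpha>:]) (Cst \<beta>) =
      (\<Sum>j\<le>n. Cst ((-1) ^ j * \<alpha> ^ (n - j) * \<beta> ^ j) * elem_hom n j)"
    unfolding split_form_eq
    by (auto simp: poly_sum poly_monom Cst_mult Cst_power Cst_uminus_1 mult_ac intro!: sum.cong)
  ultimately show ?thesis by (simp only:)
qed

text \<open>A polynomial over a domain with infinitely many constants as roots is zero. The
  exponents \<open>f j\<close> are left open because comparisons are made in powers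
  \<open>\<beta> ^ j\<close> as well as \<open>\<beta> ^ (n - j)\<close>.\<close>

lemma Cst_polynomial_eq:
  fixes u v :: "nat \<Rightarrow> 'k::field_char_0 mpoly"
  assumes inj: "inj_on f {..n}"
    and eq: "\<And>\<beta>. (\<Sum>j\<le>n. Cst (\<beta> ^ f j) * u j) = (\<Sum>j\<le>n. Cst (\<beta> ^ f j) * v j)"
    and j: "j \<le> n"
  shows "u j = v j"
proof -
  define q where "q = (\<Sum>j\<le>n. monom (u j - v j) (f j))"
  have "poly q (Cst \<beta>) = 0" for \<beta>
  proof -
    have "poly q (Cst \<beta>) = (\<Sum>j\<le>n. Cst (\<beta> ^ f j) * u j) - (\<Sum>j\<le>n. Cst (\<beta> ^ f j) * v j)"
      by (simp add: q_def poly_sum poly_monom sum_subtractf[symmetric] Cst_power algebra_simps)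
    then show ?thesis by (simp only: eq diff_self)
  qed
  then have "range Cst \<subseteq> {x. poly q x = 0}" by auto
  moreover have "infinite (range Cst :: 'k mpoly set)"
    using infinite_UNIV_char_0[where 'a = 'k]
    by (subst finite_image_iff) (auto simp: inj_on_def Cst_inject)
  ultimately have "q = 0" using poly_roots_finite[of q] finite_subset by blast
  have "coeff q (f j) = (\<Sum>i\<le>n. if i = j then u j - v j else 0)"
    unfolding q_def coeff_sum using inj j by (intro sum.cong) (auto simp: inj_on_def)
  then show ?thesis using j \<open>q = 0\<close> by simp
qed

text \<open>A permutation only rearranges the factors of the product in
  \<open>elem_hom_identity\<close>; taking \<alpha> = 1 and comparing powers of \<beta> gives the
  claim.\<close>

lemma perm_vars_elem_hom:
  assumes \<sigma>: "\<sigma> permutes {1..n}" and j: "j \<le> n"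
  shows "perm_vars \<sigma> (elem_hom n j :: 'k::field_char_0 mpoly) = elem_hom n j"
proof -
  have "Cst ((-1) ^ j) * perm_vars \<sigma> (elem_hom n j) = Cst ((-1) ^ j) * (elem_hom n j :: 'k mpoly)"
  proof (rule Cst_polynomial_eq[where f = id and n = n])
    fix \<beta> :: 'k
    have "(\<Sum>j\<le>n. Cst ((-1) ^ j * 1 ^ (n - j) * \<beta> ^ j) * perm_vars \<sigma> (elem_hom n j)) =
        perm_vars \<sigma> (\<Prod>i=1..n. Cst 1 * Var i 0 - Cst \<beta> * Var i 1)"
      unfolding elem_hom_identity[symmetric]
      by (simp only: perm_vars.hom_sum perm_vars.hom_mult perm_vars.hom_Cst)
    also have "\<dots> = (\<Prod>i=1..n. Cst 1 * Var (Hilbert_Choice.inv \<sigma> i) 0 - Cst \<beta> * Var (Hilbert_Choice.inv \<sigma> i) 1)"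
      by (simp only: perm_vars.hom_prod perm_vars.hom_diff perm_vars.hom_mult perm_vars.hom_Cst perm_vars_Var)
    also have "\<dots> = (\<Prod>i=1..n. Cst 1 * Var i 0 - Cst \<beta> * Var i 1)"
      by (subst (2) prod.permute[OF permutes_inv[OF \<sigma>]]) (simp only: o_def)
    also have "\<dots> = (\<Sum>j\<le>n. Cst ((-1) ^ j * 1 ^ (n - j) * \<beta> ^ j) * elem_hom n j)"
      by (simp only: elem_hom_identity)
    finally have "(\<Sum>j\<le>n. Cst ((-1) ^ j * 1 ^ (n - j) * \<beta> ^ j) * perm_vars \<sigma> (elem_hom n j)) =
        (\<Sum>j\<le>n. Cst ((-1) ^ j * 1 ^ (n - j) * \<beta> ^ j) * elem_hom n j)" .
    then show "(\<Sum>j\<le>n. Cst (\<beta> ^ id j) * (Cst ((-1) ^ j) * perm_vars \<sigma> (elem_hom n j))) =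
        (\<Sum>j\<le>n. Cst (\<beta> ^ id j) * (Cst ((-1) ^ j) * elem_hom n j))"
      by (simp only: Cst_mult power_one mult_1_left mult_1_right Cst_1 id_apply mult_ac)
  qed (use j in auto)
  moreover have "Cst ((-1) ^ j) \<noteq> (0 :: 'k mpoly)"
    unfolding Cst_0[symmetric] Cst_inject by simp
  ultimately show ?thesis by (simp only: mult_cancel_left simp_thms)
qed

lemma perm_vars_esym:
  assumes \<sigma>: "\<sigma> permutes {1..n}" and F: "F \<in> polys {1} (\<lambda>_. n)"
  shows "perm_vars \<sigma> (esym n F :: 'k::field_char_0 mpoly) = esym n F"
  unfolding esym_def perm_vars_def psubst_psubst
  unfolding perm_vars_def[symmetric]
proof (rule psubst_cong)
  fix v assume "v \<in> \<Union> (Poly_Mapping.keys ` Poly_Mapping.keys F)"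
  then have "v \<in> coords {1} (\<lambda>_. n)" using F by (auto simp: polys_def)
  then show "perm_vars \<sigma> (case v of (_, j) \<Rightarrow> elem_hom n j) = (case v of (_, j) \<Rightarrow> (elem_hom n j :: 'k mpoly))"
    using perm_vars_elem_hom[OF \<sigma>] by (auto simp: coords_def)
qed

subsection \<open>Algebraic independence\<close>

text \<open>Uniqueness of digits: reduction modulo \<open>B\<close> yields the lowest one.\<close>

lemma base_expansion_inj:
  fixes d e :: "nat \<Rightarrow> nat"
  assumes "\<And>i. i < N \<Longrightarrow> d i < B" "\<And>i. i < N \<Longrightarrow> e i < B"
    and "(\<Sum>i<N. d i * B ^ i) = (\<Sum>i<N. e i * B ^ i)"
  shows "\<forall>i<N. d i = e i"
  using assms
proof (induction N arbitrary: d e)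
  case (Suc N)
  have split: "(\<Sum>i<Suc N. f i * B ^ i) = f 0 + B * (\<Sum>i<N. f (Suc i) * B ^ i)" for f :: "nat \<Rightarrow> nat"
    unfolding sum.lessThan_Suc_shift sum_distrib_left by (simp add: mult_ac)
  have eq: "d 0 + B * (\<Sum>i<N. d (Suc i) * B ^ i) = e 0 + B * (\<Sum>i<N. e (Suc i) * B ^ i)"
    using Suc.prems(3) unfolding split .
  have B: "d 0 < B" "e 0 < B" using Suc.prems by auto
  have 0: "d 0 = e 0"
    using arg_cong[OF eq, of "\<lambda>x. x mod B"] B by simp
  then have "(\<Sum>i<N. d (Suc i) * B ^ i) = (\<Sum>i<N. e (Suc i) * B ^ i)"
    using eq B by simp
  then have "\<forall>i<N. d (Suc i) = e (Suc i)"
    by (intro Suc.IH[of "\<lambda>i. d (Suc i)" "\<lambda>i. e (Suc i)"] Suc.prems(1,2)) simp_all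
  then show ?case using 0 by (auto simp: less_Suc_eq_0_disj)
qed simp

text \<open>By Kronecker substitution this reduces to polynomials in one variable.\<close>

lemma mpoly_eq_0_if_vanishes:
  fixes F :: "'k::field_char_0 mpoly"
  assumes F: "F \<in> polys {1} (\<lambda>_. n)"
    and ev: "\<And>b. b (1, 0) \<noteq> 0 \<Longrightarrow> psubst (\<lambda>v. Cst (b v)) F = 0"
  shows "F = 0"
proof (rule ccontr)
  assume "F \<noteq> 0"
  then obtain m0 where m0: "m0 \<in> Poly_Mapping.keys F" by fastforce
  \<comment> \<open>\<open>B\<close> exceeds every exponent in \<open>F\<close>, so the exponents of
    a monomial are the base-\<open>B\<close> digits of \<open>w m\<close>, and the substitution of
    \<open>t ^ B ^ j\<close> for variable \<open>j\<close> sends distinct monomials to distinct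
    powers of \<open>t\<close>.\<close>
  define B where "B = Suc (\<Sum>m\<in>Poly_Mapping.keys F. \<Sum>v\<in>Poly_Mapping.keys m. Poly_Mapping.lookup m v)"
  have B: "Poly_Mapping.lookup m v < B" if m: "m \<in> Poly_Mapping.keys F" for m v
  proof (cases "v \<in> Poly_Mapping.keys m")
    case True
    have "Poly_Mapping.lookup m v \<le> (\<Sum>v\<in>Poly_Mapping.keys m. Poly_Mapping.lookup m v)"
      by (rule member_le_sum) (use True in auto)
    also have "\<dots> \<le> (\<Sum>m\<in>Poly_Mapping.keys F. \<Sum>v\<in>Poly_Mapping.keys m. Poly_Mapping.lookup m v)"
      using m by (intro member_le_sum) auto
    finally show ?thesis by (simp add: B_def)
  qed (simp add: B_def in_keys_iff)
  define w where "w m = (\<Sum>j<Suc n. Poly_Mapping.lookup m (1, j) * B ^ j)" for m :: "(nat \<times> nat) \<Rightarrow>\<^sub>0 nat"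
  have keys: "Poly_Mapping.keys m \<subseteq> coords {1} (\<lambda>_. n)" if "m \<in> Poly_Mapping.keys F" for m
    using F that by (auto simp: polys_def)
  have w_inj: "inj_on w (Poly_Mapping.keys F)"
  proof (rule inj_onI)
    fix m m' assume m: "m \<in> Poly_Mapping.keys F" "m' \<in> Poly_Mapping.keys F" "w m = w m'"
    have "\<forall>j<Suc n. Poly_Mapping.lookup m (1, j) = Poly_Mapping.lookup m' (1, j)"
      by (rule base_expansion_inj[of _ _ B]) (use m B in \<open>auto simp: w_def\<close>)
    moreover have "Poly_Mapping.lookup m v = 0 \<and> Poly_Mapping.lookup m' v = 0" if "v \<notin> coords {1} (\<lambda>_. n)" for v
      using keys[OF m(1)] keys[OF m(2)] that by (auto simp: in_keys_iff)
    ultimately show "m = m'"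
      by (intro poly_mapping_eqI, case_tac "k \<in> coords {1} (\<lambda>_. n)") (auto simp: coords_def)
  qed
  define p where "p = (\<Sum>m\<in>Poly_Mapping.keys F. monom (Poly_Mapping.lookup F m) (w m))"
  \<comment> \<open>The hypothesis on \<open>b (1, 0)\<close> costs only the value
    \<open>t = 0\<close>, which leaves infinitely many roots.\<close>
  have root: "poly p t = 0" if t: "t \<noteq> 0" for t
  proof -
    have mon: "(\<Prod>v\<in>Poly_Mapping.keys m. Cst (t ^ B ^ snd v) ^ Poly_Mapping.lookup m v) = Cst (t ^ w m)"
      if "m \<in> Poly_Mapping.keys F" for m
    proof -
      have "(\<Prod>v\<in>Poly_Mapping.keys m. Cst (t ^ B ^ snd v) ^ Poly_Mapping.lookup m v) =
          (\<Prod>v\<in>Pair 1 ` {..<Suc n}. Cst (t ^ B ^ snd v) ^ Poly_Mapping.lookup m v)"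
        by (rule prod_keys_superset) (use keys[OF that] in \<open>auto simp: coords_def\<close>)
      also have "\<dots> = (\<Prod>j<Suc n. Cst ((t ^ B ^ j) ^ Poly_Mapping.lookup m (1, j)))"
        by (subst prod.reindex) (auto simp: inj_on_def Cst_power)
      also have "\<dots> = Cst (t ^ w m)"
        unfolding Cst_prod[symmetric] w_def power_sum by (simp add: power_mult[symmetric] mult.commute)
      finally show ?thesis .
    qed
    have "Cst (poly p t) = psubst (\<lambda>v. Cst (t ^ B ^ snd v)) F"
      unfolding p_def poly_sum poly_monom Cst_sum psubst_def
      by (intro sum.cong refl) (simp only: Cst_mult mon)
    also have "\<dots> = 0" by (rule ev[of "\<lambda>v. t ^ B ^ snd v"]) (use t in simp)
    finally show ?thesis unfolding Cst_0[symmetric] Cst_inject .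
  qed
  have "infinite (UNIV - {0 :: 'k})" using infinite_UNIV_char_0[where 'a = 'k] by simp
  moreover have "UNIV - {0} \<subseteq> {t. poly p t = 0}" using root by auto
  ultimately have "p = 0" using poly_roots_finite[of p] finite_subset by blast
  moreover have "coeff p (w m0) = (\<Sum>m\<in>Poly_Mapping.keys F. if m = m0 then Poly_Mapping.lookup F m else 0)"
    unfolding p_def coeff_sum using w_inj m0 by (intro sum.cong) (auto simp: inj_on_def)
  ultimately show False using m0 by (simp add: in_keys_iff)
qed

text \<open>A polynomial of degree \<open>n\<close> over an algebraically closed field splits, and
  its roots serve as the ratios of the two coordinates of the factors.\<close>

lemma elem_hom_values:
  fixes b :: "nat \<Rightarrow> 'k::{alg_closed_field, field_char_0}"
  assumes "b 0 \<noteq> 0" "n \<ge> 1"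
  obtains a where "\<And>j. j \<le> n \<Longrightarrow> psubst (\<lambda>v. Cst (a v)) (elem_hom n j) = Cst (b j)"
proof -
  \<comment> \<open>With these signs \<open>p\<close> is what \<open>split_form\<close> should
    become after the substitution at X = t, Y = 1.\<close>
  define p where "p = (\<Sum>j\<le>n. monom ((-1) ^ j * b j) (n - j))"
  have cp: "coeff p n = b 0"
  proof -
    have "coeff p n = (\<Sum>j\<le>n. if j = 0 then b 0 else 0)"
      unfolding p_def coeff_sum by (intro sum.cong) auto
    then show ?thesis by simp
  qed
  have "degree p \<le> n"
    unfolding p_def by (intro degree_sum_le) (auto intro: order_trans[OF degree_monom_le])
  then have deg: "degree p = n" using cp assms le_degree[of p n] by auto
  have "p \<noteq> 0" using cp assms by auto
  then obtain A where A: "size A = n" "p = Polynomial.smult (b 0) (\<Prod>x\<in>#A. [:-x, 1:])"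
    using alg_closed_imp_factorization[of p] deg cp by auto
  obtain xs where xs: "mset xs = A" using ex_mset by blast
  define r where "r i = xs ! (i - 1)" for i
  \<comment> \<open>The leading coefficient is absorbed into the first factor, which exists because
    \<open>n \<ge> 1\<close>.\<close>
  define c where "c i = (if i = 1 then b 0 else 1)" for i :: nat
  define a where "a v = (if snd v = 0 then c (fst v) else c (fst v) * r (fst v))" for v :: "nat \<times> nat"
  have len: "length xs = n" using A xs by auto
  have p_val: "poly p t = (\<Prod>i=1..n. t * a (i, 0) - a (i, 1))" for t
  proof -
    have "poly p t = b 0 * (\<Prod>x\<in>#A. t - x)"
      by (subst A(2)) (simp add: poly_prod_mset)
    also have "(\<Prod>x\<in>#A. t - x) = (\<Prod>i<n. t - xs ! i)"
      unfolding xs[symmetric] mset_map[symmetric] prod_mset_prod_list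
      by (simp add: prod.list_conv_set_nth len atLeast0LessThan)
    also have "(\<Prod>i<n. t - xs ! i) = (\<Prod>i=1..n. t - r i)"
      by (rule prod.reindex_bij_witness[of _ "\<lambda>i. i - 1" Suc]) (auto simp: r_def)
    also have "b 0 = (\<Prod>i=1..n. c i)"
      using assms(2) by (simp add: c_def)
    finally have "poly p t = (\<Prod>i=1..n. c i * (t - r i))" by (simp add: prod.distrib)
    then show ?thesis by (simp add: a_def algebra_simps)
  qed
  let ?e = "psubst (\<lambda>v. Cst (a v)) :: 'k mpoly \<Rightarrow> _"
  interpret e: alg_hom ?e by (rule alg_hom_psubst)
  have "Cst ((-1) ^ j) * ?e (elem_hom n j) = Cst ((-1) ^ j) * Cst (b j)" if "j \<le> n" for j
  proof (rule Cst_polynomial_eq[where f = "\<lambda>j. n - j" and n = n])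
    fix t :: 'k
    have "(\<Sum>j\<le>n. Cst ((-1) ^ j * t ^ (n - j) * 1 ^ j) * ?e (elem_hom n j)) =
        ?e (\<Prod>i=1..n. Cst t * Var i 0 - Cst 1 * Var i 1)"
      unfolding elem_hom_identity[symmetric] by (simp only: e.hom_sum e.hom_mult e.hom_Cst)
    also have "\<dots> = (\<Prod>i=1..n. Cst t * Cst (a (i, 0)) - Cst 1 * Cst (a (i, 1)))"
      by (simp only: e.hom_prod e.hom_diff e.hom_mult e.hom_Cst psubst_Var)
    also have "\<dots> = Cst (poly p t)"
      by (simp only: p_val Cst_prod Cst_diff Cst_mult Cst_1 mult_1_left)
    also have "\<dots> = (\<Sum>j\<le>n. Cst (t ^ (n - j)) * (Cst ((-1) ^ j) * Cst (b j)))"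
      by (simp only: p_def poly_sum poly_monom Cst_sum Cst_mult mult_ac)
    finally show "(\<Sum>j\<le>n. Cst (t ^ (n - j)) * (Cst ((-1) ^ j) * ?e (elem_hom n j))) =
      (\<Sum>j\<le>n. Cst (t ^ (n - j)) * (Cst ((-1) ^ j) * Cst (b j)))"
      by (simp only: Cst_mult power_one mult_1_left mult_1_right Cst_1 mult_ac)
  qed (use that in \<open>auto simp: inj_on_def\<close>)
  moreover have "Cst ((-1) ^ j) \<noteq> (0 :: 'k mpoly)" for j
    unfolding Cst_0[symmetric] Cst_inject by simp
  ultimately have "?e (elem_hom n j) = Cst (b j)" if "j \<le> n" for j
    using that by (simp only: mult_cancel_left simp_thms)
  then show thesis by (rule that)
qed

text \<open>Algebraic independence: every point with nonzero first coordinate consists of values of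
  the elementary symmetric polynomials, so \<open>F\<close> vanishes there, and such points
  suffice.\<close>

lemma esym_eq_0:
  fixes F :: "'k::{alg_closed_field, field_char_0} mpoly"
  assumes "n \<ge> 1" and F: "F \<in> polys {1} (\<lambda>_. n)" and 0: "esym n F = 0"
  shows "F = 0"
proof (rule mpoly_eq_0_if_vanishes[OF F])
  fix b :: "nat \<times> nat \<Rightarrow> 'k" assume "b (1, 0) \<noteq> 0"
  then obtain a where a: "\<And>j. j \<le> n \<Longrightarrow> psubst (\<lambda>v. Cst (a v)) (elem_hom n j) = Cst (b (1, j))"
    using elem_hom_values[of "\<lambda>j. b (1, j)" n] assms(1) by blast
  have "psubst (\<lambda>v. Cst (a v)) (esym n F) = psubst (\<lambda>v. Cst (b v)) F"
    unfolding esym_def psubst_psubst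
  proof (rule psubst_cong)
    fix v assume "v \<in> \<Union> (Poly_Mapping.keys ` Poly_Mapping.keys F)"
    then have "v \<in> coords {1} (\<lambda>_. n)" using F by (auto simp: polys_def)
    then show "psubst (\<lambda>v. Cst (a v)) (case v of (_, j) \<Rightarrow> elem_hom n j) = Cst (b v)"
      using a by (auto simp: coords_def)
  qed
  then show "psubst (\<lambda>v. Cst (b v)) F = 0" by (simp only: 0 psubst_0)
qed

lemma esym_inject:
  fixes F G :: "'k::{alg_closed_field, field_char_0} mpoly"
  assumes "n \<ge> 1" "F \<in> polys {1} (\<lambda>_. n)" "G \<in> polys {1} (\<lambda>_. n)" "esym n F = esym n G"
  shows "F = G"
proof -
  have "esym n (F - G) = 0" unfolding esym.hom_diff assms(4) by (rule diff_self)
  then have "F - G = 0" by (rule esym_eq_0[OF assms(1) polys_diff[OF assms(2,3)]])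
  then show ?thesis by (simp only: right_minus_eq)
qed

section \<open>Symmetrised forms are polynomials in the elementary symmetric ones\<close>

lemma ryser:
  fixes M :: "'b \<Rightarrow> 'b \<Rightarrow> 'a::comm_ring_1"
  assumes N: "finite N"
  shows "(\<Sum>\<sigma> | \<sigma> permutes N. \<Prod>i\<in>N. M i (\<sigma> i)) =
     (\<Sum>A\<in>Pow N. (-1) ^ card N * (-1) ^ card A * (\<Prod>i\<in>N. \<Sum>l\<in>A. M i l))"
proof -
  have inner: "(\<Sum>A | A \<subseteq> N \<and> f ` N \<subseteq> A. (-1) ^ card N * (-1) ^ card A) =
      (if f ` N = N then 1 else 0 :: 'a)" if f: "f ` N \<subseteq> N" for f
  proof (cases "f ` N = N")
    case True
    then have "{A. A \<subseteq> N \<and> f ` N \<subseteq> A} = {N}" by auto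
    then show ?thesis using True by (simp add: power_add[symmetric])
  next
    case False
    have "(\<Sum>A | A \<subseteq> N \<and> f ` N \<subseteq> A. (-1) ^ card A) = (0 :: 'a)"
      using card_subsupersets_even_odd[OF N, of "f ` N"] False f N
      by (intro sum_alternating_cancels) (auto simp: conj_assoc)
    then show ?thesis using False by (simp add: sum_distrib_left[symmetric])
  qed
  have "(\<Sum>A\<in>Pow N. (-1) ^ card N * (-1) ^ card A * (\<Prod>i\<in>N. \<Sum>l\<in>A. M i l)) =
      (\<Sum>A\<in>Pow N. \<Sum>f\<in>N \<rightarrow>\<^sub>E A. (-1) ^ card N * (-1) ^ card A * (\<Prod>i\<in>N. M i (f i)))"
    using N by (intro sum.cong refl) (auto simp: prod_sum_PiE sum_distrib_left dest: finite_subset)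
  \<comment> \<open>Maps into \<open>A\<close> are viewed as maps into \<open>N\<close> with image
    inside \<open>A\<close>, so that the two summations can be exchanged.\<close>
  also have "\<dots> = (\<Sum>A\<in>Pow N. \<Sum>f | f \<in> N \<rightarrow>\<^sub>E N \<and> f ` N \<subseteq> A.
      (-1) ^ card N * (-1) ^ card A * (\<Prod>i\<in>N. M i (f i)))"
    by (intro sum.cong refl) (auto simp: PiE_iff extensional_def)
  also have "\<dots> = (\<Sum>f\<in>N \<rightarrow>\<^sub>E N. \<Sum>A | A \<in> Pow N \<and> f ` N \<subseteq> A.
      (-1) ^ card N * (-1) ^ card A * (\<Prod>i\<in>N. M i (f i)))"
    using N by (intro sum.swap_restrict) (auto intro: finite_PiE)
  also have "\<dots> = (\<Sum>f\<in>N \<rightarrow>\<^sub>E N. if f ` N = N then \<Prod>i\<in>N. M i (f i) else 0)"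
  proof (intro sum.cong refl)
    fix f assume "f \<in> N \<rightarrow>\<^sub>E N"
    then have "f ` N \<subseteq> N" by auto
    from inner[OF this] show "(\<Sum>A | A \<in> Pow N \<and> f ` N \<subseteq> A.
      (-1) ^ card N * (-1) ^ card A * (\<Prod>i\<in>N. M i (f i))) = (if f ` N = N then \<Prod>i\<in>N. M i (f i) else 0)"
      by (simp add: sum_distrib_right[symmetric])
  qed
  also have "\<dots> = (\<Sum>f | f \<in> N \<rightarrow>\<^sub>E N \<and> f ` N = N. \<Prod>i\<in>N. M i (f i))"
    using N by (simp add: sum.inter_filter finite_PiE)
  also have "\<dots> = (\<Sum>\<sigma> | \<sigma> permutes N. \<Prod>i\<in>N. M i (\<sigma> i))"
  \<comment> \<open>Permutations are the identity off \<open>N\<close>, extensional maps are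
    \<open>undefined\<close> there; the bijection only changes this default.\<close>
  proof (rule sum.reindex_bij_witness[of _ "\<lambda>\<sigma>. restrict \<sigma> N" "\<lambda>f x. if x \<in> N then f x else x"])
    fix f assume f: "f \<in> {f \<in> N \<rightarrow>\<^sub>E N. f ` N = N}"
    then show "restrict (\<lambda>x. if x \<in> N then f x else x) N = f" by (auto simp: fun_eq_iff)
    have "bij_betw f N N" using f N by (auto simp: bij_betw_def intro: eq_card_imp_inj_on)
    then have "bij_betw (\<lambda>x. if x \<in> N then f x else x) N N"
      by (rule bij_betw_cong[THEN iffD1, rotated]) simp
    then show "(\<lambda>x. if x \<in> N then f x else x) \<in> {\<sigma>. \<sigma> permutes N}"
      by (auto intro: bij_imp_permutes)
    show "(\<Prod>i\<in>N. M i (if i \<in> N then f i else i)) = (\<Prod>i\<in>N. M i (f i))" by simp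
  next
    fix \<sigma> assume \<sigma>: "\<sigma> \<in> {\<sigma>. \<sigma> permutes N}"
    then have \<sigma>': "\<sigma> permutes N" by simp
    show "(\<lambda>x. if x \<in> N then restrict \<sigma> N x else x) = \<sigma>"
      using permutes_not_in[OF \<sigma>'] by (auto simp: fun_eq_iff)
    show "restrict \<sigma> N \<in> {f \<in> N \<rightarrow>\<^sub>E N. f ` N = N}"
      using permutes_image[OF \<sigma>'] by auto
  qed
  finally show ?thesis ..
qed

text \<open>The subsequent lemmas show that, over an algebraically closed field of characteristic
  zero, this set contains every symmetric form of multidegree (m, ..., m).\<close>

definition sym_img :: "nat \<Rightarrow> nat \<Rightarrow> 'k::field mpoly set" where
  "sym_img n m = esym n ` multiforms {1} (\<lambda>_. n) (udeg {1} m)"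

lemma sym_img_add: "F \<in> sym_img n m \<Longrightarrow> G \<in> sym_img n m \<Longrightarrow> F + G \<in> sym_img n m"
  unfolding sym_img_def by (auto simp: esym.hom_add[symmetric] intro!: imageI multiforms_add)

lemma sym_img_0: "0 \<in> sym_img n m"
  unfolding sym_img_def using multiforms_0 esym.hom_0 by (rule rev_image_eqI[OF _ sym])

lemma sym_img_sum: "(\<And>x. x \<in> A \<Longrightarrow> f x \<in> sym_img n m) \<Longrightarrow> (\<Sum>x\<in>A. f x) \<in> sym_img n m"
  by (induction A rule: infinite_finite_induct) (simp_all add: sym_img_0 sym_img_add)

lemma sym_img_mult:
  assumes "F \<in> sym_img n a" "G \<in> sym_img n b"
  shows "F * G \<in> sym_img n (a + b)"
proof -
  obtain F' G' where *: "F = esym n F'" "G = esym n G'" "F' \<in> multiforms {1} (\<lambda>_. n) (udeg {1} a)"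
    "G' \<in> multiforms {1} (\<lambda>_. n) (udeg {1} b)"
    using assms unfolding sym_img_def by blast
  have "F' * G' \<in> multiforms {1} (\<lambda>_. n) (udeg {1} (a + b))"
    using multiforms_mult[OF *(3,4)] unfolding udeg_add .
  then show ?thesis unfolding *(1,2) sym_img_def esym.hom_mult[symmetric] by (rule imageI)
qed

lemma sym_img_Cst: "Cst c \<in> sym_img n 0"
  unfolding sym_img_def udeg_0 using multiforms_Cst esym.hom_Cst by (rule rev_image_eqI[OF _ sym])

lemma sym_img_Cst_mult: "F \<in> sym_img n m \<Longrightarrow> Cst c * F \<in> sym_img n m"
  using sym_img_mult[OF sym_img_Cst, of F n m c] by simp

lemma sym_img_linear: "(\<Prod>i=1..n. Cst s * Var i 0 + Cst t * Var i 1) \<in> sym_img n 1"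
proof -
  have "(\<Prod>i=1..n. Cst s * Var i 0 + Cst t * Var i 1) =
      (\<Sum>j\<le>n. Cst ((-1) ^ j * s ^ (n - j) * (-t) ^ j) * elem_hom n j)"
    unfolding elem_hom_identity by (simp add: Cst_uminus)
  also have "\<dots> = esym n (\<Sum>j\<le>n. Cst ((-1) ^ j * s ^ (n - j) * (-t) ^ j) * Var 1 j)"
    by (simp only: esym.hom_sum esym.hom_mult esym.hom_Cst esym_Var)
  also have "\<dots> \<in> sym_img n 1"
    unfolding sym_img_def
    by (rule imageI, rule multiforms_sum, rule multiforms_Cst_mult, rule Var_udeg) simp
  finally show ?thesis .
qed

text \<open>The homogenisation of \<open>\<gamma>\<close> in the two coordinates of factor
  \<open>i\<close>. The formal degree \<open>m\<close> is separate from
  \<open>degree \<gamma>\<close>: if it is larger, \<open>Var i 0\<close> divides the form.\<close>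

definition binary_form :: "nat \<Rightarrow> 'k::field poly \<Rightarrow> nat \<Rightarrow> 'k mpoly" where
  "binary_form m \<gamma> i = (\<Sum>a\<le>m. Cst (coeff \<gamma> a) * (Var i 0 ^ (m - a) * Var i 1 ^ a))"

lemma binary_form_factor:
  assumes "degree \<gamma> \<le> m"
  shows "binary_form (Suc m) (Polynomial.smult s \<gamma> + pCons 0 (Polynomial.smult t \<gamma>)) i =
     (Cst s * Var i 0 + Cst t * Var i 1) * binary_form m \<gamma> i"
proof -
  let ?X = "Var i 0" and ?Y = "Var i 1"
  have "binary_form (Suc m) (Polynomial.smult s \<gamma> + pCons 0 (Polynomial.smult t \<gamma>)) i =
      (\<Sum>a\<le>Suc m. Cst s * (Cst (coeff \<gamma> a) * (?X ^ (Suc m - a) * ?Y ^ a))) +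
      (\<Sum>a\<le>Suc m. Cst (coeff (pCons 0 (Polynomial.smult t \<gamma>)) a) * (?X ^ (Suc m - a) * ?Y ^ a))"
    unfolding binary_form_def coeff_add coeff_smult Cst_add Cst_mult distrib_right sum.distrib
    by (simp only: mult.assoc)
  \<comment> \<open>The top term vanishes because \<open>degree \<gamma> \<le> m\<close>. In the
    other sum it is the bottom term that vanishes, by the shift in \<open>pCons\<close>.\<close>
  also have "(\<Sum>a\<le>Suc m. Cst s * (Cst (coeff \<gamma> a) * (?X ^ (Suc m - a) * ?Y ^ a))) =
      (\<Sum>a\<le>m. Cst s * (Cst (coeff \<gamma> a) * (?X ^ (Suc m - a) * ?Y ^ a)))"
    using assms by (simp add: coeff_eq_0 Cst_0)
  also have "\<dots> = (\<Sum>a\<le>m. (Cst s * ?X) * (Cst (coeff \<gamma> a) * (?X ^ (m - a) * ?Y ^ a)))"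
  proof (rule sum.cong[OF refl])
    fix a assume "a \<in> {..m}"
    then have "Suc m - a = Suc (m - a)" by auto
    then show "Cst s * (Cst (coeff \<gamma> a) * (?X ^ (Suc m - a) * ?Y ^ a)) =
        (Cst s * ?X) * (Cst (coeff \<gamma> a) * (?X ^ (m - a) * ?Y ^ a))"
      by (simp only: power_Suc mult_ac)
  qed
  also have "\<dots> = Cst s * ?X * binary_form m \<gamma> i"
    by (simp only: binary_form_def sum_distrib_left)
  also have "(\<Sum>a\<le>Suc m. Cst (coeff (pCons 0 (Polynomial.smult t \<gamma>)) a) * (?X ^ (Suc m - a) * ?Y ^ a)) =
      (\<Sum>a\<le>m. Cst (t * coeff \<gamma> a) * (?X ^ (m - a) * ?Y ^ Suc a))"
    unfolding sum.atMost_Suc_shift by (simp add: Cst_0)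
  also have "\<dots> = Cst t * ?Y * binary_form m \<gamma> i"
    unfolding binary_form_def sum_distrib_left
    by (intro sum.cong refl) (simp only: Cst_mult power_Suc mult_ac)
  finally show ?thesis by (simp only: distrib_right)
qed

text \<open>Over an algebraically closed field a binary form is a product of linear ones.\<close>

lemma sym_img_binary_form:
  fixes \<gamma> :: "'k::alg_closed_field poly"
  assumes "degree \<gamma> \<le> m"
  shows "(\<Prod>i=1..n. binary_form m \<gamma> i) \<in> sym_img n m"
  using assms
proof (induction m arbitrary: \<gamma>)
  case 0
  have "(\<Prod>i=1..n. binary_form 0 \<gamma> i) = Cst (coeff \<gamma> 0 ^ n)"
    by (simp add: binary_form_def Cst_power)
  then show ?case by (simp only: sym_img_Cst)
next
  case (Suc m)
  have step: "(\<Prod>i=1..n. binary_form (Suc m) \<gamma> i) \<in> sym_img n (Suc m)"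
    if \<gamma>: "\<gamma> = Polynomial.smult s \<delta> + pCons 0 (Polynomial.smult t \<delta>)" "degree \<delta> \<le> m" for s t \<delta>
    using sym_img_mult[OF sym_img_linear[of s t n] Suc.IH[OF \<gamma>(2)]]
    unfolding \<gamma>(1) binary_form_factor[OF \<gamma>(2)] prod.distrib by simp
  show ?case
  proof (cases "degree \<gamma> \<le> m")
    case True
    \<comment> \<open>A root at infinity: the linear factor split off is \<open>Var i 0\<close>
      itself.\<close>
    then show ?thesis by (intro step[of 1 \<gamma> 0]) auto
  next
    case False
    then have deg: "degree \<gamma> = Suc m" using Suc.prems by simp
    then obtain z where "poly \<gamma> z = 0" using alg_closed_imp_poly_has_root[of \<gamma>] by auto
    then obtain \<delta> where \<delta>: "\<gamma> = [:-z, 1:] * \<delta>" by (auto simp: poly_eq_0_iff_dvd)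
    have "\<delta> \<noteq> 0" using deg \<delta> by auto
    then have "degree \<delta> = m" using deg unfolding \<delta> by (subst (asm) degree_mult_eq) auto
    moreover have "\<gamma> = Polynomial.smult (- z) \<delta> + pCons 0 (Polynomial.smult 1 \<delta>)"
      unfolding \<delta> by simp
    ultimately show ?thesis by (intro step[of "-z" \<delta> 1]) auto
  qed
qed

text \<open>By linearity it suffices to treat a monomial with exponents \<open>m - a i\<close> and
  \<open>a i\<close> in factor \<open>i\<close>. Its symmetrisation is the permanent of the matrix
  of the \<open>\<mu> (a l) i\<close>. In Ryser's formula the row sums over a set \<open>A\<close>
  are one and the same binary form, with coefficients given by the sum of the
  \<open>monom 1 (a l)\<close>, evaluated in the different factors.\<close>

lemma sym_img_symmetrised:
  fixes F :: "'k::alg_closed_field mpoly"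
  assumes F: "F \<in> multiforms {1..n} (\<lambda>_. 1) (udeg {1..n} m)"
  shows "(\<Sum>\<sigma> | \<sigma> permutes {1..n}. perm_vars \<sigma> F) \<in> sym_img n m"
proof -
  let ?N = "{1..n}"
  let ?S = "\<lambda>F. \<Sum>\<sigma> | \<sigma> permutes ?N. perm_vars \<sigma> F"
  have mono: "?S (Poly_Mapping.single e c) \<in> sym_img n m" (is "?s \<in> _")
    if e: "Poly_Mapping.keys e \<subseteq> coords ?N (\<lambda>_. 1)" "multideg e = udeg ?N m" for e and c :: 'k
  proof -
    define a where "a i = Poly_Mapping.lookup e (i, 1)" for i
    define \<mu> where "\<mu> b l = (Var l 0 ^ (m - b) * Var l 1 ^ b :: 'k mpoly)" for b l
    have a: "Poly_Mapping.lookup e (i, 0) = m - a i" "a i \<le> m" if "i \<in> ?N" for i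
    proof -
      have "m = multideg e i" using e(2) that by (simp add: udeg_def)
      also have "\<dots> = (\<Sum>v\<in>{v \<in> coords ?N (\<lambda>_. 1). fst v = i}. Poly_Mapping.lookup e v)"
      proof (rule multideg_superset)
        have "coords ?N (\<lambda>_. 1) = ?N \<times> {..1}" by (auto simp: coords_def)
        then show "finite (coords ?N (\<lambda>_. 1))" by simp
      qed (rule e(1))
      also have "{v \<in> coords ?N (\<lambda>_. 1). fst v = i} = {(i, 0), (i, 1)}"
        using that by (auto simp: coords_def)
      finally have "m = Poly_Mapping.lookup e (i, 0) + a i" by (simp add: a_def)
      then show "Poly_Mapping.lookup e (i, 0) = m - a i" "a i \<le> m" by auto
    qed
    have single: "perm_vars \<sigma> (Poly_Mapping.single e c) = Cst c * (\<Prod>i\<in>?N. \<mu> (a (\<sigma> i)) i)"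
      if \<sigma>: "\<sigma> permutes ?N" for \<sigma>
    proof -
      let ?g = "\<lambda>(i, j). Var (Hilbert_Choice.inv \<sigma> i) j :: 'k mpoly"
      have "(\<Prod>v\<in>Poly_Mapping.keys e. ?g v ^ Poly_Mapping.lookup e v) =
          (\<Prod>v\<in>?N \<times> {..1}. ?g v ^ Poly_Mapping.lookup e v)"
        by (rule prod_keys_superset) (use e(1) in \<open>auto simp: coords_def\<close>)
      also have "\<dots> = (\<Prod>i\<in>?N. \<Prod>j\<le>1. Var (Hilbert_Choice.inv \<sigma> i) j ^ Poly_Mapping.lookup e (i, j))"
        by (subst prod.cartesian_product) (simp add: split_def)
      also have "\<dots> = (\<Prod>i\<in>?N. \<mu> (a i) (Hilbert_Choice.inv \<sigma> i))"
        by (intro prod.cong refl) (simp add: \<mu>_def a a_def)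
      also have "\<dots> = (\<Prod>i\<in>?N. \<mu> (a (\<sigma> i)) i)"
        by (subst prod.permute[OF \<sigma>]) (simp add: permutes_inverses[OF \<sigma>])
      finally show ?thesis unfolding perm_vars_def psubst_single by (simp only:)
    qed
    have "?s = Cst c * (\<Sum>\<sigma> | \<sigma> permutes ?N. \<Prod>i\<in>?N. \<mu> (a (\<sigma> i)) i)"
      unfolding sum_distrib_left by (intro sum.cong refl single) simp
    also have "(\<Sum>\<sigma> | \<sigma> permutes ?N. \<Prod>i\<in>?N. \<mu> (a (\<sigma> i)) i) =
        (\<Sum>A\<in>Pow ?N. (-1) ^ card ?N * (-1) ^ card A * (\<Prod>i\<in>?N. \<Sum>l\<in>A. \<mu> (a l) i))"
      by (rule ryser) simp
    also have "\<dots> = (\<Sum>A\<in>Pow ?N. Cst ((-1) ^ card ?N * (-1) ^ card A) *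
        (\<Prod>i\<in>?N. binary_form m (\<Sum>l\<in>A. monom 1 (a l)) i))"
    proof (intro sum.cong refl arg_cong2[of _ _ _ _ "(*)"] prod.cong)
      fix A i assume A: "A \<in> Pow ?N"
      show "(-1) ^ card ?N * (-1) ^ card A = (Cst ((-1) ^ card ?N * (-1) ^ card A) :: 'k mpoly)"
        by (simp only: Cst_mult Cst_power Cst_uminus_1)
      have "binary_form m (\<Sum>l\<in>A. monom 1 (a l)) i =
          (\<Sum>b\<le>m. \<Sum>l\<in>A. Cst (coeff (monom 1 (a l)) b) * \<mu> b i)"
        by (simp only: binary_form_def coeff_sum Cst_sum sum_distrib_right \<mu>_def)
      also have "\<dots> = (\<Sum>l\<in>A. \<Sum>b\<le>m. Cst (coeff (monom 1 (a l)) b) * \<mu> b i)"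
        by (rule sum.swap)
      also have "\<dots> = (\<Sum>l\<in>A. \<mu> (a l) i)"
      proof (intro sum.cong refl)
        fix l assume "l \<in> A"
        then have "a l \<le> m" using A a(2) by blast
        moreover have "(\<Sum>b\<le>m. Cst (coeff (monom 1 (a l)) b) * \<mu> b i) = (\<Sum>b\<le>m. if b = a l then \<mu> (a l) i else 0)"
          by (intro sum.cong refl) (auto simp: Cst_1 Cst_0)
        ultimately show "(\<Sum>b\<le>m. Cst (coeff (monom 1 (a l)) b) * \<mu> b i) = \<mu> (a l) i" by simp
      qed
      finally show "(\<Sum>l\<in>A. \<mu> (a l) i) = binary_form m (\<Sum>l\<in>A. monom 1 (a l)) i" ..
    qed
    finally have eq: "?s = Cst c * (\<Sum>A\<in>Pow ?N. Cst ((-1) ^ card ?N * (-1) ^ card A) *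
        (\<Prod>i\<in>?N. binary_form m (\<Sum>l\<in>A. monom 1 (a l)) i))" .
    show ?thesis
      unfolding eq
    proof (intro sym_img_sum sym_img_Cst_mult sym_img_binary_form)
      fix A assume "A \<in> Pow ?N"
      then show "degree (\<Sum>l\<in>A. monom (1 :: 'k) (a l)) \<le> m"
        using a(2) finite_subset[of A ?N]
        by (intro degree_sum_le) (auto simp: degree_monom_eq)
    qed
  qed
  have "?S F = (\<Sum>e\<in>Poly_Mapping.keys F. ?S (Poly_Mapping.single e (Poly_Mapping.lookup F e)))"
    by (subst sum.swap) (simp only: perm_vars.hom_sum[symmetric] mpoly_as_sum[of F, symmetric])
  also have "\<dots> \<in> sym_img n m"
    by (intro sym_img_sum mono) (use F in \<open>auto simp: multiforms_def polys_def\<close>)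
  finally show ?thesis .
qed

section \<open>Averaging over the symmetric group\<close>

lemma sum_perm_vars_invariant:
  assumes "\<And>\<sigma>. \<sigma> permutes {1..n} \<Longrightarrow> perm_vars \<sigma> G = G"
  shows "(\<Sum>\<sigma> | \<sigma> permutes {1..n}. perm_vars \<sigma> (G * F)) = G * (\<Sum>\<sigma> | \<sigma> permutes {1..n}. perm_vars \<sigma> F)"
  unfolding sum_distrib_left by (intro sum.cong refl) (simp add: perm_vars.hom_mult assms)

lemma sum_perm_vars_const:
  fixes G :: "'k::field_char_0 mpoly"
  assumes "\<And>\<sigma>. \<sigma> permutes {1..n} \<Longrightarrow> perm_vars \<sigma> G = G"
  shows "Cst (1 / fact n) * (\<Sum>\<sigma> | \<sigma> permutes {1..n}. perm_vars \<sigma> G) = G"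
proof -
  have "(\<Sum>\<sigma> | \<sigma> permutes {1..n}. perm_vars \<sigma> G) = (\<Sum>\<sigma> | \<sigma> permutes {1..n}. G)"
    using assms by (intro sum.cong) auto
  also have "\<dots> = of_nat (fact n) * G"
    using card_permutations[of "{1..n}" n] by simp
  also have "\<dots> = Cst (fact n) * G" by (simp only: Cst_of_nat[symmetric] of_nat_fact)
  finally have "Cst (1 / fact n) * (\<Sum>\<sigma> | \<sigma> permutes {1..n}. perm_vars \<sigma> G) = Cst (1 / fact n * fact n) * G"
    by (simp only: mult.assoc Cst_mult)
  also have "1 / fact n * fact n = (1 :: 'k)" by simp
  finally show ?thesis by (simp only: Cst_1 mult_1_left)
qed

text \<open>Up to the factor 1/n! an invariant form is its own symmetrisation.\<close>

lemma invariant_in_sym_img: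
  fixes G :: "'k::{alg_closed_field, field_char_0} mpoly"
  assumes G: "G \<in> multiforms {1..n} (\<lambda>_. 1) (udeg {1..n} m)"
    and inv: "\<And>\<sigma>. \<sigma> permutes {1..n} \<Longrightarrow> perm_vars \<sigma> G = G"
  obtains H where "H \<in> multiforms {1} (\<lambda>_. n) (udeg {1} m)" "esym n H = G"
proof -
  have "Cst (1 / fact n) * (\<Sum>\<sigma> | \<sigma> permutes {1..n}. perm_vars \<sigma> G) \<in> sym_img n m"
    by (intro sym_img_Cst_mult sym_img_symmetrised G)
  then have "G \<in> sym_img n m" by (simp only: sum_perm_vars_const[OF inv])
  then show thesis using that unfolding sym_img_def by blast
qed

section \<open>Points\<close>

lemma multiproj_points_iff:
  "P \<in> multiproj_points I r \<longleftrightarrow>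
     primeideal P (coord_ring I r) \<and> multihom P \<and> (\<forall>i\<in>I. \<exists>j\<le>r i. Var i j \<notin> P)"
  by (auto simp: multiproj_points_def multihom_def)

lemma multiproj_pointsD:
  assumes "P \<in> multiproj_points I r"
  shows "primeideal P (coord_ring I r)" "multihom P" "poly_ideal I r P"
    "i \<in> I \<Longrightarrow> \<exists>j\<le>r i. Var i j \<notin> P"
  using assms primeidealD_poly(1)[of P I r] unfolding multiproj_points_iff by blast+

lemma multihom_part_notin:
  assumes A: "poly_ideal I r A" and F: "F \<in> polys I r" "F \<notin> A"
  obtains d where "multihom_part d F \<in> multiforms I r d" "multihom_part d F \<notin> A"
proof -
  have "\<exists>d. multihom_part d F \<notin> A"
  proof (rule ccontr)
    assume "\<nexists>d. multihom_part d F \<notin> A"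
    then have "(\<Sum>d\<in>multideg ` Poly_Mapping.keys F. multihom_part d F) \<in> A"
      by (intro poly_ideal_sum[OF A]) auto
    then show False using F(2) multihom_part_decomp[of F] by simp
  qed
  then show thesis using that multihom_part_in_multiforms[OF F(1)] by blast
qed

text \<open>In each factor some coordinate is outside \<open>P\<close>; powers of these coordinates
  fill up the missing degrees, and their product stays outside because \<open>P\<close> is
  prime.\<close>

lemma raise_degree:
  fixes P :: "'k::field mpoly set"
  assumes P: "P \<in> multiproj_points I r" and "finite I"
    and d: "\<And>i. i \<in> I \<Longrightarrow> d i \<le> m" "\<And>i. i \<notin> I \<Longrightarrow> d i = 0"
  obtains u where "u \<in> multiforms I r (\<lambda>i. udeg I m i - d i)" "u \<notin> P"
    "\<And>F. F \<in> multiforms I r d \<Longrightarrow> u * F \<in> multiforms I r (udeg I m)"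
proof -
  obtain j where j: "\<And>i. i \<in> I \<Longrightarrow> j i \<le> r i" "\<And>i. i \<in> I \<Longrightarrow> Var i (j i) \<notin> P"
    using multiproj_pointsD(4)[OF P] by metis
  define u :: "'k mpoly" where "u = (\<Prod>i\<in>I. Var i (j i) ^ (m - d i))"
  have "u \<in> multiforms I r (\<lambda>k. \<Sum>i\<in>I. (m - d i) * (if k = i then 1 else 0))"
    unfolding u_def using assms(2)
    by (rule multiforms_prod) (intro multiforms_power multiforms_Var j(1), assumption+)
  also have "(\<lambda>k. \<Sum>i\<in>I. (m - d i) * (if k = i then 1 else 0)) = (\<lambda>i. udeg I m i - d i)"
    using assms(2) by (auto simp: udeg_def if_distrib cong: if_cong)
  finally have u: "u \<in> multiforms I r (\<lambda>i. udeg I m i - d i)" .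
  have V: "Var i (j i) \<in> polys I r" if "i \<in> I" for i using that j(1)[OF that] by (rule polys_Var)
  have "Var i (j i) ^ k \<notin> P" if "i \<in> I" for i k
    by (rule prime_power[OF multiproj_pointsD(1)[OF P] V[OF that] j(2)[OF that]])
  then have "u \<notin> P"
    unfolding u_def
    by (subst prime_prod_iff[OF multiproj_pointsD(1)[OF P] assms(2)]) (auto intro!: polys_power V)
  moreover have "u * F \<in> multiforms I r (udeg I m)" if "F \<in> multiforms I r d" for F
  proof -
    have "(\<lambda>i. udeg I m i - d i + d i) = udeg I m" using d by (fastforce simp: udeg_def)
    then show ?thesis using multiforms_mult[OF u that] by (simp only:)
  qed
  ultimately show thesis using that u by blast
qed

lemma multiforms_degree_support:
  assumes "F \<in> multiforms I r d" "F \<noteq> 0" "i \<notin> I"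
  shows "d i = 0"
proof -
  obtain m where m: "m \<in> Poly_Mapping.keys F" using assms(2) by fastforce
  then have "multideg m = d" "Poly_Mapping.keys m \<subseteq> coords I r"
    using assms(1) by (auto simp: multiforms_def polys_def)
  then show ?thesis using assms(3) by (fastforce simp: multideg_def coords_def intro!: sum.neutral)
qed

text \<open>This and \<open>esym_pt\<close> are the point maps of \<open>permute_factors\<close> and
  \<open>pi_map\<close>, written as contractions of ideals.\<close>

definition perm_pt :: "nat \<Rightarrow> (nat \<Rightarrow> nat) \<Rightarrow> 'k::field mpoly set \<Rightarrow> 'k mpoly set" where
  "perm_pt n \<sigma> P = {F \<in> polys {1..n} (\<lambda>_. 1). perm_vars \<sigma> F \<in> P}"

definition esym_pt :: "nat \<Rightarrow> 'k::field mpoly set \<Rightarrow> 'k mpoly set" where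
  "esym_pt n P = {F \<in> polys {1} (\<lambda>_. n). esym n F \<in> P}"

lemma perm_pt_point:
  assumes \<sigma>: "\<sigma> permutes {1..n}" and P: "P \<in> multiproj_points {1..n} (\<lambda>_. 1)"
  shows "perm_pt n \<sigma> P \<in> multiproj_points {1..n} (\<lambda>_. 1)"
proof -
  interpret graded_hom "perm_vars \<sigma>" "{1..n}" "\<lambda>_. 1" "{1..n}" "\<lambda>_. 1" "\<lambda>d i. d (\<sigma> i)"
    by (rule graded_hom_perm_vars[OF \<sigma>])
  note PD = multiproj_pointsD[OF P]
  have "\<exists>j\<le>1. Var i j \<notin> perm_pt n \<sigma> P" if "i \<in> {1..n}" for i
  proof -
    have "Hilbert_Choice.inv \<sigma> i \<in> {1..n}" using permutes_in_image[OF permutes_inv[OF \<sigma>]] that by blast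
    then show ?thesis using PD(4)[of "Hilbert_Choice.inv \<sigma> i"] by (auto simp: perm_pt_def perm_vars_Var)
  qed
  then show ?thesis
    unfolding multiproj_points_iff perm_pt_def
    using contraction_prime[OF PD(1)] contraction_multihom[OF PD(2) poly_idealD(2)[OF PD(3)]] by blast
qed

lemma perm_pt_id: "poly_ideal {1..n} (\<lambda>_. 1) P \<Longrightarrow> perm_pt n id P = P"
  using poly_idealD(1)[of "{1..n}" "\<lambda>_. 1" P] by (auto simp: perm_pt_def perm_vars_id)

lemma perm_pt_comp:
  assumes "\<sigma> permutes {1..n}" "\<tau> permutes {1..n}"
  shows "perm_pt n \<sigma> (perm_pt n \<tau> P) = perm_pt n (\<sigma> \<circ> \<tau>) P"
proof -
  interpret graded_hom "perm_vars \<sigma>" "{1..n}" "\<lambda>_. 1" "{1..n}" "\<lambda>_. 1" "\<lambda>d i. d (\<sigma> i)"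
    by (rule graded_hom_perm_vars[OF assms(1)])
  show ?thesis
    using hom_polys by (auto simp: perm_pt_def perm_vars_comp[OF assms(2,1)])
qed

lemma perm_pt_mono: "P \<subseteq> P' \<Longrightarrow> perm_pt n \<sigma> P \<subseteq> perm_pt n \<sigma> P'"
  by (auto simp: perm_pt_def)

lemma esym_pt_perm_pt:
  fixes P :: "'k::field_char_0 mpoly set"
  assumes "n \<ge> 1" "\<sigma> permutes {1..n}"
  shows "esym_pt n (perm_pt n \<sigma> P) = esym_pt n P"
proof -
  interpret graded_hom "esym n" "{1..n}" "\<lambda>_. 1" "{1}" "\<lambda>_. n" "\<lambda>d. udeg {1..n} (d 1)"
    by (rule graded_hom_esym[OF assms(1)])
  show ?thesis
    using hom_polys by (auto simp: perm_pt_def esym_pt_def perm_vars_esym[OF assms(2)])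
qed

text \<open>
  If all elementary symmetric polynomials vanish at a point then so does
  \<open>\<Prod>\<^sub>i (x\<^sub>i\<^sub>0 - \<beta> x\<^sub>i\<^sub>1)\<close> for every \<open>\<beta>\<close>, hence two of these linear forms for the same \<open>i\<close>.
\<close>

lemma elem_hom_notin_point:
  fixes P :: "'k::field_char_0 mpoly set"
  assumes P: "P \<in> multiproj_points {1..n} (\<lambda>_. 1)"
  obtains j where "j \<le> n" "elem_hom n j \<notin> P"
proof -
  note PD = multiproj_pointsD[OF P]
  have "\<exists>j\<le>n. elem_hom n j \<notin> P"
  proof (rule ccontr)
    assume all: "\<not> ?thesis"
    have "\<exists>i\<in>{1..n}. Var i 0 - Cst \<beta> * Var i 1 \<in> P" for \<beta>
    proof -
      have "(\<Sum>j\<le>n. Cst ((-1) ^ j * 1 ^ (n - j) * \<beta> ^ j) * elem_hom n j) \<in> P"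
        by (rule poly_ideal_sum[OF PD(3)]) (use all in \<open>auto intro!: poly_idealD(4)[OF PD(3)] polys_Cst\<close>)
      then have "(\<Prod>i=1..n. Cst 1 * Var i 0 - Cst \<beta> * Var i 1) \<in> P"
        by (simp only: elem_hom_identity)
      then have "\<exists>i\<in>{1..n}. Cst 1 * Var i 0 - Cst \<beta> * Var i 1 \<in> P"
        by (subst (asm) prime_prod_iff[OF PD(1)]) (auto intro!: polys_diff polys_mult polys_Cst polys_Var)
      then show ?thesis by (simp only: Cst_1 mult_1_left)
    qed
    then obtain f where f: "\<And>\<beta>. f \<beta> \<in> {1..n}" "\<And>\<beta>. Var (f \<beta>) 0 - Cst \<beta> * Var (f \<beta>) 1 \<in> P"
      by metis
    have "finite (range f)" by (rule finite_subset[of _ "{1..n}"]) (use f(1) in auto)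
    then obtain \<beta> where "infinite {\<beta>'. f \<beta>' = f \<beta>}"
      using pigeonhole_infinite[OF infinite_UNIV_char_0[where 'a = 'k], of f] by auto
    then have "infinite ({\<beta>'. f \<beta>' = f \<beta>} - {\<beta>})" by simp
    then have "{\<beta>'. f \<beta>' = f \<beta>} - {\<beta>} \<noteq> {}" by (metis finite.emptyI)
    then obtain \<beta>' where \<beta>': "f \<beta>' = f \<beta>" "\<beta>' \<noteq> \<beta>" by blast
    let ?x = "Var (f \<beta>) 0 :: 'k mpoly" and ?y = "Var (f \<beta>) 1 :: 'k mpoly"
    have x: "?x - Cst \<beta> * ?y \<in> P" using f(2) by blast
    have x': "?x - Cst \<beta>' * ?y \<in> P" using f(2)[of \<beta>'] unfolding \<beta>'(1) .
    have yp: "?y \<in> polys {1..n} (\<lambda>_. 1)" using f(1) by (intro polys_Var) auto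
    have "(?x - Cst \<beta> * ?y) - (?x - Cst \<beta>' * ?y) \<in> P" by (rule poly_idealD(7)[OF PD(3) x x'])
    then have "Cst (1 / (\<beta>' - \<beta>)) * ((?x - Cst \<beta> * ?y) - (?x - Cst \<beta>' * ?y)) \<in> P"
      by (rule poly_idealD(4)[OF PD(3)]) (rule polys_Cst)
    also have "Cst (1 / (\<beta>' - \<beta>)) * ((?x - Cst \<beta> * ?y) - (?x - Cst \<beta>' * ?y)) =
        Cst (1 / (\<beta>' - \<beta>)) * (Cst \<beta>' - Cst \<beta>) * ?y"
      by (simp only: algebra_simps)
    also have "\<dots> = Cst (1 / (\<beta>' - \<beta>) * (\<beta>' - \<beta>)) * ?y"
      by (simp only: Cst_diff Cst_mult)
    also have "\<dots> = ?y" using \<beta>'(2) by (simp add: Cst_1)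
    finally have y: "?y \<in> P" .
    have "(?x - Cst \<beta> * ?y) + Cst \<beta> * ?y \<in> P"
      by (intro poly_idealD(3)[OF PD(3)] x poly_idealD(4)[OF PD(3) y] polys_Cst)
    then have "?x \<in> P" by (simp only: diff_add_cancel)
    then have "\<forall>j\<le>1. Var (f \<beta>) j \<in> P" using y by (auto simp: le_Suc_eq)
    then show False using PD(4)[OF f(1)] by blast
  qed
  then show thesis using that by blast
qed

lemma esym_pt_point:
  fixes P :: "'k::field_char_0 mpoly set"
  assumes "n \<ge> 1" and P: "P \<in> multiproj_points {1..n} (\<lambda>_. 1)"
  shows "esym_pt n P \<in> multiproj_points {1} (\<lambda>_. n)"
proof -
  interpret graded_hom "esym n" "{1..n}" "\<lambda>_. 1" "{1}" "\<lambda>_. n" "\<lambda>d. udeg {1..n} (d 1)"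
    by (rule graded_hom_esym[OF assms(1)])
  note PD = multiproj_pointsD[OF P]
  obtain j where "j \<le> n" "elem_hom n j \<notin> P" by (rule elem_hom_notin_point[OF P])
  then have "\<exists>j\<le>n. Var 1 j \<notin> esym_pt n P" by (auto simp: esym_pt_def esym_Var)
  then show ?thesis
    unfolding multiproj_points_iff esym_pt_def
    using contraction_prime[OF PD(1)] contraction_multihom[OF PD(2) poly_idealD(2)[OF PD(3)]] by blast
qed

subsection \<open>Invariant forms avoiding a prime\<close>

lemma (in alg_hom) hom_coeff_prod:
  assumes "\<And>x i. x \<in> A \<Longrightarrow> \<phi> (coeff (f x) i) = coeff (g x) i"
  shows "\<phi> (coeff (\<Prod>x\<in>A. f x) k) = coeff (\<Prod>x\<in>A. g x) k"
  using assms
proof (induction A arbitrary: k rule: infinite_finite_induct)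
  case (insert x A)
  then show ?case by (simp add: coeff_mult hom_sum hom_mult)
qed (simp_all add: hom_0 hom_1)

lemma multiforms_coeff_prod:
  assumes "finite A" "\<And>x i. x \<in> A \<Longrightarrow> coeff (f x) i \<in> multiforms I r (udeg I m)"
  shows "coeff (\<Prod>x\<in>A. f x) k \<in> multiforms I r (udeg I (card A * m))"
  using assms
proof (induction A arbitrary: k rule: finite_induct)
  case empty
  show ?case by (cases "k = 0") (simp_all add: udeg_0 multiforms_1 multiforms_0)
next
  case (insert x A)
  have "(\<Sum>i\<le>k. coeff (f x) i * coeff (\<Prod>x\<in>A. f x) (k - i)) \<in> multiforms I r (udeg I (m + card A * m))"
    unfolding udeg_add[symmetric]
    by (intro multiforms_sum multiforms_mult insert.IH insert.prems) simp_all
  then show ?case using insert.hyps by (simp add: coeff_mult)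
qed

text \<open>
  The witness is a coefficient of \<open>\<Prod>\<^sub>\<sigma> \<sigma> (\<Sum>\<^sub>a w\<^sub>a T\<^sup>a)\<close>, none of whose factors has all its coefficients
  in the prime.
\<close>

lemma invariant_avoiding_prime:
  fixes P :: "'k::field mpoly set" and w :: "nat \<Rightarrow> 'k mpoly"
  assumes P: "primeideal P (coord_ring {1..n} (\<lambda>_. 1))"
    and w: "\<And>a. a < l \<Longrightarrow> w a \<in> multiforms {1..n} (\<lambda>_. 1) (udeg {1..n} m)"
    and av: "\<And>\<sigma>. \<sigma> permutes {1..n} \<Longrightarrow> \<exists>a<l. perm_vars \<sigma> (w a) \<notin> P"
  obtains b M where "\<And>a. a < l \<Longrightarrow> b a \<in> multiforms {1..n} (\<lambda>_. 1) (udeg {1..n} M)"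
    "\<And>\<sigma>. \<sigma> permutes {1..n} \<Longrightarrow> perm_vars \<sigma> (\<Sum>a<l. b a * w a) = (\<Sum>a<l. b a * w a)"
    "(\<Sum>a<l. b a * w a) \<notin> P"
proof -
  let ?S = "{\<sigma>. \<sigma> permutes {1..n}}"
  have finS: "finite ?S" by (intro finite_permutations) simp
  define f where "f \<sigma> = (\<Sum>a<l. monom (perm_vars \<sigma> (w a)) a)" for \<sigma>
  have cf: "coeff (f \<sigma>) i = (if i < l then perm_vars \<sigma> (w i) else 0)" for \<sigma> i
  proof -
    have "coeff (f \<sigma>) i = (\<Sum>a<l. if a = i then perm_vars \<sigma> (w i) else 0)"
      unfolding f_def coeff_sum by (intro sum.cong) auto
    then show ?thesis by simp
  qed
  have cf_mf: "coeff (f \<sigma>) i \<in> multiforms {1..n} (\<lambda>_. 1) (udeg {1..n} m)" if "\<sigma> permutes {1..n}" for \<sigma> i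
    using perm_vars_udeg[OF that w] by (simp add: cf multiforms_0)
  have "\<exists>k. coeff (\<Prod>\<sigma>\<in>?S. f \<sigma>) k \<notin> P"
  proof (rule conjunct1[OF prime_poly_prod[OF P finS]])
    fix \<sigma> assume \<sigma>: "\<sigma> \<in> ?S"
    show "coeff (f \<sigma>) i \<in> polys {1..n} (\<lambda>_. 1)" for i
      using multiforms_polys[OF cf_mf] \<sigma> by simp
    show "\<exists>i. coeff (f \<sigma>) i \<notin> P"
      using av \<sigma> by (auto simp: cf)
  qed
  then obtain k where k: "coeff (\<Prod>\<sigma>\<in>?S. f \<sigma>) k \<notin> P" by blast
  \<comment> \<open>The factor of the identity has the \<open>w a\<close> themselves as
    coefficients. Splitting it off writes the chosen coefficient as a combination of the
    \<open>w a\<close>, with coefficients of \<open>H\<close> as multipliers.\<close>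
  define H where "H = (\<Prod>\<sigma>\<in>?S - {id}. f \<sigma>)"
  define b where "b a = (if a \<le> k then coeff H (k - a) else 0)" for a
  define M where "M = card (?S - {id}) * m"
  have "id \<in> ?S" by (simp add: permutes_id)
  then have "(\<Prod>\<sigma>\<in>?S. f \<sigma>) = f id * H"
    unfolding H_def using finS by (intro prod.remove) auto
  then have "coeff (\<Prod>\<sigma>\<in>?S. f \<sigma>) k = coeff (f id * H) k" by (simp only:)
  also have "\<dots> = (\<Sum>i\<le>k. (if i < l then w i else 0) * coeff H (k - i))"
    unfolding coeff_mult cf perm_vars_id ..
  also have "\<dots> = (\<Sum>i\<in>{..k} \<inter> {..<l}. b i * w i)"
    by (rule sum.mono_neutral_cong_right) (auto simp: b_def)
  also have "\<dots> = (\<Sum>a<l. b a * w a)"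
    by (rule sum.mono_neutral_left) (auto simp: b_def)
  finally have eq: "coeff (\<Prod>\<sigma>\<in>?S. f \<sigma>) k = (\<Sum>a<l. b a * w a)" .
  show thesis
  proof (rule that)
    show "b a \<in> multiforms {1..n} (\<lambda>_. 1) (udeg {1..n} M)" for a
    proof -
      have "coeff H i \<in> multiforms {1..n} (\<lambda>_. 1) (udeg {1..n} M)" for i
        unfolding M_def H_def by (rule multiforms_coeff_prod) (use finS cf_mf in simp_all)
      then show ?thesis by (simp add: b_def multiforms_0)
    qed
    show "(\<Sum>a<l. b a * w a) \<notin> P" using k unfolding eq .
    fix \<tau> assume \<tau>: "\<tau> permutes {1..n}"
    \<comment> \<open>Acting on coefficients, \<open>\<tau>\<close> sends the factor of
      \<open>\<sigma>\<close> to that of \<open>\<sigma> \<circ> \<tau>\<close>, so the product is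
      unchanged and each of its coefficients is invariant.\<close>
    have "perm_vars \<tau> (coeff (\<Prod>\<sigma>\<in>?S. f \<sigma>) k) = coeff (\<Prod>\<sigma>\<in>?S. f (\<sigma> \<circ> \<tau>)) k"
      by (rule perm_vars.hom_coeff_prod) (use perm_vars_comp[OF \<tau>] in \<open>auto simp: cf perm_vars.hom_0\<close>)
    also have "(\<Prod>\<sigma>\<in>?S. f (\<sigma> \<circ> \<tau>)) = (\<Prod>\<sigma>\<in>?S. f \<sigma>)"
      by (rule prod.reindex_bij_witness[of _ "\<lambda>\<sigma>. \<sigma> \<circ> Hilbert_Choice.inv \<tau>" "\<lambda>\<sigma>. \<sigma> \<circ> \<tau>"])
        (use \<tau> in \<open>auto simp: comp_assoc permutes_inv_o intro: permutes_compose permutes_inv\<close>)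
    finally show "perm_vars \<tau> (\<Sum>a<l. b a * w a) = (\<Sum>a<l. b a * w a)"
      by (simp only: eq)
  qed
qed

text \<open>The applications have one form for each permutation. Generating polynomials need
  numbered coefficients, so an enumeration of the group is used and then undone.\<close>

lemma invariant_avoiding_prime_perm:
  fixes P :: "'k::field mpoly set" and w :: "(nat \<Rightarrow> nat) \<Rightarrow> 'k mpoly"
  assumes P: "primeideal P (coord_ring {1..n} (\<lambda>_. 1))"
    and w: "\<And>\<tau>. \<tau> permutes {1..n} \<Longrightarrow> w \<tau> \<in> multiforms {1..n} (\<lambda>_. 1) (udeg {1..n} m)"
    and av: "\<And>\<sigma>. \<sigma> permutes {1..n} \<Longrightarrow> \<exists>\<tau>. \<tau> permutes {1..n} \<and> perm_vars \<sigma> (w \<tau>) \<notin> P"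
  obtains b M where "\<And>\<tau>. \<tau> permutes {1..n} \<Longrightarrow> b \<tau> \<in> multiforms {1..n} (\<lambda>_. 1) (udeg {1..n} M)"
    "\<And>\<sigma>. \<sigma> permutes {1..n} \<Longrightarrow>
       perm_vars \<sigma> (\<Sum>\<tau> | \<tau> permutes {1..n}. b \<tau> * w \<tau>) = (\<Sum>\<tau> | \<tau> permutes {1..n}. b \<tau> * w \<tau>)"
    "(\<Sum>\<tau> | \<tau> permutes {1..n}. b \<tau> * w \<tau>) \<notin> P"
proof -
  let ?S = "{\<sigma>. \<sigma> permutes {1..n}}"
  have "finite ?S" by (intro finite_permutations) simp
  then obtain h where h: "bij_betw h {..<card ?S} ?S"
    using ex_bij_betw_nat_finite[of ?S] by (auto simp: atLeast0LessThan)
  have hS: "h a permutes {1..n}" if "a < card ?S" for a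
    using bij_betwE[OF h] that by auto
  have av': "\<exists>a<card ?S. perm_vars \<sigma> (w (h a)) \<notin> P" if \<sigma>: "\<sigma> permutes {1..n}" for \<sigma>
  proof -
    obtain \<tau> where \<tau>: "\<tau> \<in> ?S" "perm_vars \<sigma> (w \<tau>) \<notin> P" using av[OF \<sigma>] by blast
    then obtain a where "a < card ?S" "\<tau> = h a" using bij_betw_imp_surj_on[OF h] by blast
    then show ?thesis using \<tau>(2) by blast
  qed
  obtain b M where b: "\<And>a. a < card ?S \<Longrightarrow> b a \<in> multiforms {1..n} (\<lambda>_. 1) (udeg {1..n} M)"
    "\<And>\<sigma>. \<sigma> permutes {1..n} \<Longrightarrow> perm_vars \<sigma> (\<Sum>a<card ?S. b a * w (h a)) = (\<Sum>a<card ?S. b a * w (h a))"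
    "(\<Sum>a<card ?S. b a * w (h a)) \<notin> P"
    using invariant_avoiding_prime[OF P w[OF hS] av'] by blast
  define g where "g = the_inv_into {..<card ?S} h"
  have g: "g (h a) = a" if "a < card ?S" for a
    unfolding g_def using h that by (auto simp: bij_betw_def the_inv_into_f_f)
  have eq: "(\<Sum>\<tau>\<in>?S. b (g \<tau>) * w \<tau>) = (\<Sum>a<card ?S. b a * w (h a))"
    unfolding sum.reindex_bij_betw[OF h, symmetric] by (intro sum.cong refl) (simp add: g)
  have gS: "g \<tau> < card ?S" if "\<tau> permutes {1..n}" for \<tau>
  proof -
    have "\<tau> \<in> h ` {..<card ?S}" using that bij_betw_imp_surj_on[OF h] by blast
    then show ?thesis using g by auto
  qed
  show thesis
  proof (rule that[of "\<lambda>\<tau>. b (g \<tau>)" M], unfold eq)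
    show "b (g \<tau>) \<in> multiforms {1..n} (\<lambda>_. 1) (udeg {1..n} M)" if "\<tau> permutes {1..n}" for \<tau>
      by (rule b(1)[OF gS[OF that]])
  qed (rule b(2), assumption, rule b(3))
qed

subsection \<open>Lying over\<close>

text \<open>
  The ideal \<open>N\<close> of the proof consists of the polynomials all of whose multiples have their average
  in the image of \<open>Q\<close>. Unlike the extension of \<open>Q\<close>, which it contains, it visibly contains no
  image of a form outside \<open>Q\<close>.
\<close>

lemma esym_pt_surj:
  fixes Q :: "'k::{alg_closed_field, field_char_0} mpoly set"
  assumes "n \<ge> 1" and Q: "Q \<in> multiproj_points {1} (\<lambda>_. n)"
  obtains P where "P \<in> multiproj_points {1..n} (\<lambda>_. 1)" "esym_pt n P = Q"
proof -
  interpret e: graded_hom "esym n :: 'k mpoly \<Rightarrow> _" "{1..n}" "\<lambda>_. 1" "{1}" "\<lambda>_. n" "\<lambda>d. udeg {1..n} (d 1)"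
    by (rule graded_hom_esym[OF assms(1)])
  note QD = multiproj_pointsD[OF Q] and QP = primeidealD_poly[OF multiproj_pointsD(1)[OF Q]]
  let ?S = "polys {1..n} (\<lambda>_. 1) :: 'k mpoly set" and ?R = "polys {1} (\<lambda>_. n) :: 'k mpoly set"
  define av :: "'k mpoly \<Rightarrow> 'k mpoly" where "av F = (\<Sum>\<sigma> | \<sigma> permutes {1..n}. perm_vars \<sigma> F)" for F
  have av_add: "av (F + G) = av F + av G" for F G
    by (simp only: av_def perm_vars.hom_add sum.distrib)
  have av_0: "av 0 = 0" by (simp add: av_def perm_vars.hom_0)
  have Q_img_add: "F + G \<in> esym n ` Q" if FG: "F \<in> esym n ` Q" "G \<in> esym n ` Q" for F G
    using FG poly_idealD(3)[OF QD(3)] by (auto simp: esym.hom_add[symmetric])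
  have Q_img_0: "0 \<in> esym n ` Q" using poly_idealD(2)[OF QD(3)] esym.hom_0 by force
  \<comment> \<open>Only diagonal parts are tested, because it is in these degrees that
    symmetrisations are known to lie in the image of \<open>esym n\<close>.\<close>
  define N where "N = {F \<in> ?S. \<forall>G\<in>?S. \<forall>m. av (multihom_part (udeg {1..n} m) (G * F)) \<in> esym n ` Q}"
  have N: "poly_ideal {1..n} (\<lambda>_. 1) N"
    unfolding poly_ideal_def
  proof (intro conjI ballI)
    show "N \<subseteq> ?S" by (auto simp: N_def)
    show "0 \<in> N" using Q_img_0 by (simp add: N_def polys_0 multihom_part_0 av_0)
    fix F assume F: "F \<in> N"
    show "F + G \<in> N" if "G \<in> N" for G
      using F that Q_img_add by (simp add: N_def polys_add distrib_left multihom_part_add av_add)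
    show "G * F \<in> N" if "G \<in> ?S" for G
      using F that by (simp add: N_def polys_mult mult.assoc[symmetric])
  qed
  have Nmh: "multihom N"
    unfolding multihom_def
  proof (intro ballI allI)
    fix F d assume F: "F \<in> N"
    then have FS: "F \<in> ?S" by (simp add: N_def)
    have "av (multihom_part (udeg {1..n} m) (G * multihom_part d F)) \<in> esym n ` Q" if G: "G \<in> ?S" for G m
    proof (cases "\<forall>i. d i \<le> udeg {1..n} m i")
      case True
      let ?G = "multihom_part (\<lambda>i. udeg {1..n} m i - d i) G"
      have 1: "multihom_part (udeg {1..n} m) (G * multihom_part d F) = ?G * multihom_part d F"
        using True by (simp add: multihom_part_mult_multiform'[OF multihom_part_in_multiforms[OF FS]])
      \<comment> \<open>Testing a homogeneous part of \<open>F\<close> against \<open>G\<close>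
        amounts to testing \<open>F\<close> itself against the complementary part of
        \<open>G\<close>.\<close>
      have "multihom_part (udeg {1..n} m) (F * ?G) =
          multihom_part (\<lambda>i. udeg {1..n} m i - (udeg {1..n} m i - d i)) F * ?G"
        by (simp add: multihom_part_mult_multiform'[OF multihom_part_in_multiforms[OF G]])
      also have "(\<lambda>i. udeg {1..n} m i - (udeg {1..n} m i - d i)) = d" using True by auto
      finally have 2: "multihom_part (udeg {1..n} m) (G * multihom_part d F) = multihom_part (udeg {1..n} m) (?G * F)"
        unfolding 1 by (simp only: mult.commute)
      show ?thesis
        unfolding 2 using F multihom_part_polys[OF G] by (simp add: N_def)
    next
      case False
      then have "multihom_part (udeg {1..n} m) (G * multihom_part d F) = 0"
        by (subst multihom_part_mult_multiform'[OF multihom_part_in_multiforms[OF FS]]) (simp only: if_False)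
      then show ?thesis using Q_img_0 by (simp only: av_0)
    qed
    then show "multihom_part d F \<in> N" using multihom_part_polys[OF FS] by (simp add: N_def)
  qed
  have QN: "esym n q \<in> N" if q: "q \<in> Q" for q
  proof -
    have qR: "q \<in> ?R" using poly_idealD(1)[OF QD(3) q] .
    have "esym n (multihom_part d q) \<in> N" for d
    proof -
      let ?q = "multihom_part d q"
      have dq: "?q \<in> Q" using QD(2) q by (simp add: multihom_def)
      have eq: "esym n ?q \<in> multiforms {1..n} (\<lambda>_. 1) (udeg {1..n} (d 1))"
        by (rule esym_multiforms) (rule multihom_part_in_multiforms[OF qR])
      have "av (multihom_part (udeg {1..n} m) (G * esym n ?q)) \<in> esym n ` Q" if G: "G \<in> ?S" for G m
      proof (cases "\<forall>i. udeg {1..n} (d 1) i \<le> udeg {1..n} m i")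
        case True
        let ?G = "multihom_part (udeg {1..n} (m - d 1)) G"
        have "(\<lambda>i. udeg {1..n} m i - udeg {1..n} (d 1) i) = udeg {1..n} (m - d 1)"
          by (auto simp: udeg_def)
        then have "multihom_part (udeg {1..n} m) (G * esym n ?q) = ?G * esym n ?q"
          using True by (simp add: multihom_part_mult_multiform'[OF eq])
        then have "av (multihom_part (udeg {1..n} m) (G * esym n ?q)) = av (esym n ?q * ?G)"
          by (simp only: mult.commute)
        \<comment> \<open>Averaging is linear over invariants, and the average of \<open>?G\<close>
          comes from the target ring, so the product stays in the image of the ideal
          \<open>Q\<close>.\<close>
        also have "\<dots> = esym n ?q * av ?G"
          unfolding av_def by (rule sum_perm_vars_invariant) (rule perm_vars_esym[OF _ multihom_part_polys[OF qR]])
        also have "\<dots> \<in> esym n ` Q"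
        proof -
          have "av ?G \<in> sym_img n (m - d 1)"
            unfolding av_def by (rule sym_img_symmetrised[OF multihom_part_in_multiforms[OF G]])
          then obtain H where "av ?G = esym n H" "H \<in> multiforms {1} (\<lambda>_. n) (udeg {1} (m - d 1))"
            by (auto simp: sym_img_def)
          then show ?thesis
            using poly_idealD(5)[OF QD(3) dq multiforms_polys] by (auto simp: esym.hom_mult[symmetric])
        qed
        finally show ?thesis .
      next
        case False
        then have "multihom_part (udeg {1..n} m) (G * esym n ?q) = 0"
          by (subst multihom_part_mult_multiform'[OF eq]) (simp only: if_False)
        then show ?thesis using Q_img_0 by (simp only: av_0)
      qed
      then show ?thesis using multiforms_polys[OF eq] by (simp add: N_def)
    qed
    then have "(\<Sum>d\<in>multideg ` Poly_Mapping.keys q. esym n (multihom_part d q)) \<in> N"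
      by (intro poly_ideal_sum[OF N])
    then show ?thesis
      using arg_cong[OF multihom_part_decomp[of q], of "esym n"] by (simp only: esym.hom_sum)
  qed
  define T where "T = {esym n f | f d. f \<in> multiforms {1} (\<lambda>_. n) d \<and> f \<notin> Q}"
  have "\<exists>P. primeideal P (coord_ring {1..n} (\<lambda>_. 1)) \<and> multihom P \<and> N \<subseteq> P \<and> T \<inter> P = {}"
  proof (rule exists_multihom_prime_disjoint[OF N Nmh])
    show "\<exists>d. a \<in> multiforms {1..n} (\<lambda>_. 1) d" if "a \<in> T" for a
      using that esym_multiforms by (auto simp: T_def)
    have "1 = esym n 1" by (simp only: esym.hom_1)
    then show "1 \<in> T" unfolding T_def using multiforms_1 QP(2) by blast
    fix a b assume "a \<in> T" "b \<in> T"
    then obtain f d g d' where fg: "a = esym n f" "f \<in> multiforms {1} (\<lambda>_. n) d" "f \<notin> Q"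
      "b = esym n g" "g \<in> multiforms {1} (\<lambda>_. n) d'" "g \<notin> Q" unfolding T_def by blast
    have "a * b = esym n (f * g)" by (simp only: fg esym.hom_mult)
    moreover have "f * g \<notin> Q" using QP(3)[OF multiforms_polys[OF fg(2)] multiforms_polys[OF fg(5)]] fg by blast
    ultimately show "a * b \<in> T" unfolding T_def using multiforms_mult[OF fg(2,5)] by blast
  next
    show "T \<inter> N = {}"
    proof (rule ccontr)
      assume "T \<inter> N \<noteq> {}"
      then obtain f d where f: "f \<in> multiforms {1} (\<lambda>_. n) d" "f \<notin> Q" "esym n f \<in> N"
        unfolding T_def by blast
      note fR = multiforms_polys[OF f(1)]
      have "av (multihom_part (udeg {1..n} (d 1)) (1 * esym n f)) \<in> esym n ` Q"
        using f(3) polys_1 unfolding N_def by blast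
      then obtain q where q: "q \<in> Q" "av (esym n f) = esym n q"
        using multihom_part_multiforms[OF esym_multiforms[OF f(1)]] by auto
      \<comment> \<open>An image of \<open>esym n\<close> is its own average. By injectivity
        \<open>f\<close> would be a constant multiple of an element of \<open>Q\<close>.\<close>
      have "esym n f = Cst (1 / fact n) * av (esym n f)"
        unfolding av_def by (rule sum_perm_vars_const[symmetric]) (rule perm_vars_esym[OF _ fR])
      also have "\<dots> = esym n (Cst (1 / fact n) * q)"
        unfolding q by (simp only: esym.hom_mult esym.hom_Cst)
      finally have "f = Cst (1 / fact n) * q"
        by (rule esym_inject[OF assms(1) fR polys_mult[OF polys_Cst poly_idealD(1)[OF QD(3) q(1)]]])
      then show False using f(2) poly_idealD(4)[OF QD(3) q(1) polys_Cst] by simp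
    qed
  qed
  then obtain P where P: "primeideal P (coord_ring {1..n} (\<lambda>_. 1))" "multihom P" "N \<subseteq> P" "T \<inter> P = {}"
    by blast
  note PI = primeidealD_poly(1)[OF P(1)]
  have eqQ: "esym_pt n P = Q"
  proof (intro equalityI subsetI)
    fix F assume "F \<in> Q"
    then show "F \<in> esym_pt n P" using QN P(3) poly_idealD(1)[OF QD(3)] by (auto simp: esym_pt_def)
  next
    fix F assume "F \<in> esym_pt n P"
    then have F: "F \<in> ?R" "esym n F \<in> P" by (auto simp: esym_pt_def)
    show "F \<in> Q"
    proof (rule ccontr)
      assume "F \<notin> Q"
      then obtain d where d: "multihom_part d F \<in> multiforms {1} (\<lambda>_. n) d" "multihom_part d F \<notin> Q"
        by (rule multihom_part_notin[OF QD(3) F(1)])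
      have "\<forall>i. i \<notin> {1} \<longrightarrow> d i = 0"
        using e.hom_part_support[OF F(1)] d(2) poly_idealD(2)[OF QD(3)] by metis
      then have "esym n (multihom_part d F) = multihom_part (udeg {1..n} (d 1)) (esym n F)"
        using e.hom_part[OF F(1), of d] by simp
      then have "esym n (multihom_part d F) \<in> P" using P(2) F(2) by (simp add: multihom_def)
      then show False using d P(4) unfolding T_def by blast
    qed
  qed
  \<comment> \<open>Relevance of \<open>P\<close> is inherited from \<open>Q\<close>: if both
    coordinates of one factor were in \<open>P\<close>, so would be all \<open>elem_hom n j\<close>,
    which have degree 1 in that factor, and \<open>Q\<close> would contain all coordinates.\<close>
  have "\<exists>j\<le>1. Var i j \<notin> P" if i: "i \<in> {1..n}" for i
  proof (rule ccontr)
    assume "\<not> ?thesis"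
    then have all: "\<And>j. j \<le> 1 \<Longrightarrow> Var i j \<in> P" by blast
    have "elem_hom n j \<in> P" for j
      by (rule multiform_in_ideal[OF PI _ all elem_hom_udeg]) (use i in \<open>auto simp: udeg_def\<close>)
    moreover obtain j where j: "j \<le> n" "Var 1 j \<notin> Q" using QD(4)[of 1] by auto
    ultimately have "Var 1 j \<in> esym_pt n P" by (auto simp: esym_pt_def esym_Var intro: polys_Var)
    then show False using eqQ j by blast
  qed
  then have "P \<in> multiproj_points {1..n} (\<lambda>_. 1)" unfolding multiproj_points_iff using P by blast
  then show thesis using that eqQ by blast
qed

subsection \<open>Fibres are orbits\<close>

text \<open>If \<open>P'\<close> were contained in no translate of \<open>P\<close>, forms of
  \<open>P'\<close> outside the various translates would combine to a symmetric form in
  \<open>P'\<close> but not in \<open>P\<close>. It comes from the target ring, where the two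
  contractions agree.\<close>

lemma esym_pt_fibre_subset:
  fixes P P' :: "'k::{alg_closed_field, field_char_0} mpoly set"
  assumes "n \<ge> 1" and P: "P \<in> multiproj_points {1..n} (\<lambda>_. 1)" and P': "P' \<in> multiproj_points {1..n} (\<lambda>_. 1)"
    and eq: "esym_pt n P = esym_pt n P'"
  obtains \<sigma> where "\<sigma> permutes {1..n}" "P' \<subseteq> perm_pt n \<sigma> P"
proof -
  let ?mf = "multiforms {1..n} (\<lambda>_. 1) :: _ \<Rightarrow> 'k mpoly set"
  let ?S = "{\<sigma>. \<sigma> permutes {1..n}}"
  note PD = multiproj_pointsD[OF P] and PD' = multiproj_pointsD[OF P']
  have "\<exists>\<sigma>. \<sigma> permutes {1..n} \<and> P' \<subseteq> perm_pt n \<sigma> P"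
  proof (rule ccontr)
    assume no: "\<not> ?thesis"
    have "\<exists>F d. F \<in> ?mf d \<and> F \<in> P' \<and> F \<notin> perm_pt n \<sigma> P" if \<sigma>: "\<sigma> permutes {1..n}" for \<sigma>
    proof -
      note PS = multiproj_pointsD[OF perm_pt_point[OF \<sigma> P]]
      obtain F where F: "F \<in> P'" "F \<notin> perm_pt n \<sigma> P" using no \<sigma> by blast
      obtain d where "multihom_part d F \<in> ?mf d" "multihom_part d F \<notin> perm_pt n \<sigma> P"
        by (rule multihom_part_notin[OF PS(3) poly_idealD(1)[OF PD'(3) F(1)] F(2)])
      then show ?thesis using PD'(2) F(1) unfolding multihom_def by blast
    qed
    then obtain F d where F: "\<And>\<sigma>. \<sigma> permutes {1..n} \<Longrightarrow> F \<sigma> \<in> ?mf (d \<sigma>)"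
      "\<And>\<sigma>. \<sigma> permutes {1..n} \<Longrightarrow> F \<sigma> \<in> P'" "\<And>\<sigma>. \<sigma> permutes {1..n} \<Longrightarrow> F \<sigma> \<notin> perm_pt n \<sigma> P"
      by metis
    have finS: "finite ?S" by (intro finite_permutations) simp
    \<comment> \<open>A bound for all degrees that occur, so that the chosen forms can be raised to
      one common diagonal degree.\<close>
    define m where "m = (\<Sum>\<sigma>\<in>?S. \<Sum>i\<in>{1..n}. d \<sigma> i)"
    have m: "d \<sigma> i \<le> m" if "\<sigma> permutes {1..n}" "i \<in> {1..n}" for \<sigma> i
    proof -
      have "d \<sigma> i \<le> (\<Sum>i\<in>{1..n}. d \<sigma> i)" using that by (intro member_le_sum) auto
      also have "\<dots> \<le> m" unfolding m_def using that finS by (intro member_le_sum) auto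
      finally show ?thesis .
    qed
    have "\<exists>w. w \<in> ?mf (udeg {1..n} m) \<and> w \<in> P' \<and> perm_vars \<sigma> w \<notin> P" if \<sigma>: "\<sigma> permutes {1..n}" for \<sigma>
    proof -
      note PS = perm_pt_point[OF \<sigma> P]
      have "F \<sigma> \<noteq> 0" using F(3)[OF \<sigma>] poly_idealD(2)[OF multiproj_pointsD(3)[OF PS]] by metis
      then have d0: "\<And>i. i \<notin> {1..n} \<Longrightarrow> d \<sigma> i = 0" by (rule multiforms_degree_support[OF F(1)[OF \<sigma>]])
      obtain u where u: "u \<in> ?mf (\<lambda>i. udeg {1..n} m i - d \<sigma> i)" "u \<notin> perm_pt n \<sigma> P"
        "\<And>F. F \<in> ?mf (d \<sigma>) \<Longrightarrow> u * F \<in> ?mf (udeg {1..n} m)"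
        using raise_degree[where d = "d \<sigma>", OF PS finite_atLeastAtMost m[OF \<sigma>] d0] by blast
      have "u * F \<sigma> \<notin> perm_pt n \<sigma> P"
        using primeidealD_poly(3)[OF multiproj_pointsD(1)[OF PS] multiforms_polys[OF u(1)] multiforms_polys[OF F(1)[OF \<sigma>]]]
          u(2) F(3)[OF \<sigma>] by blast
      moreover have "u * F \<sigma> \<in> polys {1..n} (\<lambda>_. 1)"
        by (rule polys_mult[OF multiforms_polys[OF u(1)] multiforms_polys[OF F(1)[OF \<sigma>]]])
      ultimately have "perm_vars \<sigma> (u * F \<sigma>) \<notin> P" by (simp add: perm_pt_def)
      moreover have "u * F \<sigma> \<in> P'" by (rule poly_idealD(4)[OF PD'(3) F(2)[OF \<sigma>] multiforms_polys[OF u(1)]])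
      ultimately show ?thesis using u(3)[OF F(1)[OF \<sigma>]] by blast
    qed
    then obtain w where w: "\<And>\<sigma>. \<sigma> permutes {1..n} \<Longrightarrow> w \<sigma> \<in> ?mf (udeg {1..n} m)"
      "\<And>\<sigma>. \<sigma> permutes {1..n} \<Longrightarrow> w \<sigma> \<in> P'" "\<And>\<sigma>. \<sigma> permutes {1..n} \<Longrightarrow> perm_vars \<sigma> (w \<sigma>) \<notin> P"
      by metis
    have av: "\<exists>\<tau>. \<tau> permutes {1..n} \<and> perm_vars \<sigma> (w \<tau>) \<notin> P" if "\<sigma> permutes {1..n}" for \<sigma>
      using w(3) that by blast
    obtain b M where b: "\<And>\<tau>. \<tau> permutes {1..n} \<Longrightarrow> b \<tau> \<in> ?mf (udeg {1..n} M)"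
      "\<And>\<sigma>. \<sigma> permutes {1..n} \<Longrightarrow>
       perm_vars \<sigma> (\<Sum>\<tau> | \<tau> permutes {1..n}. b \<tau> * w \<tau>) = (\<Sum>\<tau> | \<tau> permutes {1..n}. b \<tau> * w \<tau>)"
      "(\<Sum>\<tau> | \<tau> permutes {1..n}. b \<tau> * w \<tau>) \<notin> P"
      using invariant_avoiding_prime_perm[OF PD(1) w(1) av] by blast
    let ?c = "\<Sum>\<tau> | \<tau> permutes {1..n}. b \<tau> * w \<tau>"
    have "?c \<in> ?mf (udeg {1..n} (M + m))"
      unfolding udeg_add[symmetric] by (intro multiforms_sum multiforms_mult) (use b(1) w(1) in auto)
    then obtain H where H: "H \<in> multiforms {1} (\<lambda>_. n) (udeg {1} (M + m))" "esym n H = ?c"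
      using invariant_in_sym_img b(2) by blast
    have "?c \<in> P'"
    proof (rule poly_ideal_sum[OF PD'(3)])
      fix \<tau> assume "\<tau> \<in> ?S"
      then have \<tau>: "\<tau> permutes {1..n}" by simp
      show "b \<tau> * w \<tau> \<in> P'" by (rule poly_idealD(4)[OF PD'(3) w(2)[OF \<tau>] multiforms_polys[OF b(1)[OF \<tau>]]])
    qed
    then have "H \<in> esym_pt n P'" using H multiforms_polys[OF H(1)] by (simp add: esym_pt_def)
    then have "H \<in> esym_pt n P" using eq by simp
    then show False using b(3) H(2) by (simp add: esym_pt_def)
  qed
  then show thesis using that by blast
qed

text \<open>The inclusions in both directions place \<open>P'\<close> inside its own translate by
  \<open>\<rho>\<close>. Since \<open>\<rho>\<close> has finite order, the increasing chain of
  translates returns to \<open>P'\<close> and all its inclusions are equalities.\<close>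

lemma esym_pt_fibre:
  fixes P P' :: "'k::{alg_closed_field, field_char_0} mpoly set"
  assumes "n \<ge> 1" and P: "P \<in> multiproj_points {1..n} (\<lambda>_. 1)" and P': "P' \<in> multiproj_points {1..n} (\<lambda>_. 1)"
    and eq: "esym_pt n P = esym_pt n P'"
  obtains \<sigma> where "\<sigma> permutes {1..n}" "P' = perm_pt n \<sigma> P"
proof -
  obtain \<sigma> where \<sigma>: "\<sigma> permutes {1..n}" "P' \<subseteq> perm_pt n \<sigma> P"
    by (rule esym_pt_fibre_subset[OF assms])
  obtain \<tau> where \<tau>: "\<tau> permutes {1..n}" "P \<subseteq> perm_pt n \<tau> P'"
    by (rule esym_pt_fibre_subset[OF assms(1) P' P eq[symmetric]])
  define \<rho> where "\<rho> = \<sigma> \<circ> \<tau>"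
  have \<rho>: "\<rho> permutes {1..n}" unfolding \<rho>_def using \<sigma>(1) \<tau>(1) by (rule permutes_compose[rotated])
  have sub: "perm_pt n \<sigma> P \<subseteq> perm_pt n \<rho> P'"
    using perm_pt_mono[OF \<tau>(2), of n \<sigma>] unfolding perm_pt_comp[OF \<sigma>(1) \<tau>(1)] \<rho>_def .
  have step: "P' \<subseteq> perm_pt n \<rho> P'" using \<sigma>(2) sub by blast
  have pow: "(\<rho> ^^ k) permutes {1..n}" for k
    by (induction k) (simp_all only: funpow.simps permutes_id permutes_compose[OF _ \<rho>])
  have iter: "perm_pt n \<rho> P' \<subseteq> perm_pt n (\<rho> ^^ Suc k) P'" for k
  proof (induction k)
    case (Suc k)
    have "perm_pt n \<rho> P' \<subseteq> perm_pt n \<rho> (perm_pt n (\<rho> ^^ Suc k) P')"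
      by (rule perm_pt_mono) (use step Suc.IH in blast)
    then show ?case unfolding perm_pt_comp[OF \<rho> pow] by (simp only: funpow.simps)
  qed simp
  obtain k where k: "\<rho> ^^ Suc k = id"
  proof -
    have "permutation \<rho>" using \<rho> by (auto simp: permutation_permutes)
    then obtain k where "\<rho> ^^ k = id" "k > 0" using permutation_is_nilpotent by blast
    then show thesis using that[of "k - 1"] by simp
  qed
  have "perm_pt n \<rho> P' \<subseteq> P'"
    using iter[of k] unfolding k perm_pt_id[OF multiproj_pointsD(3)[OF P']] .
  then have "P' = perm_pt n \<sigma> P" using \<sigma>(2) sub by blast
  then show thesis using that \<sigma>(1) by blast
qed

section \<open>Closed subschemes of products of projective spaces\<close>

definition mform :: "nat set \<Rightarrow> (nat \<Rightarrow> nat) \<Rightarrow> 'k::field mpoly \<Rightarrow> bool" where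
  "mform I r f \<longleftrightarrow> (\<exists>d. f \<in> multiforms I r d)"

text \<open>The relation is not transitive, because 0 is a form of every degree.\<close>

definition same_deg :: "nat set \<Rightarrow> (nat \<Rightarrow> nat) \<Rightarrow> 'k::field mpoly \<Rightarrow> 'k mpoly \<Rightarrow> bool" where
  "same_deg I r a f \<longleftrightarrow> (\<exists>d. a \<in> multiforms I r d \<and> f \<in> multiforms I r d)"

lemma same_degI: "a \<in> multiforms I r d \<Longrightarrow> f \<in> multiforms I r d \<Longrightarrow> same_deg I r a f"
  by (auto simp: same_deg_def)

lemma mformI: "f \<in> multiforms I r d \<Longrightarrow> mform I r f"
  by (auto simp: mform_def)

lemma mform_polys: "mform I r f \<Longrightarrow> f \<in> polys I r"
  by (auto simp: mform_def multiforms_def)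

lemma same_deg_mform: "same_deg I r a f \<Longrightarrow> mform I r a" "same_deg I r a f \<Longrightarrow> mform I r f"
  by (auto simp: mform_def same_deg_def)

lemma same_deg_polys: "same_deg I r a f \<Longrightarrow> a \<in> polys I r" "same_deg I r a f \<Longrightarrow> f \<in> polys I r"
  by (auto intro: mform_polys same_deg_mform)

lemma same_deg_refl: "mform I r f \<Longrightarrow> same_deg I r f f"
  by (auto simp: mform_def same_deg_def)

lemma same_deg_sym: "same_deg I r a f \<Longrightarrow> same_deg I r f a"
  by (auto simp: same_deg_def)

lemma same_deg_1: "same_deg I r 1 1"
  using multiforms_1 by (auto simp: same_deg_def)

lemma same_deg_Cst: "same_deg I r (Cst c) 1"
  unfolding same_deg_def using multiforms_1[of I r] multiforms_Cst[of c I r] by blast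

lemma same_deg_0: "mform I r f \<Longrightarrow> same_deg I r 0 f"
  using multiforms_0 by (auto simp: mform_def same_deg_def)

lemma mform_mult: "mform I r f \<Longrightarrow> mform I r g \<Longrightarrow> mform I r (f * g)"
  by (auto simp: mform_def dest: multiforms_mult)

lemma same_deg_mult: "same_deg I r a f \<Longrightarrow> same_deg I r b g \<Longrightarrow> same_deg I r (a * b) (f * g)"
  by (auto simp: same_deg_def dest: multiforms_mult)

lemma multiforms_mult_commute:
  "F \<in> multiforms I r d \<Longrightarrow> G \<in> multiforms I r e \<Longrightarrow> G * F \<in> multiforms I r (\<lambda>i. d i + e i)"
  using multiforms_mult[of F I r d G e] by (simp only: mult.commute)

lemma same_deg_cross_add:
  "same_deg I r a f \<Longrightarrow> same_deg I r b g \<Longrightarrow> same_deg I r (a * g + b * f) (f * g)"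
  unfolding same_deg_def by (metis multiforms_add multiforms_mult multiforms_mult_commute)

lemma same_deg_uminus: "same_deg I r a f \<Longrightarrow> same_deg I r (- a) f"
  by (auto simp: same_deg_def dest: multiforms_uminus)

lemma same_deg_cross_diff:
  "same_deg I r a f \<Longrightarrow> same_deg I r b g \<Longrightarrow> same_deg I r (a * g - b * f) (f * g)"
  using same_deg_cross_add[of I r a f "- b" g] same_deg_uminus[of I r b g] by simp

lemma basic_open_mult:
  assumes "f \<in> polys I r" "g \<in> polys I r"
  shows "basic_open I r (f * g) = basic_open I r f \<inter> basic_open I r g"
proof -
  have "f * g \<notin> P \<longleftrightarrow> f \<notin> P \<and> g \<notin> P" if "P \<in> multiproj_points I r" for P
    by (simp add: primeidealD_poly(3)[OF multiproj_pointsD(1)[OF that] assms])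
  then show ?thesis by (auto simp: basic_open_def)
qed

lemma basic_open_1: "basic_open I r 1 = multiproj_points I r"
  using primeidealD_poly(2)[OF multiproj_pointsD(1)] by (auto simp: basic_open_def)

lemma points_multiproj: "points (multiproj I r) = multiproj_points I r"
proof -
  have "multiproj_points I r \<in> {basic_open I r F |F d. F \<in> multiforms I r d}"
    using basic_open_1 multiforms_1 by blast
  then show ?thesis by (auto simp: multiproj_def basic_open_def)
qed

lemma openin_basic_open: "mform I r f \<Longrightarrow> openin (undertop (multiproj I r)) (basic_open I r f)"
  unfolding multiproj_def lrspace.simps mform_def by (rule topology_generated_by_Basis) blast

text \<open>The basic open sets are closed under finite intersections, as the ideals are prime, so
  the subbase of the definition is a base.\<close>

lemma openin_multiproj:
  "openin (undertop (multiproj I r)) U \<longleftrightarrow>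
     U \<subseteq> multiproj_points I r \<and> (\<forall>P\<in>U. \<exists>f. mform I r f \<and> f \<notin> P \<and> basic_open I r f \<subseteq> U)"
proof
  assume op: "openin (undertop (multiproj I r)) U"
  then have "generate_topology_on {basic_open I r F |F d. F \<in> multiforms I r d} U"
    by (simp add: multiproj_def openin_topology_generated_by_iff)
  then show "U \<subseteq> multiproj_points I r \<and> (\<forall>P\<in>U. \<exists>f. mform I r f \<and> f \<notin> P \<and> basic_open I r f \<subseteq> U)"
  proof (induction rule: generate_topology_on.induct)
    case (Int U V)
    show ?case
    proof (intro conjI ballI)
      show "U \<inter> V \<subseteq> multiproj_points I r" using Int.IH(1) by blast
      fix P assume P: "P \<in> U \<inter> V"
      obtain f where f: "mform I r f" "f \<notin> P" "basic_open I r f \<subseteq> U" using Int.IH(1) P by auto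
      obtain g where g: "mform I r g" "g \<notin> P" "basic_open I r g \<subseteq> V" using Int.IH(2) P by auto
      have pp: "P \<in> multiproj_points I r" using Int.IH(1) P by blast
      have "f * g \<notin> P"
        using primeidealD_poly(3)[OF multiproj_pointsD(1)[OF pp] mform_polys[OF f(1)] mform_polys[OF g(1)]] f g by blast
      moreover have "basic_open I r (f * g) \<subseteq> U \<inter> V"
        using f g by (auto simp: basic_open_mult mform_polys)
      ultimately show "\<exists>f. mform I r f \<and> f \<notin> P \<and> basic_open I r f \<subseteq> U \<inter> V"
        using mform_mult[OF f(1) g(1)] by blast
    qed
  next
    case (UN K)
    show ?case
    proof (intro conjI ballI)
      show "\<Union>K \<subseteq> multiproj_points I r" using UN.IH by auto
      fix P assume "P \<in> \<Union>K"
      then obtain U where U: "U \<in> K" "P \<in> U" by blast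
      then obtain f where "mform I r f" "f \<notin> P" "basic_open I r f \<subseteq> U"
        using UN.IH[OF U(1)] U(2) by auto
      then show "\<exists>f. mform I r f \<and> f \<notin> P \<and> basic_open I r f \<subseteq> \<Union>K" using U(1) by auto
    qed
  next
    case (Basis U)
    then show ?case by (auto simp: mform_def basic_open_def)
  qed auto
next
  assume *: "U \<subseteq> multiproj_points I r \<and> (\<forall>P\<in>U. \<exists>f. mform I r f \<and> f \<notin> P \<and> basic_open I r f \<subseteq> U)"
  have "\<exists>T. openin (undertop (multiproj I r)) T \<and> P \<in> T \<and> T \<subseteq> U" if PU: "P \<in> U" for P
  proof -
    obtain f where f: "mform I r f" "f \<notin> P" "basic_open I r f \<subseteq> U" using * PU by blast
    have "P \<in> basic_open I r f" using * PU f(2) by (auto simp: basic_open_def)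
    then show ?thesis using openin_basic_open[OF f(1)] f(3) by blast
  qed
  then show "openin (undertop (multiproj I r)) U" by (subst openin_subopen) blast
qed

subsection \<open>Local rings\<close>

lemma stalk_multiproj_simps:
  "carrier (stalk (multiproj I r) P) = degree_zero_fractions I r P"
  "mult (stalk (multiproj I r) P) = (*)" "one (stalk (multiproj I r) P) = 1"
  "zero (stalk (multiproj I r) P) = 0" "add (stalk (multiproj I r) P) = (+)"
  by (simp_all add: multiproj_def)

lemma degree_zero_fractions_iff:
  "z \<in> degree_zero_fractions I r P \<longleftrightarrow> (\<exists>a f. z = Fract a f \<and> same_deg I r a f \<and> f \<notin> P)"
  by (auto simp: degree_zero_fractions_def same_deg_def)

lemma ideal_sheaf_iff:
  "z \<in> ideal_sheaf I r A P \<longleftrightarrow> (\<exists>a f. z = Fract a f \<and> a \<in> A \<and> same_deg I r a f \<and> f \<notin> P)"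
  by (auto simp: ideal_sheaf_def same_deg_def)

lemma prime_mult_notin:
  "primeideal P (coord_ring I r) \<Longrightarrow> f \<in> polys I r \<Longrightarrow> g \<in> polys I r \<Longrightarrow> f \<notin> P \<Longrightarrow> g \<notin> P \<Longrightarrow> f * g \<notin> P"
  by (simp add: primeidealD_poly(3))

lemma prime_notin_nonzero: "primeideal P (coord_ring I r) \<Longrightarrow> f \<notin> P \<Longrightarrow> f \<noteq> 0"
  using poly_idealD(2)[OF primeidealD_poly(1)] by blast

lemma degree_zero_fractions_closed:
  assumes P: "primeideal P (coord_ring I r)"
    and x: "x \<in> degree_zero_fractions I r P" and y: "y \<in> degree_zero_fractions I r P"
  shows "x + y \<in> degree_zero_fractions I r P" "x * y \<in> degree_zero_fractions I r P"
    "- x \<in> degree_zero_fractions I r P"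
proof -
  obtain a f where x: "x = Fract a f" "same_deg I r a f" "f \<notin> P" using x by (auto simp: degree_zero_fractions_iff)
  obtain b g where y: "y = Fract b g" "same_deg I r b g" "g \<notin> P" using y by (auto simp: degree_zero_fractions_iff)
  have fg: "f * g \<notin> P" by (intro prime_mult_notin[OF P] same_deg_polys(2)[OF x(2)] same_deg_polys(2)[OF y(2)] x y)
  have nz: "f \<noteq> 0" "g \<noteq> 0" using prime_notin_nonzero[OF P] x y by auto
  have "x + y = Fract (a * g + b * f) (f * g)" using nz by (simp add: x y)
  then show "x + y \<in> degree_zero_fractions I r P"
    unfolding degree_zero_fractions_iff using same_deg_cross_add[OF x(2) y(2)] fg by blast
  have "x * y = Fract (a * b) (f * g)" by (simp add: x y)
  then show "x * y \<in> degree_zero_fractions I r P"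
    unfolding degree_zero_fractions_iff using same_deg_mult[OF x(2) y(2)] fg by blast
  have "- x = Fract (- a) f" by (simp add: x)
  then show "- x \<in> degree_zero_fractions I r P"
    unfolding degree_zero_fractions_iff using same_deg_uminus[OF x(2)] x(3) by blast
qed

lemma degree_zero_fractions_1:
  "primeideal P (coord_ring I r) \<Longrightarrow> 1 \<in> degree_zero_fractions I r P"
  unfolding degree_zero_fractions_iff One_fract_def
  using same_deg_1 primeidealD_poly(2) by blast

lemma degree_zero_fractions_0:
  "primeideal P (coord_ring I r) \<Longrightarrow> 0 \<in> degree_zero_fractions I r P"
  unfolding degree_zero_fractions_iff Zero_fract_def
  using same_deg_0[OF mformI[OF multiforms_1]] primeidealD_poly(2) by blast

lemma cring_stalk:
  assumes P: "primeideal P (coord_ring I r)"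
  shows "cring (stalk (multiproj I r) P)"
proof (rule cringI)
  note closed = degree_zero_fractions_closed[OF P] degree_zero_fractions_1[OF P] degree_zero_fractions_0[OF P]
  show "abelian_group (stalk (multiproj I r) P)"
  proof (rule abelian_groupI)
    fix x assume x: "x \<in> carrier (stalk (multiproj I r) P)"
    show "\<exists>y\<in>carrier (stalk (multiproj I r) P). y \<oplus>\<^bsub>stalk (multiproj I r) P\<^esub> x = \<zero>\<^bsub>stalk (multiproj I r) P\<^esub>"
      using x by (intro bexI[of _ "- x"]) (auto simp: stalk_multiproj_simps closed)
  qed (auto simp: stalk_multiproj_simps closed algebra_simps)
  show "comm_monoid (stalk (multiproj I r) P)"
    by (rule comm_monoidI) (auto simp: stalk_multiproj_simps closed algebra_simps)
qed (auto simp: stalk_multiproj_simps algebra_simps)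

lemma stalk_minus:
  assumes P: "primeideal P (coord_ring I r)"
    and x: "x \<in> degree_zero_fractions I r P" and y: "y \<in> degree_zero_fractions I r P"
  shows "x \<ominus>\<^bsub>stalk (multiproj I r) P\<^esub> y = x - y"
proof -
  interpret cring "stalk (multiproj I r) P" by (rule cring_stalk[OF P])
  have "\<ominus>\<^bsub>stalk (multiproj I r) P\<^esub> y = - y"
    by (rule minus_equality) (auto simp: stalk_multiproj_simps degree_zero_fractions_closed(3)[OF P y y] y)
  then show ?thesis by (simp add: a_minus_def stalk_multiproj_simps)
qed

lemma ideal_sheaf_subset: "ideal_sheaf I r A P \<subseteq> degree_zero_fractions I r P"
  unfolding subset_iff ideal_sheaf_iff degree_zero_fractions_iff by blast

lemma ideal_ideal_sheaf:
  assumes P: "primeideal P (coord_ring I r)" and A: "poly_ideal I r A"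
  shows "ideal (ideal_sheaf I r A P) (stalk (multiproj I r) P)"
proof -
  interpret cring "stalk (multiproj I r) P" by (rule cring_stalk[OF P])
  note AD = poly_idealD[OF A]
  have mult: "x * y \<in> ideal_sheaf I r A P"
    if xx: "x \<in> degree_zero_fractions I r P" and yy: "y \<in> ideal_sheaf I r A P" for x y
  proof -
    obtain a f where x: "x = Fract a f" "same_deg I r a f" "f \<notin> P" using xx by (auto simp: degree_zero_fractions_iff)
    obtain b g where y: "y = Fract b g" "b \<in> A" "same_deg I r b g" "g \<notin> P" using yy by (auto simp: ideal_sheaf_iff)
    have "x * y = Fract (a * b) (f * g)" by (simp add: x y)
    moreover have "a * b \<in> A" by (rule AD(4)[OF y(2) same_deg_polys(1)[OF x(2)]])
    moreover have "f * g \<notin> P"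
      by (intro prime_mult_notin[OF P] same_deg_polys(2)[OF x(2)] same_deg_polys(2)[OF y(3)] x y)
    ultimately show ?thesis
      unfolding ideal_sheaf_iff using same_deg_mult[OF x(2) y(3)] by blast
  qed
  have uminus: "- x \<in> ideal_sheaf I r A P" if "x \<in> ideal_sheaf I r A P" for x
    using mult[of "- 1" x] that degree_zero_fractions_1[OF P] degree_zero_fractions_closed(3)[OF P] by simp
  show ?thesis
  proof (rule idealI)
    show "ring (stalk (multiproj I r) P)" by (rule ring_axioms)
    show "subgroup (ideal_sheaf I r A P) (add_monoid (stalk (multiproj I r) P))"
    proof (rule group.subgroupI)
      show "Group.group (add_monoid (stalk (multiproj I r) P))" by (rule a_group)
      show "ideal_sheaf I r A P \<subseteq> carrier (add_monoid (stalk (multiproj I r) P))"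
        using ideal_sheaf_subset by (simp add: stalk_multiproj_simps)
      have "Fract 0 1 \<in> ideal_sheaf I r A P"
        unfolding ideal_sheaf_iff
        using AD(2) same_deg_0[OF mformI[OF multiforms_1]] primeidealD_poly(2)[OF P] by blast
      then show "ideal_sheaf I r A P \<noteq> {}" by blast
      fix x assume x: "x \<in> ideal_sheaf I r A P"
      then have xc: "x \<in> degree_zero_fractions I r P" using ideal_sheaf_subset by blast
      have "inv\<^bsub>add_monoid (stalk (multiproj I r) P)\<^esub> x = - x"
        using minus_equality[of "- x" x] xc degree_zero_fractions_closed(3)[OF P xc xc]
        unfolding a_inv_def by (simp add: stalk_multiproj_simps)
      then show "inv\<^bsub>add_monoid (stalk (multiproj I r) P)\<^esub> x \<in> ideal_sheaf I r A P" using uminus x by simp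
      fix y assume "y \<in> ideal_sheaf I r A P"
      then obtain b g where y: "y = Fract b g" "b \<in> A" "same_deg I r b g" "g \<notin> P" by (auto simp: ideal_sheaf_iff)
      obtain a f where x': "x = Fract a f" "a \<in> A" "same_deg I r a f" "f \<notin> P" using x by (auto simp: ideal_sheaf_iff)
      have nz: "f \<noteq> 0" "g \<noteq> 0" using prime_notin_nonzero[OF P] x' y by auto
      have "x + y = Fract (a * g + b * f) (f * g)" using nz by (simp add: x' y)
      moreover have "a * g + b * f \<in> A"
        by (intro AD(3) AD(5)[OF x'(2) same_deg_polys(2)[OF y(3)]] AD(5)[OF y(2) same_deg_polys(2)[OF x'(3)]])
      moreover have "f * g \<notin> P"
        by (intro prime_mult_notin[OF P] same_deg_polys(2)[OF x'(3)] same_deg_polys(2)[OF y(3)] x' y)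
      ultimately have "x + y \<in> ideal_sheaf I r A P"
        unfolding ideal_sheaf_iff using same_deg_cross_add[OF x'(3) y(3)] by blast
      then show "x \<otimes>\<^bsub>add_monoid (stalk (multiproj I r) P)\<^esub> y \<in> ideal_sheaf I r A P"
        by (simp add: stalk_multiproj_simps)
    qed
    fix a x assume "a \<in> ideal_sheaf I r A P" "x \<in> carrier (stalk (multiproj I r) P)"
    then show "x \<otimes>\<^bsub>stalk (multiproj I r) P\<^esub> a \<in> ideal_sheaf I r A P"
      "a \<otimes>\<^bsub>stalk (multiproj I r) P\<^esub> x \<in> ideal_sheaf I r A P"
      using mult[of x a] by (simp_all add: stalk_multiproj_simps mult.commute[of a x])
  qed
qed

text \<open>Clearing denominators turns a congruence of germs into membership of a polynomial in
  \<open>A\<close>. The multiplier \<open>u\<close> is the usual one in the equality of localised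
  elements.\<close>

lemma Fract_diff_in_ideal_sheaf_iff:
  assumes P: "primeideal P (coord_ring I r)" and A: "poly_ideal I r A"
    and af: "same_deg I r a f" "f \<notin> P" and bg: "same_deg I r b g" "g \<notin> P"
  shows "Fract a f - Fract b g \<in> ideal_sheaf I r A P \<longleftrightarrow> (\<exists>u. mform I r u \<and> u \<notin> P \<and> u * (a * g - b * f) \<in> A)"
proof -
  note AD = poly_idealD[OF A] and pf = same_deg_polys(2)[OF af(1)] and pg = same_deg_polys(2)[OF bg(1)]
  have nz: "f \<noteq> 0" "g \<noteq> 0" using prime_notin_nonzero[OF P] af bg by auto
  have fg: "f * g \<notin> P" by (rule prime_mult_notin[OF P pf pg af(2) bg(2)])
  have eq: "Fract a f - Fract b g = Fract (a * g - b * f) (f * g)" using nz by simp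
  show ?thesis
  proof
    assume "Fract a f - Fract b g \<in> ideal_sheaf I r A P"
    then obtain x h where x: "Fract (a * g - b * f) (f * g) = Fract x h" "x \<in> A" "same_deg I r x h" "h \<notin> P"
      unfolding eq ideal_sheaf_iff by blast
    have "h \<noteq> 0" by (rule prime_notin_nonzero[OF P x(4)])
    then have "(a * g - b * f) * h = x * (f * g)" using x(1) nz by (simp add: eq_fract)
    then have "h * (a * g - b * f) = x * (f * g)" by (simp only: mult.commute)
    then have "h * (a * g - b * f) \<in> A" using AD(5)[OF x(2) polys_mult[OF pf pg]] by (simp only:)
    then show "\<exists>u. mform I r u \<and> u \<notin> P \<and> u * (a * g - b * f) \<in> A"
      using same_deg_mform(2)[OF x(3)] x(4) by blast
  next
    assume "\<exists>u. mform I r u \<and> u \<notin> P \<and> u * (a * g - b * f) \<in> A"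
    then obtain u where u: "mform I r u" "u \<notin> P" "u * (a * g - b * f) \<in> A" by blast
    have "u \<noteq> 0" by (rule prime_notin_nonzero[OF P u(2)])
    then have "Fract a f - Fract b g = Fract (u * (a * g - b * f)) (u * (f * g))"
      unfolding eq by (rule mult_fract_cancel[symmetric])
    moreover have "u * (f * g) \<notin> P" by (rule prime_mult_notin[OF P mform_polys[OF u(1)] polys_mult[OF pf pg] u(2) fg])
    ultimately show "Fract a f - Fract b g \<in> ideal_sheaf I r A P"
      unfolding ideal_sheaf_iff
      using u(3) same_deg_mult[OF same_deg_refl[OF u(1)] same_deg_cross_diff[OF af(1) bg(1)]] by blast
  qed
qed

subsection \<open>Fractions modulo a homogeneous ideal\<close>

text \<open>The stalks of the ideal sheaf are prescribed only at points. This admits an inverse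
  image ideal, which is defined by generators and is computed only there.\<close>

locale closed_subscheme =
  fixes I :: "nat set" and r :: "nat \<Rightarrow> nat" and A :: "'k::field mpoly set"
    and J :: "'k mpoly set \<Rightarrow> 'k mpoly fract set"
  assumes ideal_A: "poly_ideal I r A"
    and J_eq: "P \<in> multiproj_points I r \<Longrightarrow> J P = ideal_sheaf I r A P"
begin

text \<open>The germ of the fraction a/f on the closed subscheme. Every element of a stalk has this
  shape, so the proofs below can calculate with numerators and denominators instead of
  cosets.\<close>

definition cls :: "'k mpoly set \<Rightarrow> 'k mpoly \<Rightarrow> 'k mpoly \<Rightarrow> 'k mpoly fract set" where
  "cls P a f = J P +>\<^bsub>stalk (multiproj I r) P\<^esub> Fract a f"

definition Z :: "('k, 'k mpoly set, 'k mpoly fract set) lrspace" where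
  "Z = closed_subspace (multiproj I r) J"

lemma ideal_J: "P \<in> multiproj_points I r \<Longrightarrow> ideal (J P) (stalk (multiproj I r) P)"
  by (simp add: J_eq ideal_ideal_sheaf multiproj_pointsD ideal_A)

lemma Fract_carrier:
  "same_deg I r a f \<Longrightarrow> f \<notin> P \<Longrightarrow> Fract a f \<in> carrier (stalk (multiproj I r) P)"
  by (auto simp: stalk_multiproj_simps degree_zero_fractions_iff)

lemma cls_eq_iff:
  assumes P: "P \<in> multiproj_points I r"
    and af: "same_deg I r a f" "f \<notin> P" and bg: "same_deg I r b g" "g \<notin> P"
  shows "cls P a f = cls P b g \<longleftrightarrow> (\<exists>u. mform I r u \<and> u \<notin> P \<and> u * (a * g - b * f) \<in> A)"
proof -
  note PD = multiproj_pointsD[OF P]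
  interpret cring "stalk (multiproj I r) P" by (rule cring_stalk[OF PD(1)])
  have "cls P a f = cls P b g \<longleftrightarrow> Fract a f \<ominus>\<^bsub>stalk (multiproj I r) P\<^esub> Fract b g \<in> J P"
    unfolding cls_def
    by (rule quotient_eq_iff_same_a_r_cos[symmetric, OF ideal_J[OF P] Fract_carrier[OF af] Fract_carrier[OF bg]])
  also have "Fract a f \<ominus>\<^bsub>stalk (multiproj I r) P\<^esub> Fract b g = Fract a f - Fract b g"
    using Fract_carrier[OF af] Fract_carrier[OF bg] by (intro stalk_minus[OF PD(1)]) (simp_all add: stalk_multiproj_simps)
  also have "\<dots> \<in> J P \<longleftrightarrow> (\<exists>u. mform I r u \<and> u \<notin> P \<and> u * (a * g - b * f) \<in> A)"
    unfolding J_eq[OF P] by (rule Fract_diff_in_ideal_sheaf_iff[OF PD(1) ideal_A af bg])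
  finally show ?thesis .
qed

lemma cls_cong: "Fract a f = Fract b g \<Longrightarrow> cls P a f = cls P b g"
  by (simp only: cls_def)

lemma cls_expand: "c \<noteq> 0 \<Longrightarrow> cls P (c * a) (c * f) = cls P a f"
  by (rule cls_cong) (rule mult_fract_cancel)

lemma stalk_Z: "stalk Z P = stalk (multiproj I r) P Quot J P"
  by (simp add: Z_def closed_subspace_def)

lemma carrier_Z:
  "carrier (stalk Z P) = {cls P a f | a f. same_deg I r a f \<and> f \<notin> P}"
proof -
  have "carrier (stalk Z P) = (\<Union>z\<in>degree_zero_fractions I r P. {J P +>\<^bsub>stalk (multiproj I r) P\<^esub> z})"
    by (simp add: stalk_Z FactRing_def A_RCOSETS_def' stalk_multiproj_simps)
  also have "\<dots> = {cls P a f | a f. same_deg I r a f \<and> f \<notin> P}"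
    unfolding degree_zero_fractions_def same_deg_def cls_def by blast
  finally show ?thesis .
qed

lemma cls_carrier: "same_deg I r a f \<Longrightarrow> f \<notin> P \<Longrightarrow> cls P a f \<in> carrier (stalk Z P)"
  unfolding carrier_Z by blast

lemma carrier_ZE:
  assumes "z \<in> carrier (stalk Z P)"
  obtains a f where "z = cls P a f" "same_deg I r a f" "f \<notin> P"
  using assms unfolding carrier_Z by blast

lemma mult_cls:
  assumes P: "P \<in> multiproj_points I r"
    and af: "same_deg I r a f" "f \<notin> P" and bg: "same_deg I r b g" "g \<notin> P"
  shows "cls P a f \<otimes>\<^bsub>stalk Z P\<^esub> cls P b g = cls P (a * b) (f * g)"
proof -
  interpret ideal "J P" "stalk (multiproj I r) P" by (rule ideal_J[OF P])
  have "cls P a f \<otimes>\<^bsub>stalk Z P\<^esub> cls P b g = J P +>\<^bsub>stalk (multiproj I r) P\<^esub> (Fract a f \<otimes>\<^bsub>stalk (multiproj I r) P\<^esub> Fract b g)"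
    unfolding cls_def stalk_Z FactRing_def
    using rcoset_mult_add[OF Fract_carrier[OF af] Fract_carrier[OF bg]] by simp
  then show ?thesis by (simp add: cls_def stalk_multiproj_simps)
qed

lemma add_cls:
  assumes P: "P \<in> multiproj_points I r"
    and af: "same_deg I r a f" "f \<notin> P" and bg: "same_deg I r b g" "g \<notin> P"
  shows "cls P a f \<oplus>\<^bsub>stalk Z P\<^esub> cls P b g = cls P (a * g + b * f) (f * g)"
proof -
  interpret ideal "J P" "stalk (multiproj I r) P" by (rule ideal_J[OF P])
  have nz: "f \<noteq> 0" "g \<noteq> 0" using prime_notin_nonzero[OF multiproj_pointsD(1)[OF P]] af bg by auto
  have "cls P a f \<oplus>\<^bsub>stalk Z P\<^esub> cls P b g = J P +>\<^bsub>stalk (multiproj I r) P\<^esub> (Fract a f \<oplus>\<^bsub>stalk (multiproj I r) P\<^esub> Fract b g)"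
    unfolding cls_def stalk_Z FactRing_def
    using a_rcos_sum[OF Fract_carrier[OF af] Fract_carrier[OF bg]] by simp
  then show ?thesis using nz by (simp add: cls_def stalk_multiproj_simps)
qed

lemma one_cls: "\<one>\<^bsub>stalk Z P\<^esub> = cls P 1 1"
  by (simp add: stalk_Z FactRing_def cls_def stalk_multiproj_simps One_fract_def)

lemma scal_cls: "scal Z P c = cls P (Cst c) 1"
  by (simp add: Z_def closed_subspace_def cls_def multiproj_def)

text \<open>The stalk of the ideal is the whole local ring iff it contains 1, which by clearing
  denominators means that some form of \<open>A\<close> lies outside \<open>P\<close>.\<close>

lemma points_Z: "points Z = {P \<in> multiproj_points I r. \<forall>a\<in>A. mform I r a \<longrightarrow> a \<in> P}"
proof -
  have "J P \<noteq> carrier (stalk (multiproj I r) P) \<longleftrightarrow> (\<forall>a\<in>A. mform I r a \<longrightarrow> a \<in> P)"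
    if P: "P \<in> multiproj_points I r" for P
  proof -
    note PD = multiproj_pointsD[OF P]
    interpret ideal "J P" "stalk (multiproj I r) P" by (rule ideal_J[OF P])
    have "J P = carrier (stalk (multiproj I r) P) \<longleftrightarrow> 1 \<in> J P"
      using one_imp_carrier one_closed by (auto simp: stalk_multiproj_simps)
    also have "\<dots> \<longleftrightarrow> Fract 1 1 - Fract 0 1 \<in> ideal_sheaf I r A P"
      unfolding J_eq[OF P] by (simp add: One_fract_def)
    also have "\<dots> \<longleftrightarrow> (\<exists>u. mform I r u \<and> u \<notin> P \<and> u * (1 * 1 - 0 * 1) \<in> A)"
      by (rule Fract_diff_in_ideal_sheaf_iff[OF PD(1) ideal_A same_deg_1 primeidealD_poly(2)[OF PD(1)]
            same_deg_0[OF mformI[OF multiforms_1]] primeidealD_poly(2)[OF PD(1)]])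
    finally show ?thesis by auto
  qed
  then show ?thesis by (auto simp: Z_def closed_subspace_def points_multiproj)
qed

lemma points_ZD: "P \<in> points Z \<Longrightarrow> P \<in> multiproj_points I r"
  by (simp add: points_Z)

lemma openin_Z:
  "openin (undertop Z) V \<longleftrightarrow>
     V \<subseteq> points Z \<and> (\<forall>P\<in>V. \<exists>f. mform I r f \<and> f \<notin> P \<and> basic_open I r f \<inter> points Z \<subseteq> V)"
proof -
  have top: "undertop Z = subtopology (undertop (multiproj I r)) (points Z)"
    unfolding Z_def closed_subspace_def lrspace.simps topspace_subtopology
    by (subst subtopology_restrict[symmetric]) (rule refl)
  have op: "openin (undertop Z) W \<longleftrightarrow> (\<exists>U. openin (undertop (multiproj I r)) U \<and> W = U \<inter> points Z)" for W
    by (subst top) (rule openin_subtopology)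
  show ?thesis
  proof
    assume "openin (undertop Z) V"
    then obtain U where U: "openin (undertop (multiproj I r)) U" "V = U \<inter> points Z"
      unfolding op by blast
    show "V \<subseteq> points Z \<and> (\<forall>P\<in>V. \<exists>f. mform I r f \<and> f \<notin> P \<and> basic_open I r f \<inter> points Z \<subseteq> V)"
    proof (intro conjI ballI)
      show "V \<subseteq> points Z" unfolding U(2) by (rule Int_lower2)
      fix P assume "P \<in> V"
      then have "P \<in> U" unfolding U(2) by (rule IntD1)
      then obtain f where "mform I r f" "f \<notin> P" "basic_open I r f \<subseteq> U"
        using U(1) unfolding openin_multiproj by auto
      then show "\<exists>f. mform I r f \<and> f \<notin> P \<and> basic_open I r f \<inter> points Z \<subseteq> V"
        unfolding U(2) by (intro exI[of _ f]) auto
    qed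
  next
    assume V: "V \<subseteq> points Z \<and> (\<forall>P\<in>V. \<exists>f. mform I r f \<and> f \<notin> P \<and> basic_open I r f \<inter> points Z \<subseteq> V)"
    have "\<exists>T. openin (undertop Z) T \<and> P \<in> T \<and> T \<subseteq> V" if PV: "P \<in> V" for P
    proof -
      obtain f where f: "mform I r f" "f \<notin> P" "basic_open I r f \<inter> points Z \<subseteq> V" using V PV by blast
      have "openin (undertop Z) (basic_open I r f \<inter> points Z)"
        unfolding op using openin_basic_open[OF f(1)] by blast
      moreover have "P \<in> basic_open I r f \<inter> points Z"
        using V PV f(2) points_ZD by (auto simp: basic_open_def)
      ultimately show ?thesis using f(3) by blast
    qed
    then show "openin (undertop Z) V" by (subst openin_subopen) blast
  qed
qed

text \<open>The definitions nest two local conditions: lifting to a section of the ambient space,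
  and writing that section as a fraction. Since basic open sets form a base, a single fraction
  suffices.\<close>

lemma sects_Z:
  assumes V: "V \<subseteq> points Z"
  shows "s \<in> sects Z V \<longleftrightarrow> s \<in> extensional V \<and>
    (\<forall>P\<in>V. \<exists>a f. same_deg I r a f \<and> f \<notin> P \<and> (\<forall>Q\<in>V. f \<notin> Q \<longrightarrow> s Q = cls Q a f))"
proof
  assume s: "s \<in> sects Z V"
  have "\<exists>a f. same_deg I r a f \<and> f \<notin> P \<and> (\<forall>Q\<in>V. f \<notin> Q \<longrightarrow> s Q = cls Q a f)" if P: "P \<in> V" for P
  proof -
    have PP: "P \<in> multiproj_points I r" using P V points_ZD by blast
    note PD = multiproj_pointsD[OF PP]
    obtain U t where U: "openin (undertop (multiproj I r)) U" "P \<in> U" "t \<in> sects (multiproj I r) U"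
      "\<forall>Q\<in>U \<inter> V. s Q = J Q +>\<^bsub>stalk (multiproj I r) Q\<^esub> t Q"
      using s P by (auto simp: Z_def closed_subspace_def)
    obtain a f where f: "same_deg I r a f" "f \<notin> P" "\<forall>Q\<in>U \<inter> basic_open I r f. t Q = Fract a f"
      using U(2,3) unfolding multiproj_def lrspace.simps same_deg_def by blast
    obtain g where g: "mform I r g" "g \<notin> P" "basic_open I r g \<subseteq> U"
      using U(1,2) unfolding openin_multiproj by blast
    note pf = same_deg_polys(2)[OF f(1)] and pg = mform_polys[OF g(1)]
    \<comment> \<open>Expanding by \<open>g\<close> lets the nonvanishing of the denominator alone
      express that \<open>Q\<close> lies in \<open>U\<close> and in the domain of a/f.\<close>
    have "s Q = cls Q (g * a) (g * f)" if Q: "Q \<in> V" "g * f \<notin> Q" for Q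
    proof -
      have QQ: "Q \<in> multiproj_points I r" using Q V points_ZD by blast
      have "Q \<in> basic_open I r (g * f)" using Q QQ by (simp add: basic_open_def)
      then have fg: "Q \<in> basic_open I r f" "Q \<in> basic_open I r g" using basic_open_mult[OF pg pf] by auto
      then have "s Q = cls Q a f" using U(4) g(3) f(3) Q(1) by (auto simp: cls_def)
      moreover have "g \<noteq> 0"
        using prime_notin_nonzero[OF multiproj_pointsD(1)[OF QQ], of g] fg(2) by (simp add: basic_open_def)
      ultimately show ?thesis by (simp add: cls_expand)
    qed
    moreover have "g * f \<notin> P" by (rule prime_mult_notin[OF PD(1) pg pf g(2) f(2)])
    ultimately show ?thesis using same_deg_mult[OF same_deg_refl[OF g(1)] f(1)] by blast
  qed
  moreover have "s \<in> extensional V" using s by (simp add: Z_def closed_subspace_def)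
  ultimately show "s \<in> extensional V \<and>
    (\<forall>P\<in>V. \<exists>a f. same_deg I r a f \<and> f \<notin> P \<and> (\<forall>Q\<in>V. f \<notin> Q \<longrightarrow> s Q = cls Q a f))" by blast
next
  assume s: "s \<in> extensional V \<and>
    (\<forall>P\<in>V. \<exists>a f. same_deg I r a f \<and> f \<notin> P \<and> (\<forall>Q\<in>V. f \<notin> Q \<longrightarrow> s Q = cls Q a f))"
  have "\<exists>U t. openin (undertop (multiproj I r)) U \<and> P \<in> U \<and> t \<in> sects (multiproj I r) U \<and>
      (\<forall>Q\<in>U \<inter> V. s Q = J Q +>\<^bsub>stalk (multiproj I r) Q\<^esub> t Q)" if P: "P \<in> V" for P
  proof -
    obtain a f where f: "same_deg I r a f" "f \<notin> P" "\<forall>Q\<in>V. f \<notin> Q \<longrightarrow> s Q = cls Q a f"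
      using s P by blast
    let ?U = "basic_open I r f"
    have "(\<lambda>Q\<in>?U. Fract a f) \<in> sects (multiproj I r) ?U"
      using f(1) by (auto simp: multiproj_def same_deg_def basic_open_def)
    moreover have "\<forall>Q\<in>?U \<inter> V. s Q = J Q +>\<^bsub>stalk (multiproj I r) Q\<^esub> (\<lambda>Q\<in>?U. Fract a f) Q"
      using f(3) by (auto simp: cls_def basic_open_def)
    moreover have "P \<in> ?U" using P V f(2) points_ZD by (auto simp: basic_open_def)
    ultimately show ?thesis using openin_basic_open[OF same_deg_mform(2)[OF f(1)]] by blast
  qed
  then show "s \<in> sects Z V" using s by (simp add: Z_def closed_subspace_def)
qed

lemma sects_Z_carrier:
  assumes "V \<subseteq> points Z" "s \<in> sects Z V" "P \<in> V"
  shows "s P \<in> carrier (stalk Z P)"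
  using assms cls_carrier unfolding sects_Z[OF assms(1)] by metis

text \<open>An inverse b/g makes \<open>a * b\<close> congruent to \<open>f * g\<close> modulo
  \<open>P\<close>, because on the subscheme the forms of \<open>A\<close> lie in \<open>P\<close>;
  conversely f/a is an inverse. With this criterion, locality of the induced maps becomes a
  statement about contraction of primes.\<close>

lemma Units_cls:
  assumes P: "P \<in> points Z" and af: "same_deg I r a f" "f \<notin> P"
  shows "cls P a f \<in> Units (stalk Z P) \<longleftrightarrow> a \<notin> P"
proof
  note PP = points_ZD[OF P] and PD = multiproj_pointsD[OF points_ZD[OF P]]
  have one: "(1 :: 'k mpoly) \<notin> P" by (rule primeidealD_poly(2)[OF PD(1)])
  assume "cls P a f \<in> Units (stalk Z P)"
  then obtain y where y: "y \<in> carrier (stalk Z P)" "cls P a f \<otimes>\<^bsub>stalk Z P\<^esub> y = \<one>\<^bsub>stalk Z P\<^esub>"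
    unfolding Units_def by blast
  obtain b g where bg: "y = cls P b g" "same_deg I r b g" "g \<notin> P" by (rule carrier_ZE[OF y(1)])
  note pa = same_deg_polys[OF af(1)] and pb = same_deg_polys[OF bg(2)]
  have fg: "f * g \<notin> P" by (rule prime_mult_notin[OF PD(1) pa(2) pb(2) af(2) bg(3)])
  have "cls P (a * b) (f * g) = cls P 1 1"
    using y(2) unfolding bg(1) mult_cls[OF PP af bg(2,3)] one_cls .
  then obtain u where u: "mform I r u" "u \<notin> P" "u * ((a * b) * 1 - 1 * (f * g)) \<in> A"
    using cls_eq_iff[OF PP same_deg_mult[OF af(1) bg(2)] fg same_deg_1 one] by blast
  have "same_deg I r ((a * b) * 1 - 1 * (f * g)) ((f * g) * 1)"
    by (rule same_deg_cross_diff[OF same_deg_mult[OF af(1) bg(2)] same_deg_1])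
  then have mf: "mform I r ((a * b) * 1 - 1 * (f * g))" by (rule same_deg_mform)
  then have "u * ((a * b) * 1 - 1 * (f * g)) \<in> P"
    using P u(3) mform_mult[OF u(1) mf] unfolding points_Z by blast
  then have d: "(a * b) * 1 - 1 * (f * g) \<in> P"
    using primeidealD_poly(3)[OF PD(1) mform_polys[OF u(1)] mform_polys[OF mf]] u(2) by blast
  show "a \<notin> P"
  proof
    assume "a \<in> P"
    then have "a * b \<in> P" by (rule poly_idealD(5)[OF PD(3) _ pb(1)])
    then have "a * b - ((a * b) * 1 - 1 * (f * g)) \<in> P" using d by (rule poly_idealD(7)[OF PD(3)])
    then show False using fg by simp
  qed
next
  note PP = points_ZD[OF P] and PD = multiproj_pointsD[OF points_ZD[OF P]]
  assume a: "a \<notin> P"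
  have "a \<noteq> 0" "f \<noteq> 0" using prime_notin_nonzero[OF PD(1)] a af(2) by auto
  then have "Fract (a * f) (f * a) = Fract 1 1" by (simp add: eq_fract mult.commute)
  then have "cls P (a * f) (f * a) = cls P 1 1" by (rule cls_cong)
  then have "cls P a f \<otimes>\<^bsub>stalk Z P\<^esub> cls P f a = \<one>\<^bsub>stalk Z P\<^esub>"
    by (simp only: mult_cls[OF PP af same_deg_sym[OF af(1)] a] one_cls)
  moreover have "cls P f a \<otimes>\<^bsub>stalk Z P\<^esub> cls P a f = cls P a f \<otimes>\<^bsub>stalk Z P\<^esub> cls P f a"
    using mult_cls[OF PP af same_deg_sym[OF af(1)] a] mult_cls[OF PP same_deg_sym[OF af(1)] a af]
    by (simp only: mult.commute)
  ultimately show "cls P a f \<in> Units (stalk Z P)"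
    unfolding Units_def using cls_carrier[OF af] cls_carrier[OF same_deg_sym[OF af(1)] a] by auto
qed

end

section \<open>Morphisms induced by graded homomorphisms\<close>

context graded_hom
begin

lemma same_deg_hom: "same_deg I' r' a g \<Longrightarrow> same_deg I r (\<phi> a) (\<phi> g)"
  by (auto simp: same_deg_def dest: hom_multiforms)

lemma mform_hom: "mform I' r' a \<Longrightarrow> mform I r (\<phi> a)"
  by (auto simp: mform_def dest: hom_multiforms)

text \<open>The definite description is justified by cross multiplication: \<open>\<phi>\<close>
  preserves the identity that expresses equality of two fractions.\<close>

lemma germ_multiproj_map:
  assumes P: "primeideal P (coord_ring I r)" and ag: "same_deg I' r' a g" "\<phi> g \<notin> P"
  shows "germ (multiproj_map I' r' \<phi>) P (Fract a g) = Fract (\<phi> a) (\<phi> g)"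
proof -
  have nz: "h \<noteq> 0" "\<phi> h \<noteq> 0" if "\<phi> h \<notin> P" for h
    using that poly_idealD(2)[OF primeidealD_poly(1)[OF P]] hom_0 by auto
  obtain d where d: "a \<in> multiforms I' r' d" "g \<in> multiforms I' r' d"
    using ag(1) by (auto simp: same_deg_def)
  show ?thesis
    unfolding multiproj_map_def lrmap.simps
  proof (rule the_equality)
    show "\<exists>a' f d. a' \<in> multiforms I' r' d \<and> f \<in> multiforms I' r' d \<and> \<phi> f \<notin> P \<and>
        Fract a g = Fract a' f \<and> Fract (\<phi> a) (\<phi> g) = Fract (\<phi> a') (\<phi> f)"
      using d ag(2) by blast
  next
    fix w
    assume "\<exists>a' f d. a' \<in> multiforms I' r' d \<and> f \<in> multiforms I' r' d \<and> \<phi> f \<notin> P \<and>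
        Fract a g = Fract a' f \<and> w = Fract (\<phi> a') (\<phi> f)"
    then obtain a' f where f: "\<phi> f \<notin> P" "Fract a g = Fract a' f" "w = Fract (\<phi> a') (\<phi> f)"
      by blast
    have "a * f = a' * g" using f(2) nz(1)[OF ag(2)] nz(1)[OF f(1)] by (simp add: eq_fract)
    then have "\<phi> a * \<phi> f = \<phi> a' * \<phi> g" by (simp only: hom_mult[symmetric])
    then show "w = Fract (\<phi> a) (\<phi> g)"
      using f(3) nz(2)[OF ag(2)] nz(2)[OF f(1)] by (simp add: eq_fract)
  qed
qed

end

text \<open>A graded homomorphism may contract a point to an irrelevant prime;
  \<open>relevant\<close> excludes such base points. \<open>maps_ideal\<close> makes the map
  restrict to the subschemes.\<close>

locale closed_subscheme_hom =
  graded_hom \<phi> I r I' r' \<delta> + X: closed_subscheme I r A J + Y: closed_subscheme I' r' A' J'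
  for \<phi> :: "'k::field mpoly \<Rightarrow> 'k mpoly" and I r I' r' \<delta>
    and A :: "'k mpoly set" and J :: "'k mpoly set \<Rightarrow> 'k mpoly fract set"
    and A' :: "'k mpoly set" and J' :: "'k mpoly set \<Rightarrow> 'k mpoly fract set" +
  assumes relevant: "P \<in> multiproj_points I r \<Longrightarrow> {F \<in> polys I' r'. \<phi> F \<in> P} \<in> multiproj_points I' r'"
    and maps_ideal: "a \<in> A' \<Longrightarrow> \<phi> a \<in> A"
begin

definition pmap :: "'k mpoly set \<Rightarrow> 'k mpoly set" where
  "pmap P = {F \<in> polys I' r'. \<phi> F \<in> P}"

abbreviation ind :: "('k mpoly set, 'k mpoly set, 'k mpoly fract set, 'k mpoly fract set) lrmap" where
  "ind \<equiv> induced_map (multiproj I r) J (multiproj_map I' r' \<phi>)"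

lemma pt_ind: "pt ind P = pmap P"
  by (simp add: induced_map_def multiproj_map_def pmap_def)

lemma notin_pmap: "g \<in> polys I' r' \<Longrightarrow> g \<notin> pmap P \<longleftrightarrow> \<phi> g \<notin> P"
  by (simp add: pmap_def)

lemma notin_pmap_same_deg: "same_deg I' r' a g \<Longrightarrow> g \<notin> pmap P \<longleftrightarrow> \<phi> g \<notin> P"
  by (rule notin_pmap[OF same_deg_polys(2)])

text \<open>\<open>induced_map\<close> sends a coset to the sum of \<open>J P\<close> with the image
  of the coset. The point is that this sum is a single coset: adding an element of \<open>J'\<close>
  to the argument changes the value by an element of \<open>J P\<close>.\<close>

lemma germ_ind:
  assumes P: "P \<in> multiproj_points I r" and ag: "same_deg I' r' a g" "g \<notin> pmap P"
  shows "germ ind P (Y.cls (pmap P) a g) = X.cls P (\<phi> a) (\<phi> g)"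
proof -
  let ?g = "germ (multiproj_map I' r' \<phi>) P"
  note PD = multiproj_pointsD[OF P]
  have Q: "pmap P \<in> multiproj_points I' r'" unfolding pmap_def by (rule relevant[OF P])
  note QD = multiproj_pointsD[OF Q]
  interpret JP: ideal "J P" "stalk (multiproj I r) P" by (rule X.ideal_J[OF P])
  interpret JQ: ideal "J' (pmap P)" "stalk (multiproj I' r') (pmap P)" by (rule Y.ideal_J[OF Q])
  have g_nz: "g \<noteq> 0" by (rule prime_notin_nonzero[OF QD(1) ag(2)])
  have key: "\<exists>j\<in>J P. ?g (j' + Fract a g) = j + Fract (\<phi> a) (\<phi> g)" if j': "j' \<in> J' (pmap P)" for j'
  proof -
    obtain x h where x: "j' = Fract x h" "x \<in> A'" "same_deg I' r' x h" "h \<notin> pmap P"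
      using j' unfolding Y.J_eq[OF Q] ideal_sheaf_iff by blast
    have h_nz: "h \<noteq> 0" by (rule prime_notin_nonzero[OF QD(1) x(4)])
    have hg: "h * g \<notin> pmap P"
      by (rule prime_mult_notin[OF QD(1) same_deg_polys(2)[OF x(3)] same_deg_polys(2)[OF ag(1)] x(4) ag(2)])
    have \<phi>h: "\<phi> h \<notin> P" using x(4) notin_pmap_same_deg[OF x(3)] by blast
    have \<phi>g: "\<phi> g \<notin> P" using ag(2) notin_pmap_same_deg[OF ag(1)] by blast
    have nz: "\<phi> h \<noteq> 0" "\<phi> g \<noteq> 0" using prime_notin_nonzero[OF PD(1)] \<phi>h \<phi>g by auto
    have sd: "same_deg I' r' (x * g + a * h) (h * g)" by (rule same_deg_cross_add[OF x(3) ag(1)])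
    have "j' + Fract a g = Fract (x * g + a * h) (h * g)" using g_nz h_nz by (simp add: x(1))
    then have "?g (j' + Fract a g) = Fract (\<phi> (x * g + a * h)) (\<phi> (h * g))"
      using germ_multiproj_map[OF PD(1) sd] hg notin_pmap_same_deg[OF sd] by simp
    also have "\<dots> = Fract (\<phi> x) (\<phi> h) + Fract (\<phi> a) (\<phi> g)"
      using nz by (simp add: hom_add hom_mult)
    finally have "?g (j' + Fract a g) = Fract (\<phi> x) (\<phi> h) + Fract (\<phi> a) (\<phi> g)" .
    moreover have "Fract (\<phi> x) (\<phi> h) \<in> J P"
      unfolding X.J_eq[OF P] ideal_sheaf_iff using maps_ideal[OF x(2)] same_deg_hom[OF x(3)] \<phi>h by blast
    ultimately show ?thesis by blast
  qed
  have zero: "0 \<in> J P" "0 \<in> J' (pmap P)"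
    using additive_subgroup.zero_closed[OF JP.is_additive_subgroup]
      additive_subgroup.zero_closed[OF JQ.is_additive_subgroup] by (simp_all add: stalk_multiproj_simps)
  have addJ: "x + y \<in> J P" if "x \<in> J P" "y \<in> J P" for x y
    using additive_subgroup.a_closed[OF JP.is_additive_subgroup that] by (simp add: stalk_multiproj_simps)
  have "germ ind P (Y.cls (pmap P) a g) = {j + k | j k. j \<in> J P \<and> k \<in> ?g ` {j' + Fract a g | j'. j' \<in> J' (pmap P)}}"
    unfolding induced_map_def lrmap.simps Y.cls_def set_add_def' a_r_coset_def' stalk_multiproj_simps by blast
  also have "\<dots> = {j + Fract (\<phi> a) (\<phi> g) | j. j \<in> J P}" (is "?L = ?R")
  proof (intro equalityI subsetI)
    fix z assume "z \<in> ?L"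
    then obtain j j' where j: "j \<in> J P" "j' \<in> J' (pmap P)" "z = j + ?g (j' + Fract a g)" by blast
    then obtain k where k: "k \<in> J P" "?g (j' + Fract a g) = k + Fract (\<phi> a) (\<phi> g)" using key by blast
    have "z = (j + k) + Fract (\<phi> a) (\<phi> g)" by (simp add: j(3) k(2))
    then show "z \<in> ?R" using addJ[OF j(1) k(1)] by blast
  next
    fix z assume "z \<in> ?R"
    then obtain j where j: "j \<in> J P" "z = j + Fract (\<phi> a) (\<phi> g)" by blast
    have "?g (Fract a g) = Fract (\<phi> a) (\<phi> g)"
      using germ_multiproj_map[OF PD(1) ag(1)] ag(2) notin_pmap_same_deg[OF ag(1)] by blast
    then have "z = j + ?g (0 + Fract a g)" by (simp add: j(2))
    then show "z \<in> ?L" using j(1) zero(2) by blast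
  qed
  also have "\<dots> = X.cls P (\<phi> a) (\<phi> g)"
    unfolding X.cls_def a_r_coset_def' stalk_multiproj_simps by blast
  finally show ?thesis .
qed

lemma pmap_points: "P \<in> points X.Z \<Longrightarrow> pmap P \<in> points Y.Z"
  unfolding X.points_Z Y.points_Z
  using maps_ideal mform_hom poly_idealD(1)[OF Y.ideal_A] relevant
  by (auto simp: pmap_def)

lemma preim_ind: "preim X.Z ind V = {P \<in> points X.Z. pmap P \<in> V}"
  by (simp add: preim_def pt_ind)

lemma preim_ind_subset: "preim X.Z ind V \<subseteq> points X.Z"
  by (auto simp: preim_ind)

lemma openin_preim:
  assumes V: "openin (undertop Y.Z) V"
  shows "openin (undertop X.Z) (preim X.Z ind V)"
  unfolding X.openin_Z
proof (intro conjI ballI)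
  fix P assume "P \<in> preim X.Z ind V"
  then have P: "P \<in> points X.Z" "pmap P \<in> V" by (auto simp: preim_ind)
  obtain g where g: "mform I' r' g" "g \<notin> pmap P" "basic_open I' r' g \<inter> points Y.Z \<subseteq> V"
    using V P(2) unfolding Y.openin_Z by blast
  have "basic_open I r (\<phi> g) \<inter> points X.Z \<subseteq> preim X.Z ind V"
  proof
    fix P' assume "P' \<in> basic_open I r (\<phi> g) \<inter> points X.Z"
    then have P': "P' \<in> points X.Z" "\<phi> g \<notin> P'" by (auto simp: basic_open_def)
    then have "pmap P' \<in> points Y.Z" "g \<notin> pmap P'"
      using pmap_points notin_pmap[OF mform_polys[OF g(1)]] by auto
    then show "P' \<in> preim X.Z ind V"
      using g(3) P'(1) Y.points_ZD by (auto simp: preim_ind basic_open_def)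
  qed
  then show "\<exists>f. mform I r f \<and> f \<notin> P \<and> basic_open I r f \<inter> points X.Z \<subseteq> preim X.Z ind V"
    using mform_hom[OF g(1)] g(2) notin_pmap[OF mform_polys[OF g(1)]] by blast
qed (rule preim_ind_subset)

lemma pull_ind:
  assumes "P \<in> preim X.Z ind V" "s (pmap P) = Y.cls (pmap P) a g" "same_deg I' r' a g" "\<phi> g \<notin> P"
  shows "pull X.Z ind V s P = X.cls P (\<phi> a) (\<phi> g)"
  using germ_ind[OF X.points_ZD, of P a g] assms notin_pmap_same_deg[OF assms(3)]
  by (simp add: pull_def pt_ind preim_ind)

lemma pull_sects:
  assumes V: "openin (undertop Y.Z) V" and s: "s \<in> sects Y.Z V"
  shows "pull X.Z ind V s \<in> sects X.Z (preim X.Z ind V)"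
  unfolding X.sects_Z[OF preim_ind_subset]
proof (intro conjI ballI)
  have VY: "V \<subseteq> points Y.Z" using openin_subset[OF V] .
  show "pull X.Z ind V s \<in> extensional (preim X.Z ind V)" by (simp add: pull_def)
  fix P assume P: "P \<in> preim X.Z ind V"
  then have "pmap P \<in> V" by (simp add: preim_ind)
  then obtain a g where g: "same_deg I' r' a g" "g \<notin> pmap P" "\<forall>Q\<in>V. g \<notin> Q \<longrightarrow> s Q = Y.cls Q a g"
    using s unfolding Y.sects_Z[OF VY] by blast
  have "pull X.Z ind V s P' = X.cls P' (\<phi> a) (\<phi> g)" if P': "P' \<in> preim X.Z ind V" "\<phi> g \<notin> P'" for P'
  proof (rule pull_ind[OF P'(1) _ g(1) P'(2)])
    show "s (pmap P') = Y.cls (pmap P') a g"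
      using g(3) P' notin_pmap_same_deg[OF g(1)] by (simp add: preim_ind)
  qed
  then show "\<exists>a f. same_deg I r a f \<and> f \<notin> P \<and> (\<forall>Q\<in>preim X.Z ind V. f \<notin> Q \<longrightarrow> pull X.Z ind V s Q = X.cls Q a f)"
    using same_deg_hom[OF g(1)] g(2) notin_pmap_same_deg[OF g(1)] by blast
qed

lemma germ_ind_ring_hom:
  assumes P: "P \<in> multiproj_points I r"
  shows "germ ind P \<in> Ring.ring_hom (stalk Y.Z (pmap P)) (stalk X.Z P)"
proof (rule ring_hom_memI)
  have Q: "pmap P \<in> multiproj_points I' r'" unfolding pmap_def by (rule relevant[OF P])
  note PD = multiproj_pointsD[OF P] and QD = multiproj_pointsD[OF Q]
  have one: "(1 :: 'k mpoly) \<notin> pmap P" by (rule primeidealD_poly(2)[OF QD(1)])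
  show "germ ind P \<one>\<^bsub>stalk Y.Z (pmap P)\<^esub> = \<one>\<^bsub>stalk X.Z P\<^esub>"
    unfolding X.one_cls Y.one_cls germ_ind[OF P same_deg_1 one] hom_1 ..
  fix x assume "x \<in> carrier (stalk Y.Z (pmap P))"
  then obtain a g where x: "x = Y.cls (pmap P) a g" "same_deg I' r' a g" "g \<notin> pmap P" by (rule Y.carrier_ZE)
  have \<phi>g: "\<phi> g \<notin> P" using x(3) notin_pmap_same_deg[OF x(2)] by blast
  show "germ ind P x \<in> carrier (stalk X.Z P)"
    unfolding x(1) germ_ind[OF P x(2,3)] by (rule X.cls_carrier[OF same_deg_hom[OF x(2)] \<phi>g])
  fix y assume "y \<in> carrier (stalk Y.Z (pmap P))"
  then obtain b h where y: "y = Y.cls (pmap P) b h" "same_deg I' r' b h" "h \<notin> pmap P" by (rule Y.carrier_ZE)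
  have \<phi>h: "\<phi> h \<notin> P" using y(3) notin_pmap_same_deg[OF y(2)] by blast
  have gh: "g * h \<notin> pmap P"
    by (rule prime_mult_notin[OF QD(1) same_deg_polys(2)[OF x(2)] same_deg_polys(2)[OF y(2)] x(3) y(3)])
  show "germ ind P (x \<otimes>\<^bsub>stalk Y.Z (pmap P)\<^esub> y) = germ ind P x \<otimes>\<^bsub>stalk X.Z P\<^esub> germ ind P y"
    unfolding x(1) y(1) Y.mult_cls[OF Q x(2,3) y(2,3)] germ_ind[OF P x(2,3)] germ_ind[OF P y(2,3)]
      germ_ind[OF P same_deg_mult[OF x(2) y(2)] gh]
      X.mult_cls[OF P same_deg_hom[OF x(2)] \<phi>g same_deg_hom[OF y(2)] \<phi>h] hom_mult ..
  show "germ ind P (x \<oplus>\<^bsub>stalk Y.Z (pmap P)\<^esub> y) = germ ind P x \<oplus>\<^bsub>stalk X.Z P\<^esub> germ ind P y"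
    unfolding x(1) y(1) Y.add_cls[OF Q x(2,3) y(2,3)] germ_ind[OF P x(2,3)] germ_ind[OF P y(2,3)]
      germ_ind[OF P same_deg_cross_add[OF x(2) y(2)] gh]
      X.add_cls[OF P same_deg_hom[OF x(2)] \<phi>g same_deg_hom[OF y(2)] \<phi>h] hom_add hom_mult ..
qed

lemma germ_ind_scal:
  assumes P: "P \<in> multiproj_points I r"
  shows "germ ind P (scal Y.Z (pmap P) c) = scal X.Z P c"
proof -
  have Q: "pmap P \<in> multiproj_points I' r'" unfolding pmap_def by (rule relevant[OF P])
  have one: "(1 :: 'k mpoly) \<notin> pmap P" by (rule primeidealD_poly(2)[OF multiproj_pointsD(1)[OF Q]])
  show ?thesis
    unfolding X.scal_cls Y.scal_cls germ_ind[OF P same_deg_Cst one] hom_1 hom_Cst ..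
qed

lemma lrs_morphism_ind: "lrs_morphism X.Z Y.Z ind"
  unfolding lrs_morphism_def
proof (intro conjI ballI allI impI)
  show "continuous_map (undertop X.Z) (undertop Y.Z) (pt ind)"
    unfolding continuous_map_def
  proof (intro conjI allI impI)
    show "pt ind \<in> points X.Z \<rightarrow> points Y.Z" by (auto simp: pt_ind pmap_points)
    fix V assume "openin (undertop Y.Z) V"
    from openin_preim[OF this] show "openin (undertop X.Z) {x \<in> points X.Z. pt ind x \<in> V}"
      by (simp only: preim_def)
  qed
next
  fix P assume P: "P \<in> points X.Z"
  note PP = X.points_ZD[OF P]
  show "germ ind P \<in> Ring.ring_hom (stalk Y.Z (pt ind P)) (stalk X.Z P)"
    unfolding pt_ind by (rule germ_ind_ring_hom[OF PP])
  show "germ ind P (scal Y.Z (pt ind P) c) = scal X.Z P c" for c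
    unfolding pt_ind by (rule germ_ind_scal[OF PP])
  fix z assume "z \<in> carrier (stalk Y.Z (pt ind P))" and u: "germ ind P z \<in> Units (stalk X.Z P)"
  then have "z \<in> carrier (stalk Y.Z (pmap P))" by (simp only: pt_ind)
  then obtain a g where z: "z = Y.cls (pmap P) a g" "same_deg I' r' a g" "g \<notin> pmap P" by (rule Y.carrier_ZE)
  have \<phi>g: "\<phi> g \<notin> P" using z(3) notin_pmap_same_deg[OF z(2)] by blast
  have "\<phi> a \<notin> P"
    using u unfolding z(1) germ_ind[OF PP z(2,3)] X.Units_cls[OF P same_deg_hom[OF z(2)] \<phi>g] .
  then show "z \<in> Units (stalk Y.Z (pt ind P))"
    unfolding z(1) pt_ind Y.Units_cls[OF pmap_points[OF P] z(2,3)]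
    using notin_pmap[OF same_deg_polys(1)[OF z(2)]] by blast
next
  fix V s assume "openin (undertop Y.Z) V \<and> s \<in> sects Y.Z V"
  then show "pull X.Z ind V s \<in> sects X.Z (preim X.Z ind V)" using pull_sects by blast
qed

end

section \<open>The discriminant scheme\<close>

definition principal :: "nat set \<Rightarrow> (nat \<Rightarrow> nat) \<Rightarrow> 'k::field mpoly \<Rightarrow> 'k mpoly set" where
  "principal I r D = {F * D | F. F \<in> polys I r}"

lemma principal_genideal:
  assumes "D \<in> polys I r"
  shows "Idl\<^bsub>coord_ring I r\<^esub> {D} = principal I r D"
proof -
  interpret cring "coord_ring I r" by (rule cring_coord_ring)
  show ?thesis
    using cgenideal_eq_genideal[of D] assms
    by (auto simp: cgenideal_def principal_def coord_ring_simps)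
qed

lemma poly_ideal_principal:
  assumes "D \<in> polys I r"
  shows "poly_ideal I r (principal I r D)"
proof -
  interpret cring "coord_ring I r" by (rule cring_coord_ring)
  show ?thesis
    unfolding poly_ideal_iff principal_genideal[OF assms, symmetric]
    by (rule genideal_ideal) (simp add: coord_ring_simps assms)
qed

lemma principal_self: "D \<in> principal I r D"
proof -
  have "D = 1 * D" by simp
  then show ?thesis unfolding principal_def using polys_1 by blast
qed

lemma multihom_principal:
  assumes D: "D \<in> multiforms I r e"
  shows "multihom (principal I r D)"
  unfolding multihom_def
proof (intro ballI allI)
  fix F d assume "F \<in> principal I r D"
  then obtain G where G: "F = G * D" "G \<in> polys I r" unfolding principal_def by blast
  have "0 = 0 * D" by simp
  then have "0 \<in> principal I r D" unfolding principal_def using polys_0 by blast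
  then show "multihom_part d F \<in> principal I r D"
    unfolding G(1) multihom_part_mult_multiform'[OF D]
    using multihom_part_polys[OF G(2)] by (auto simp: principal_def)
qed

text \<open>Taking parts of degree \<open>d\<close> makes the cofactor homogeneous. For
  \<open>F = 0\<close> the degrees need not be comparable, so this case is excluded.\<close>

lemma principal_multiform:
  assumes D: "D \<in> multiforms I r e" and F: "F \<in> principal I r D" "F \<in> multiforms I r d" "F \<noteq> 0"
  obtains G where "F = G * D" "G \<in> multiforms I r (\<lambda>i. d i - e i)" "\<And>i. e i \<le> d i"
proof -
  obtain H where H: "F = H * D" "H \<in> polys I r" using F(1) unfolding principal_def by blast
  have "F = multihom_part d F" by (simp add: multihom_part_multiforms[OF F(2)])
  also have "\<dots> = (if \<forall>i. e i \<le> d i then multihom_part (\<lambda>i. d i - e i) H * D else 0)"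
    unfolding H(1) by (rule multihom_part_mult_multiform'[OF D])
  finally have eq: "F = (if \<forall>i. e i \<le> d i then multihom_part (\<lambda>i. d i - e i) H * D else 0)" .
  have le: "\<forall>i. e i \<le> d i" using eq F(3) by (auto split: if_splits)
  have "F = multihom_part (\<lambda>i. d i - e i) H * D" using eq le by simp
  then show thesis using that multihom_part_in_multiforms[OF H(2)] le by blast
qed

text \<open>Each entry of the Sylvester matrix is 0 or a linear form, including the coefficients of
  the derivative, so every product in the Leibniz expansion has the size of the matrix as its
  degree.\<close>

lemma disc_resultant_multiform:
  assumes "n \<ge> 1"
  shows "disc_resultant n \<in> multiforms {1} (\<lambda>_. n) (udeg {1} (n + (n - 1)))"
proof -
  let ?M = "sylvester_mat_sub n (n - 1) (generic_poly n) (pderiv (generic_poly n)) :: 'a mpoly mat"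
  let ?L = "multiforms {1} (\<lambda>_. n) (udeg {1} 1) :: 'a mpoly set"
  note V = Var_udeg[of _ n]
  have c: "coeff (generic_poly n) j \<in> ?L" for j
  proof (cases "j \<le> n")
    case True
    then show ?thesis using V[of "n - j"] by (simp add: generic_poly_coeff)
  next
    case False
    then have "coeff (generic_poly n) j = (0 :: 'a mpoly)"
      unfolding generic_poly_def coeff_sum by (intro sum.neutral) auto
    then show ?thesis by (simp add: multiforms_0)
  qed
  have c': "coeff (pderiv (generic_poly n)) j \<in> ?L" for j
    unfolding coeff_pderiv Cst_of_nat[symmetric] by (rule multiforms_Cst_mult[OF c])
  have entry: "?M $$ (i, j) \<in> ?L" if "i < n + (n - 1)" "j < n + (n - 1)" for i j
    using that c c' by (simp add: sylvester_mat_sub_index multiforms_0)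
  have prod: "(\<Prod>i = 0..<n + (n - 1). ?M $$ (i, p i)) \<in> multiforms {1} (\<lambda>_. n) (udeg {1} (n + (n - 1)))"
    if "p permutes {0..<n + (n - 1)}" for p
  proof -
    have "(\<Prod>i = 0..<n + (n - 1). ?M $$ (i, p i)) \<in>
        multiforms {1} (\<lambda>_. n) (\<lambda>k. \<Sum>i = 0..<n + (n - 1). udeg {1} 1 k)"
      by (rule multiforms_prod) (use entry permutes_in_image[OF that] in auto)
    also have "(\<lambda>k. \<Sum>i = 0..<n + (n - 1). udeg {1} 1 k) = udeg {1} (n + (n - 1))"
      by (auto simp: udeg_def)
    finally show ?thesis .
  qed
  have sgn: "signof p * F \<in> multiforms {1} (\<lambda>_. n) d" if "F \<in> multiforms {1} (\<lambda>_. n) d"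
    for p :: "nat \<Rightarrow> nat" and F :: "'a mpoly" and d
    using that multiforms_uminus[OF that] by (auto simp: sign_def)
  have "det ?M = (\<Sum>p | p permutes {0..<n + (n - 1)}. signof p * (\<Prod>i = 0..<n + (n - 1). ?M $$ (i, p i)))"
    by (rule det_def'[OF sylvester_mat_sub_carrier])
  also have "\<dots> \<in> multiforms {1} (\<lambda>_. n) (udeg {1} (n + (n - 1)))"
    by (rule multiforms_sum, rule sgn, rule prod) simp
  finally have "det ?M \<in> multiforms {1} (\<lambda>_. n) (udeg {1} (n + (n - 1)))" .
  then show ?thesis by (simp add: disc_resultant_def)
qed

text \<open>
  That no variable outside the coordinate ring occurs follows by setting those variables to \<open>0\<close>.
\<close>

lemma disc_poly_multiform:
  fixes n :: nat
  assumes "n \<ge> 1"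
  obtains e where "(disc_poly n :: 'k::field_char_0 mpoly) \<in> multiforms {1} (\<lambda>_. n) (udeg {1} e)"
proof -
  let ?C = "coords {1} (\<lambda>_. n)" and ?D = "disc_poly n :: 'k mpoly" and ?R = "disc_resultant n :: 'k mpoly"
  let ?x = "Var 1 0 :: 'k mpoly"
  define g :: "nat \<times> nat \<Rightarrow> 'k mpoly" where "g v = (if v \<in> ?C then (case v of (i, j) \<Rightarrow> Var i j) else 0)" for v
  interpret g: alg_hom "psubst g" by (rule alg_hom_psubst)
  have R: "?R \<in> multiforms {1} (\<lambda>_. n) (udeg {1} (n + (n - 1)))" by (rule disc_resultant_multiform[OF assms])
  have eq: "?x * ?D = ?R" by (rule disc_poly[OF assms])
  have x_nz: "?x \<noteq> 0" unfolding Var_def by (metis lookup_single_eq lookup_zero zero_neq_one)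
  have g_polys: "g v \<in> polys {1} (\<lambda>_. n)" for v
    unfolding g_def by (auto simp: coords_def polys_0 split: prod.split intro!: polys_Var)
  have g_id: "psubst g F = F" if "F \<in> polys {1} (\<lambda>_. n)" for F
  proof -
    have "psubst g F = psubst (\<lambda>(i, j). Var i j) F"
      by (rule psubst_cong) (use that in \<open>auto simp: polys_def g_def\<close>)
    then show ?thesis by (simp only: psubst_Var_id)
  qed
  have "?x * psubst g ?D = psubst g (?x * ?D)"
    by (simp add: psubst_mult psubst_Var g_def coords_def)
  also have "\<dots> = ?x * ?D" unfolding eq by (rule g_id[OF multiforms_polys[OF R]])
  finally have "psubst g ?D = ?D" using x_nz by (simp only: mult_cancel_left simp_thms)
  moreover have "psubst g ?D \<in> polys {1} (\<lambda>_. n)"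
    unfolding psubst_def by (intro polys_sum polys_mult polys_Cst polys_prod polys_power g_polys)
  ultimately have D: "?D \<in> polys {1} (\<lambda>_. n)" by (simp only:)
  have x: "?x \<in> multiforms {1} (\<lambda>_. n) (udeg {1} 1)"
    by (rule Var_udeg) simp
  \<comment> \<open>The exceptional degree is 2n - 2. A part of \<open>?D\<close> in another degree,
    multiplied by \<open>?x\<close>, would be a part of the form \<open>?R\<close> in a degree
    different from its own.\<close>
  have 0: "multihom_part d ?D = 0" if "d \<noteq> udeg {1} (n + (n - 1) - 1)" for d
  proof -
    have "(\<lambda>i. d i + udeg {1} 1 i) \<noteq> udeg {1} (n + (n - 1))"
    proof
      assume *: "(\<lambda>i. d i + udeg {1} 1 i) = udeg {1} (n + (n - 1))"
      have "d i = udeg {1} (n + (n - 1) - 1) i" for i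
        using fun_cong[OF *, of i] by (auto simp: udeg_def split: if_splits)
      then show False using that by auto
    qed
    then have "multihom_part (\<lambda>i. d i + udeg {1} 1 i) (?D * ?x) = 0"
      using multihom_part_multiforms[OF R] eq by (simp add: mult.commute)
    then have "multihom_part d ?D * ?x = 0" by (simp only: multihom_part_mult_multiform[OF x])
    then show ?thesis using x_nz by (simp only: mult_eq_0_iff simp_thms)
  qed
  have "multihom_part d ?D \<in> multiforms {1} (\<lambda>_. n) (udeg {1} (n + (n - 1) - 1))" for d
  proof (cases "d = udeg {1} (n + (n - 1) - 1)")
    case True
    show ?thesis unfolding True by (rule multihom_part_in_multiforms[OF D])
  next
    case False
    then show ?thesis using 0 multiforms_0 by simp
  qed
  then have "(\<Sum>d\<in>multideg ` Poly_Mapping.keys ?D. multihom_part d ?D) \<in>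
      multiforms {1} (\<lambda>_. n) (udeg {1} (n + (n - 1) - 1))"
    by (rule multiforms_sum)
  then have "?D \<in> multiforms {1} (\<lambda>_. n) (udeg {1} (n + (n - 1) - 1))"
    using multihom_part_decomp[of ?D] by (simp only:)
  then show thesis by (rule that)
qed

section \<open>The quotient of the inverse image of a hypersurface\<close>

text \<open>
  Otherwise the simplifier turns \<open>{1..n}\<close> into \<open>{Suc 0..n}\<close> inside locale parameters, where the
  facts of the locale no longer apply.
\<close>

declare One_nat_def [simp del]

locale symmetric_hypersurface =
  fixes n :: nat and D :: "'k::{alg_closed_field, field_char_0} mpoly" and e :: nat
  assumes n_pos: "n \<ge> 1" and D_form: "D \<in> multiforms {1} (\<lambda>_. n) (udeg {1} e)"
begin

abbreviation Sforms :: "nat \<Rightarrow> 'k mpoly set" where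
  "Sforms m \<equiv> multiforms {1..n} (\<lambda>_. 1) (udeg {1..n} m)"

abbreviation "Spolys \<equiv> polys {1..n} (\<lambda>_. 1) :: 'k mpoly set"
abbreviation "Rpolys \<equiv> polys {1} (\<lambda>_. n) :: 'k mpoly set"
abbreviation "Spoints \<equiv> multiproj_points {1..n} (\<lambda>_. 1) :: 'k mpoly set set"
abbreviation "Rpoints \<equiv> multiproj_points {1} (\<lambda>_. n) :: 'k mpoly set set"
abbreviation "Ssame \<equiv> same_deg {1..n} (\<lambda>_. 1) :: 'k mpoly \<Rightarrow> 'k mpoly \<Rightarrow> bool"
abbreviation "Rsame \<equiv> same_deg {1} (\<lambda>_. n) :: 'k mpoly \<Rightarrow> 'k mpoly \<Rightarrow> bool"
abbreviation "Smform \<equiv> mform {1..n} (\<lambda>_. 1) :: 'k mpoly \<Rightarrow> bool"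
abbreviation "Rmform \<equiv> mform {1} (\<lambda>_. n) :: 'k mpoly \<Rightarrow> bool"

definition AY :: "'k mpoly set" where "AY = principal {1} (\<lambda>_. n) D"
definition AX :: "'k mpoly set" where "AX = principal {1..n} (\<lambda>_. 1) (esym n D)"

definition JY :: "'k mpoly set \<Rightarrow> 'k mpoly fract set" where
  "JY = ideal_sheaf {1} (\<lambda>_. n) AY"

text \<open>Kept in the shape of \<open>X_ideal\<close>, so that the scheme-theoretic inverse image
  is literally the one treated; \<open>JX_eq\<close> then identifies its stalks with those given by
  \<open>AX\<close>.\<close>

definition JX :: "'k mpoly set \<Rightarrow> 'k mpoly fract set" where
  "JX = inverse_image_ideal (P1_power n) (pi_map n) JY"

lemma esymD_form: "esym n D \<in> Sforms e"
  using esym_multiforms[OF D_form] by (simp add: udeg_def)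

lemma ideal_AX: "poly_ideal {1..n} (\<lambda>_. 1) AX"
  unfolding AX_def by (rule poly_ideal_principal[OF multiforms_polys[OF esymD_form]])

lemma ideal_AY: "poly_ideal {1} (\<lambda>_. n) AY"
  unfolding AY_def by (rule poly_ideal_principal[OF multiforms_polys[OF D_form]])

lemma pi_map_esym: "pi_map n = multiproj_map {1} (\<lambda>_. n) (esym n :: 'k mpoly \<Rightarrow> _)"
  by (simp add: pi_map_def esym_def)

lemma permute_factors_perm_vars:
  "permute_factors n \<sigma> = multiproj_map {1..n} (\<lambda>_. 1) (perm_vars \<sigma> :: 'k mpoly \<Rightarrow> _)"
  by (simp add: permute_factors_def perm_vars_def)

sublocale E: graded_hom "esym n :: 'k mpoly \<Rightarrow> _" "{1..n}" "\<lambda>_. 1" "{1}" "\<lambda>_. n" "\<lambda>d. udeg {1..n} (d 1)"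
  by (rule graded_hom_esym[OF n_pos])

lemma esym_AY: "a \<in> AY \<Longrightarrow> esym n a \<in> AX"
proof -
  assume "a \<in> AY"
  then obtain F where F: "a = F * D" "F \<in> Rpolys" unfolding AY_def principal_def by blast
  have "esym n a = esym n F * esym n D" by (simp only: F(1) esym.hom_mult)
  then show ?thesis unfolding AX_def principal_def using E.hom_polys[OF F(2)] by blast
qed

lemma perm_AX:
  assumes \<sigma>: "\<sigma> permutes {1..n}" and a: "a \<in> AX"
  shows "perm_vars \<sigma> a \<in> AX"
proof -
  interpret p: graded_hom "perm_vars \<sigma> :: 'k mpoly \<Rightarrow> _" "{1..n}" "\<lambda>_. 1" "{1..n}" "\<lambda>_. 1" "\<lambda>d i. d (\<sigma> i)"
    by (rule graded_hom_perm_vars[OF \<sigma>])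
  obtain F where F: "a = F * esym n D" "F \<in> Spolys" using a unfolding AX_def principal_def by blast
  have "perm_vars \<sigma> a = perm_vars \<sigma> F * esym n D"
    by (simp only: F(1) perm_vars.hom_mult perm_vars_esym[OF \<sigma> multiforms_polys[OF D_form]])
  then show ?thesis unfolding AX_def principal_def using p.hom_polys[OF F(2)] by blast
qed

text \<open>The inverse image ideal is generated by fractions in which the denominator comes from
  the target too. If \<open>h\<close> is such a denominator for \<open>D\<close>, a multiple
  \<open>x * esym n D\<close> over \<open>f\<close> is (x esym(h) / f) times esym(D) /
  esym(h).\<close>

lemma JX_eq:
  assumes P: "P \<in> Spoints"
  shows "JX P = ideal_sheaf {1..n} (\<lambda>_. 1) AX P"
proof -
  let ?L = "stalk (multiproj {1..n} (\<lambda>_. 1)) P"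
  let ?g = "germ (multiproj_map {1} (\<lambda>_. n) (esym n)) P"
  note PD = multiproj_pointsD[OF P]
  interpret cring ?L by (rule cring_stalk[OF PD(1)])
  have J: "JX P = Idl\<^bsub>?L\<^esub> (?g ` JY (esym_pt n P))"
    unfolding JX_def inverse_image_ideal_def P1_power_def pi_map_esym
    by (simp add: multiproj_map_def esym_pt_def)
  have id: "ideal (ideal_sheaf {1..n} (\<lambda>_. 1) AX P) ?L" by (rule ideal_ideal_sheaf[OF PD(1) ideal_AX])
  have gen: "?g ` JY (esym_pt n P) \<subseteq> ideal_sheaf {1..n} (\<lambda>_. 1) AX P"
  proof
    fix w assume "w \<in> ?g ` JY (esym_pt n P)"
    then obtain z where z: "w = ?g z" "z \<in> ideal_sheaf {1} (\<lambda>_. n) AY (esym_pt n P)"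
      unfolding JY_def by (rule imageE)
    obtain a f where a: "z = Fract a f" "a \<in> AY" "Rsame a f" "f \<notin> esym_pt n P"
      using z(2) unfolding ideal_sheaf_iff by blast
    have f: "esym n f \<notin> P" using a(4) same_deg_polys(2)[OF a(3)] by (simp add: esym_pt_def)
    have "w = Fract (esym n a) (esym n f)" unfolding z(1) a(1) by (rule E.germ_multiproj_map[OF PD(1) a(3) f])
    then show "w \<in> ideal_sheaf {1..n} (\<lambda>_. 1) AX P"
      unfolding ideal_sheaf_iff using esym_AY[OF a(2)] E.same_deg_hom[OF a(3)] f by blast
  qed
  have carr: "?g ` JY (esym_pt n P) \<subseteq> carrier ?L"
    using gen ideal_sheaf_subset unfolding stalk_multiproj_simps by blast
  have "ideal_sheaf {1..n} (\<lambda>_. 1) AX P \<subseteq> JX P"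
  proof
    fix w assume "w \<in> ideal_sheaf {1..n} (\<lambda>_. 1) AX P"
    then obtain a f where a: "w = Fract a f" "a \<in> AX" "Ssame a f" "f \<notin> P"
      unfolding ideal_sheaf_iff by blast
    interpret JI: ideal "JX P" ?L unfolding J by (rule genideal_ideal[OF carr])
    show "w \<in> JX P"
    proof (cases "a = 0")
      case True
      have "w = 0" unfolding a(1) True by (simp add: Zero_fract_def eq_fract)
      then show ?thesis
        using additive_subgroup.zero_closed[OF JI.is_additive_subgroup] by (simp add: stalk_multiproj_simps)
    next
      case False
      obtain d where d: "a \<in> multiforms {1..n} (\<lambda>_. 1) d" "f \<in> multiforms {1..n} (\<lambda>_. 1) d"
        using a(3) by (auto simp: same_deg_def)
      obtain x where x: "a = x * esym n D" "x \<in> multiforms {1..n} (\<lambda>_. 1) (\<lambda>i. d i - udeg {1..n} e i)"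
        "\<And>i. udeg {1..n} e i \<le> d i"
        using principal_multiform[OF esymD_form a(2)[unfolded AX_def] d(1) False] by blast
      obtain j where j: "j \<le> n" "elem_hom n j \<notin> P" by (rule elem_hom_notin_point[OF P])
      \<comment> \<open>A denominator of the same degree as \<open>D\<close>: not all elementary
        symmetric polynomials vanish at \<open>P\<close>.\<close>
      define h :: "'k mpoly" where "h = Var 1 j ^ e"
      have h: "h \<in> multiforms {1} (\<lambda>_. n) (udeg {1} e)"
      proof -
        have "h \<in> multiforms {1} (\<lambda>_. n) (\<lambda>i. e * udeg {1} 1 i)"
          unfolding h_def by (rule multiforms_power[OF Var_udeg[OF j(1)]])
        also have "(\<lambda>i. e * udeg {1} 1 i) = udeg {1} e" by (auto simp: udeg_def)
        finally show ?thesis .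
      qed
      have \<phi>h: "esym n h \<notin> P"
        unfolding h_def esym.hom_power esym_Var
        by (rule prime_power[OF PD(1) multiforms_polys[OF elem_hom_udeg] j(2)])
      have \<phi>hf: "esym n h \<in> Sforms e" using esym_multiforms[OF h] by (simp add: udeg_def)
      have "h \<notin> esym_pt n P" using \<phi>h by (simp add: esym_pt_def)
      then have "Fract D h \<in> JY (esym_pt n P)"
        unfolding JY_def ideal_sheaf_iff AY_def
        using principal_self same_degI[OF D_form h] by blast
      then have "?g (Fract D h) \<in> JX P"
        unfolding J using genideal_self[OF carr] by blast
      then have m1: "Fract (esym n D) (esym n h) \<in> JX P"
        by (simp only: E.germ_multiproj_map[OF PD(1) same_degI[OF D_form h] \<phi>h])
      have xh: "x * esym n h \<in> multiforms {1..n} (\<lambda>_. 1) d"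
      proof -
        have "(\<lambda>i. d i - udeg {1..n} e i + udeg {1..n} e i) = d" using x(3) by simp
        then show ?thesis using multiforms_mult[OF x(2) \<phi>hf] by (simp only:)
      qed
      have carr_x: "Fract (x * esym n h) f \<in> carrier ?L"
        unfolding stalk_multiproj_simps degree_zero_fractions_iff using same_degI[OF xh d(2)] a(4) by blast
      have "Fract (x * esym n h) f * Fract (esym n D) (esym n h) \<in> JX P"
        using JI.I_l_closed[OF m1 carr_x] unfolding stalk_multiproj_simps .
      also have "Fract (x * esym n h) f * Fract (esym n D) (esym n h) = Fract ((x * esym n h) * esym n D) (f * esym n h)"
        by (rule mult_fract)
      also have "\<dots> = Fract (esym n h * a) (esym n h * f)"
        by (simp only: x(1) mult_ac)
      also have "\<dots> = w"
        unfolding a(1) by (rule mult_fract_cancel) (rule prime_notin_nonzero[OF PD(1) \<phi>h])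
      finally show ?thesis .
    qed
  qed
  moreover have "JX P \<subseteq> ideal_sheaf {1..n} (\<lambda>_. 1) AX P"
    unfolding J by (rule genideal_minimal[OF id gen])
  ultimately show ?thesis by blast
qed

sublocale X: closed_subscheme "{1..n}" "\<lambda>_. 1" AX JX
  by unfold_locales (rule ideal_AX, rule JX_eq)

sublocale Y: closed_subscheme "{1}" "\<lambda>_. n" AY JY
  by unfold_locales (rule ideal_AY, simp add: JY_def)

sublocale pi: closed_subscheme_hom "esym n :: 'k mpoly \<Rightarrow> _" "{1..n}" "\<lambda>_. 1" "{1}" "\<lambda>_. n"
  "\<lambda>d. udeg {1..n} (d 1)" AX JX AY JY
proof unfold_locales
  show "{F \<in> Rpolys. esym n F \<in> P} \<in> Rpoints" if "P \<in> Spoints" for P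
    using esym_pt_point[OF n_pos that] by (simp add: esym_pt_def)
qed (rule esym_AY)

lemma perm_hom:
  assumes \<sigma>: "\<sigma> permutes {1..n}"
  shows "closed_subscheme_hom (perm_vars \<sigma>) {1..n} (\<lambda>_. 1) {1..n} (\<lambda>_. 1) (\<lambda>d i. d (\<sigma> i)) AX JX AX JX"
proof -
  interpret p: graded_hom "perm_vars \<sigma> :: 'k mpoly \<Rightarrow> _" "{1..n}" "\<lambda>_. 1" "{1..n}" "\<lambda>_. 1" "\<lambda>d i. d (\<sigma> i)"
    by (rule graded_hom_perm_vars[OF \<sigma>])
  show ?thesis
  proof unfold_locales
    show "{F \<in> Spolys. perm_vars \<sigma> F \<in> P} \<in> Spoints" if "P \<in> Spoints" for P
      using perm_pt_point[OF \<sigma> that] by (simp add: perm_pt_def)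
  qed (rule perm_AX[OF \<sigma>])
qed

section \<open>The action and the projection in terms of fractions\<close>

definition act :: "(nat \<Rightarrow> nat) \<Rightarrow> ('k mpoly set, 'k mpoly set, 'k mpoly fract set, 'k mpoly fract set) lrmap" where
  "act \<sigma> = induced_map (P1_power n) JX (permute_factors n \<sigma>)"

definition proj :: "('k mpoly set, 'k mpoly set, 'k mpoly fract set, 'k mpoly fract set) lrmap" where
  "proj = induced_map (P1_power n) JX (pi_map n)"

lemma act_ind: "act \<sigma> = induced_map (multiproj {1..n} (\<lambda>_. 1)) JX (multiproj_map {1..n} (\<lambda>_. 1) (perm_vars \<sigma>))"
  by (simp only: act_def P1_power_def permute_factors_perm_vars)

lemma proj_ind: "proj = pi.ind"
  by (simp only: proj_def P1_power_def pi_map_esym)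

lemma pmap_esym: "pi.pmap P = esym_pt n P"
  by (simp add: pi.pmap_def esym_pt_def)

lemma pt_act: "pt (act \<sigma>) P = perm_pt n \<sigma> P"
  by (simp add: act_ind induced_map_def multiproj_map_def perm_pt_def)

lemma pt_proj: "pt proj P = esym_pt n P"
  by (simp add: proj_ind pi.pt_ind pmap_esym)

lemma germ_act:
  assumes \<sigma>: "\<sigma> permutes {1..n}" and P: "P \<in> Spoints" and ag: "Ssame a g" "perm_vars \<sigma> g \<notin> P"
  shows "germ (act \<sigma>) P (X.cls (perm_pt n \<sigma> P) a g) = X.cls P (perm_vars \<sigma> a) (perm_vars \<sigma> g)"
proof -
  interpret p: closed_subscheme_hom "perm_vars \<sigma>" "{1..n}" "\<lambda>_. 1" "{1..n}" "\<lambda>_. 1" "\<lambda>d i. d (\<sigma> i)" AX JX AX JX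
    by (rule perm_hom[OF \<sigma>])
  have "p.pmap P = perm_pt n \<sigma> P" by (simp add: p.pmap_def perm_pt_def)
  moreover have "g \<notin> p.pmap P" using ag(2) p.notin_pmap_same_deg[OF ag(1)] by blast
  ultimately show ?thesis using p.germ_ind[OF P ag(1)] by (simp add: act_ind)
qed

lemma germ_proj:
  assumes P: "P \<in> Spoints" and ag: "Rsame a g" "esym n g \<notin> P"
  shows "germ proj P (Y.cls (esym_pt n P) a g) = X.cls P (esym n a) (esym n g)"
  using pi.germ_ind[OF P ag(1)] ag(2) pi.notin_pmap_same_deg[OF ag(1)]
  unfolding proj_ind pmap_esym by blast

lemma morphism_act:
  assumes \<sigma>: "\<sigma> permutes {1..n}"
  shows "lrs_morphism X.Z X.Z (act \<sigma>)"
proof -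
  interpret p: closed_subscheme_hom "perm_vars \<sigma>" "{1..n}" "\<lambda>_. 1" "{1..n}" "\<lambda>_. 1" "\<lambda>d i. d (\<sigma> i)" AX JX AX JX
    by (rule perm_hom[OF \<sigma>])
  show ?thesis unfolding act_ind by (rule p.lrs_morphism_ind)
qed

lemma perm_pt_points:
  assumes \<sigma>: "\<sigma> permutes {1..n}" and P: "P \<in> points X.Z"
  shows "perm_pt n \<sigma> P \<in> points X.Z"
proof -
  interpret p: closed_subscheme_hom "perm_vars \<sigma>" "{1..n}" "\<lambda>_. 1" "{1..n}" "\<lambda>_. 1" "\<lambda>d i. d (\<sigma> i)" AX JX AX JX
    by (rule perm_hom[OF \<sigma>])
  show ?thesis using p.pmap_points[OF P] by (simp add: p.pmap_def perm_pt_def)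
qed

lemma notin_perm_pt: "g \<in> Spolys \<Longrightarrow> g \<notin> perm_pt n \<sigma> P \<longleftrightarrow> perm_vars \<sigma> g \<notin> P"
  by (simp add: perm_pt_def)

lemma points_X: "points X.Z = {P \<in> Spoints. esym n D \<in> P}"
proof -
  have "(\<forall>a\<in>AX. Smform a \<longrightarrow> a \<in> P) \<longleftrightarrow> esym n D \<in> P" if P: "P \<in> Spoints" for P
  proof
    show "esym n D \<in> P" if "\<forall>a\<in>AX. Smform a \<longrightarrow> a \<in> P"
      using that principal_self mformI[OF esymD_form] unfolding AX_def by blast
    show "\<forall>a\<in>AX. Smform a \<longrightarrow> a \<in> P" if "esym n D \<in> P"
      using poly_idealD(4)[OF multiproj_pointsD(3)[OF P] that] unfolding AX_def principal_def by blast
  qed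
  then show ?thesis unfolding X.points_Z by blast
qed

lemma points_Y: "points Y.Z = {P \<in> Rpoints. D \<in> P}"
proof -
  have "(\<forall>a\<in>AY. Rmform a \<longrightarrow> a \<in> P) \<longleftrightarrow> D \<in> P" if P: "P \<in> Rpoints" for P
  proof
    show "D \<in> P" if "\<forall>a\<in>AY. Rmform a \<longrightarrow> a \<in> P"
      using that principal_self mformI[OF D_form] unfolding AY_def by blast
    show "\<forall>a\<in>AY. Rmform a \<longrightarrow> a \<in> P" if "D \<in> P"
      using poly_idealD(4)[OF multiproj_pointsD(3)[OF P] that] unfolding AY_def principal_def by blast
  qed
  then show ?thesis unfolding Y.points_Z by blast
qed

lemma esym_pt_points: "P \<in> points X.Z \<Longrightarrow> esym_pt n P \<in> points Y.Z"
  using pi.pmap_points by (simp only: pmap_esym)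

lemma point_over:
  assumes "Q \<in> points Y.Z"
  obtains P where "P \<in> points X.Z" "esym_pt n P = Q"
proof -
  have Q: "Q \<in> Rpoints" "D \<in> Q" using assms by (auto simp: points_Y)
  obtain P where P: "P \<in> Spoints" "esym_pt n P = Q" by (rule esym_pt_surj[OF n_pos Q(1)])
  then have "P \<in> points X.Z" using Q(2) by (auto simp: points_X esym_pt_def)
  then show thesis using that P(2) by blast
qed

subsection \<open>The action and the invariant morphism\<close>

lemma acts_on_X: "acts_on (sym_group n) act X.Z"
  unfolding acts_on_def sym_group_mult sym_group_one
proof (intro conjI ballI)
  show "group (sym_group n)" by (rule sym_group_is_group)
  show "lrs_morphism X.Z X.Z (act \<sigma>)" if "\<sigma> \<in> carrier (sym_group n)" for \<sigma>
    using that by (intro morphism_act) (simp add: sym_group_carrier)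
next
  fix P assume P: "P \<in> points X.Z"
  note PP = X.points_ZD[OF P]
  have id: "perm_pt n id P = P" by (rule perm_pt_id[OF multiproj_pointsD(3)[OF PP]])
  show "pt (act id) P = P" by (simp only: pt_act id)
  fix z assume "z \<in> carrier (stalk X.Z P)"
  then obtain a g where z: "z = X.cls P a g" "Ssame a g" "g \<notin> P" by (rule X.carrier_ZE)
  show "germ (act id) P z = z"
    using germ_act[OF permutes_id PP z(2)] z(3) by (simp add: z(1) id perm_vars_id)
next
  fix \<sigma> \<tau> P assume "\<sigma> \<in> carrier (sym_group n)" "\<tau> \<in> carrier (sym_group n)" and P: "P \<in> points X.Z"
  then have \<sigma>: "\<sigma> permutes {1..n}" and \<tau>: "\<tau> permutes {1..n}" by (simp_all add: sym_group_carrier)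
  have \<sigma>\<tau>: "(\<sigma> \<circ> \<tau>) permutes {1..n}" by (rule permutes_compose[OF \<tau> \<sigma>])
  note PP = X.points_ZD[OF P]
  note \<tau>P = perm_pt_point[OF \<tau> PP]
  show eq: "pt (act (\<sigma> \<circ> \<tau>)) P = pt (act \<sigma>) (pt (act \<tau>) P)"
    by (simp only: pt_act perm_pt_comp[OF \<sigma> \<tau>])
  fix z assume "z \<in> carrier (stalk X.Z (pt (act (\<sigma> \<circ> \<tau>)) P))"
  then have "z \<in> carrier (stalk X.Z (perm_pt n (\<sigma> \<circ> \<tau>) P))" by (simp only: pt_act)
  then obtain a g where z: "z = X.cls (perm_pt n (\<sigma> \<circ> \<tau>) P) a g" "Ssame a g" "g \<notin> perm_pt n (\<sigma> \<circ> \<tau>) P"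
    by (rule X.carrier_ZE)
  interpret s: graded_hom "perm_vars \<sigma> :: 'k mpoly \<Rightarrow> _" "{1..n}" "\<lambda>_. 1" "{1..n}" "\<lambda>_. 1" "\<lambda>d i. d (\<sigma> i)"
    by (rule graded_hom_perm_vars[OF \<sigma>])
  note sd = s.same_deg_hom[OF z(2)]
  have g: "perm_vars (\<sigma> \<circ> \<tau>) g \<notin> P" using z(3) notin_perm_pt[OF same_deg_polys(2)[OF z(2)]] by blast
  have g2: "perm_vars \<tau> (perm_vars \<sigma> g) \<notin> P" using g unfolding perm_vars_comp[OF \<tau> \<sigma>] .
  have g1: "perm_vars \<sigma> g \<notin> perm_pt n \<tau> P" using g2 notin_perm_pt[OF same_deg_polys(2)[OF sd]] by blast
  have "germ (act \<tau>) P (germ (act \<sigma>) (perm_pt n \<tau> P) (X.cls (perm_pt n \<sigma> (perm_pt n \<tau> P)) a g)) =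
      X.cls P (perm_vars \<tau> (perm_vars \<sigma> a)) (perm_vars \<tau> (perm_vars \<sigma> g))"
    by (simp only: germ_act[OF \<sigma> \<tau>P z(2) g1] germ_act[OF \<tau> PP sd g2])
  then show "germ (act (\<sigma> \<circ> \<tau>)) P z = germ (act \<tau>) P (germ (act \<sigma>) (pt (act \<tau>) P) z)"
    by (simp only: z(1) germ_act[OF \<sigma>\<tau> PP z(2) g] pt_act perm_pt_comp[OF \<sigma> \<tau>] perm_vars_comp[OF \<tau> \<sigma>])
qed

text \<open>Germs pulled back from the target have numerator and denominator in the image of
  \<open>esym n\<close>, which permutations fix.\<close>

lemma germ_act_proj:
  assumes \<sigma>: "\<sigma> permutes {1..n}" and P: "P \<in> Spoints" and z: "z \<in> carrier (stalk Y.Z (esym_pt n P))"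
  shows "germ (act \<sigma>) P (germ proj (perm_pt n \<sigma> P) z) = germ proj P z"
proof -
  obtain a g where z: "z = Y.cls (esym_pt n P) a g" "Rsame a g" "g \<notin> esym_pt n P"
    by (rule Y.carrier_ZE[OF z])
  note ag = same_deg_polys[OF z(2)]
  have inv_ag: "perm_vars \<sigma> (esym n a) = esym n a" "perm_vars \<sigma> (esym n g) = esym n g"
    by (rule perm_vars_esym[OF \<sigma> ag(1)], rule perm_vars_esym[OF \<sigma> ag(2)])
  have g: "esym n g \<notin> P" using z(3) ag(2) by (simp add: esym_pt_def)
  then have g': "perm_vars \<sigma> (esym n g) \<notin> P" by (simp only: inv_ag not_False_eq_True)
  then have g'': "esym n g \<notin> perm_pt n \<sigma> P" using notin_perm_pt[OF E.hom_polys[OF ag(2)]] by blast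
  have "germ proj (perm_pt n \<sigma> P) (Y.cls (esym_pt n (perm_pt n \<sigma> P)) a g) = X.cls (perm_pt n \<sigma> P) (esym n a) (esym n g)"
    by (rule germ_proj[OF perm_pt_point[OF \<sigma> P] z(2) g''])
  then show ?thesis
    using germ_act[OF \<sigma> P E.same_deg_hom[OF z(2)] g']
    by (simp only: z(1) esym_pt_perm_pt[OF n_pos \<sigma>] germ_proj[OF P z(2) g] inv_ag)
qed

lemma invariant_proj: "invariant_morphism (sym_group n) act X.Z Y.Z proj"
  unfolding invariant_morphism_def
proof (intro conjI ballI)
  show "lrs_morphism X.Z Y.Z proj" unfolding proj_ind by (rule pi.lrs_morphism_ind)
  fix \<sigma> P assume "\<sigma> \<in> carrier (sym_group n)" and P: "P \<in> points X.Z"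
  then have \<sigma>: "\<sigma> permutes {1..n}" by (simp add: sym_group_carrier)
  show "pt proj (pt (act \<sigma>) P) = pt proj P"
    by (simp only: pt_act pt_proj esym_pt_perm_pt[OF n_pos \<sigma>])
  fix z assume "z \<in> carrier (stalk Y.Z (pt proj P))"
  then show "germ (act \<sigma>) P (germ proj (pt (act \<sigma>) P) z) = germ proj P z"
    unfolding pt_act pt_proj by (rule germ_act_proj[OF \<sigma> X.points_ZD[OF P]])
qed

subsection \<open>Denominators\<close>

lemma raise_form:
  assumes P: "P \<in> Spoints" and f: "Smform f" "f \<notin> P"
  obtains u m where "Smform u" "u \<notin> P" "m \<ge> 1" "u * f \<in> Sforms m" "\<And>a. Ssame a f \<Longrightarrow> u * a \<in> Sforms m"
proof -
  note PD = multiproj_pointsD[OF P]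
  have f_nz: "f \<noteq> 0" by (rule prime_notin_nonzero[OF PD(1) f(2)])
  obtain d where d: "f \<in> multiforms {1..n} (\<lambda>_. 1) d" using f(1) by (auto simp: mform_def)
  have d0: "\<And>i. i \<notin> {1..n} \<Longrightarrow> d i = 0" by (rule multiforms_degree_support[OF d f_nz])
  \<comment> \<open>The successor ensures \<open>m \<ge> 1\<close>. In
    \<open>kill_difference\<close> positive degree in every factor makes a prime that avoids the
    form relevant.\<close>
  define m where "m = Suc (\<Sum>i\<in>{1..n}. d i)"
  have dm: "d i \<le> m" if "i \<in> {1..n}" for i
  proof -
    have "d i \<le> (\<Sum>i\<in>{1..n}. d i)" using that by (intro member_le_sum) auto
    then show ?thesis by (simp add: m_def)
  qed
  obtain u where u: "u \<in> multiforms {1..n} (\<lambda>_. 1) (\<lambda>i. udeg {1..n} m i - d i)" "u \<notin> P"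
    "\<And>F. F \<in> multiforms {1..n} (\<lambda>_. 1) d \<Longrightarrow> u * F \<in> Sforms m"
    using raise_degree[where d = d, OF P finite_atLeastAtMost dm d0] by blast
  have "u * a \<in> Sforms m" if a: "Ssame a f" for a
  proof -
    obtain d' where d': "a \<in> multiforms {1..n} (\<lambda>_. 1) d'" "f \<in> multiforms {1..n} (\<lambda>_. 1) d'"
      using a by (auto simp: same_deg_def)
    \<comment> \<open>A nonzero form determines its degree, so every numerator that goes with
      \<open>f\<close> has degree \<open>d\<close> as well.\<close>
    have "f = multihom_part d' f" by (simp add: multihom_part_multiforms[OF d'(2)])
    also have "\<dots> = (if d' = d then f else 0)" by (rule multihom_part_multiforms[OF d])
    finally have "d' = d" using f_nz by (simp split: if_splits)
    then show ?thesis using u(3) d'(1) by blast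
  qed
  moreover have "m \<ge> 1" by (simp add: m_def)
  ultimately show thesis using that[OF mformI[OF u(1)] u(2) _ u(3)[OF d]] by blast
qed

text \<open>The conjugates of \<open>f\<close> form a suitable family: for each
  \<open>\<sigma>\<close>, the conjugate by its inverse is carried back to \<open>f\<close>. As
  \<open>H\<close> lies in the ideal they generate, some conjugate of \<open>f\<close> is nonzero
  wherever \<open>H\<close> is.\<close>

lemma invariant_denominator:
  assumes P: "P \<in> Spoints" and f: "f \<in> Sforms m" "f \<notin> P"
  obtains b M H where "\<And>\<tau>. \<tau> permutes {1..n} \<Longrightarrow> b \<tau> \<in> Sforms M"
    "H \<in> multiforms {1} (\<lambda>_. n) (udeg {1} (M + m))"
    "esym n H = (\<Sum>\<tau> | \<tau> permutes {1..n}. b \<tau> * perm_vars \<tau> f)" "esym n H \<notin> P"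
proof -
  have av: "\<exists>\<tau>. \<tau> permutes {1..n} \<and> perm_vars \<sigma> (perm_vars \<tau> f) \<notin> P" if \<sigma>: "\<sigma> permutes {1..n}" for \<sigma>
  proof (intro exI conjI)
    show "Hilbert_Choice.inv \<sigma> permutes {1..n}" by (rule permutes_inv[OF \<sigma>])
    show "perm_vars \<sigma> (perm_vars (Hilbert_Choice.inv \<sigma>) f) \<notin> P" unfolding perm_vars_inv(2)[OF \<sigma>] by (rule f(2))
  qed
  obtain b M where b: "\<And>\<tau>. \<tau> permutes {1..n} \<Longrightarrow> b \<tau> \<in> Sforms M"
    "\<And>\<sigma>. \<sigma> permutes {1..n} \<Longrightarrow>
       perm_vars \<sigma> (\<Sum>\<tau> | \<tau> permutes {1..n}. b \<tau> * perm_vars \<tau> f) = (\<Sum>\<tau> | \<tau> permutes {1..n}. b \<tau> * perm_vars \<tau> f)"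
    "(\<Sum>\<tau> | \<tau> permutes {1..n}. b \<tau> * perm_vars \<tau> f) \<notin> P"
    using invariant_avoiding_prime_perm[OF multiproj_pointsD(1)[OF P] perm_vars_udeg[OF _ f(1)] av] by blast
  have "(\<Sum>\<tau> | \<tau> permutes {1..n}. b \<tau> * perm_vars \<tau> f) \<in> Sforms (M + m)"
    unfolding udeg_add[symmetric]
    by (intro multiforms_sum multiforms_mult) (use b(1) perm_vars_udeg[OF _ f(1)] in auto)
  then obtain H where H: "H \<in> multiforms {1} (\<lambda>_. n) (udeg {1} (M + m))"
    "esym n H = (\<Sum>\<tau> | \<tau> permutes {1..n}. b \<tau> * perm_vars \<tau> f)"
    using invariant_in_sym_img b(2) by blast
  have H_P: "esym n H \<notin> P" using b(3) unfolding H(2) .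
  show thesis by (rule that[OF b(1) H H_P])
qed

lemma notin_sum_perm:
  assumes P: "poly_ideal {1..n} (\<lambda>_. 1) P" and b: "\<And>\<tau>. \<tau> permutes {1..n} \<Longrightarrow> b \<tau> \<in> Spolys"
    and s: "(\<Sum>\<tau> | \<tau> permutes {1..n}. b \<tau> * w \<tau>) \<notin> P"
  obtains \<tau> where "\<tau> permutes {1..n}" "w \<tau> \<notin> P"
proof -
  have "\<exists>\<tau>. \<tau> permutes {1..n} \<and> w \<tau> \<notin> P"
  proof (rule ccontr)
    assume no: "\<not> ?thesis"
    have "(\<Sum>\<tau> | \<tau> permutes {1..n}. b \<tau> * w \<tau>) \<in> P"
    proof (rule poly_ideal_sum[OF P])
      fix \<tau> assume "\<tau> \<in> {\<tau>. \<tau> permutes {1..n}}"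
      then have \<tau>: "\<tau> permutes {1..n}" by simp
      then have "w \<tau> \<in> P" using no by blast
      then show "b \<tau> * w \<tau> \<in> P" by (rule poly_idealD(4)[OF P _ b[OF \<tau>]])
    qed
    then show False using s by simp
  qed
  then show thesis using that by blast
qed

text \<open>Around a point of \<open>W\<close> the required form is a symmetric \<open>H\<close>
  obtained from a basic open neighbourhood upstairs. Over a point where \<open>H\<close> does not
  vanish, some translate of a preimage lies in that neighbourhood, and translation does not change
  the image.\<close>

lemma openin_image:
  assumes W: "W \<subseteq> points Y.Z" and op: "openin (undertop X.Z) {P \<in> points X.Z. esym_pt n P \<in> W}"
  shows "openin (undertop Y.Z) W"
  unfolding Y.openin_Z
proof (intro conjI ballI)
  show "W \<subseteq> points Y.Z" by (rule W)
  fix Q assume Q: "Q \<in> W"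
  obtain P where P: "P \<in> points X.Z" "esym_pt n P = Q" using point_over W Q by blast
  note PP = X.points_ZD[OF P(1)]
  note PD = multiproj_pointsD[OF PP]
  obtain f where f: "Smform f" "f \<notin> P"
    "basic_open {1..n} (\<lambda>_. 1) f \<inter> points X.Z \<subseteq> {P \<in> points X.Z. esym_pt n P \<in> W}"
    using op P Q unfolding X.openin_Z by blast
  obtain u m where u: "Smform u" "u \<notin> P" "m \<ge> 1" "u * f \<in> Sforms m"
    using raise_form[OF PP f(1,2)] by blast
  have uf: "u * f \<notin> P" by (rule prime_mult_notin[OF PD(1) mform_polys[OF u(1)] mform_polys[OF f(1)] u(2) f(2)])
  obtain b M H where b: "\<And>\<tau>. \<tau> permutes {1..n} \<Longrightarrow> b \<tau> \<in> Sforms M"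
    "H \<in> multiforms {1} (\<lambda>_. n) (udeg {1} (M + m))"
    "esym n H = (\<Sum>\<tau> | \<tau> permutes {1..n}. b \<tau> * perm_vars \<tau> (u * f))" "esym n H \<notin> P"
    using invariant_denominator[OF PP u(4) uf] by blast
  have "H \<notin> Q" using b(4) unfolding P(2)[symmetric] esym_pt_def by blast
  moreover have "Q' \<in> W" if Q': "Q' \<in> points Y.Z" "H \<notin> Q'" for Q'
  proof -
    obtain P' where P': "P' \<in> points X.Z" "esym_pt n P' = Q'" by (rule point_over[OF Q'(1)])
    note PD' = multiproj_pointsD[OF X.points_ZD[OF P'(1)]]
    have "esym n H \<notin> P'" using Q'(2) multiforms_polys[OF b(2)] unfolding P'(2)[symmetric] esym_pt_def by blast
    then have "(\<Sum>\<tau> | \<tau> permutes {1..n}. b \<tau> * perm_vars \<tau> (u * f)) \<notin> P'" unfolding b(3) .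
    then obtain \<tau> where \<tau>: "\<tau> permutes {1..n}" "perm_vars \<tau> (u * f) \<notin> P'"
      using notin_sum_perm[where b = b and w = "\<lambda>\<tau>. perm_vars \<tau> (u * f)", OF PD'(3) multiforms_polys[OF b(1)]]
      by blast
    have "u * f \<notin> perm_pt n \<tau> P'"
      using \<tau>(2) notin_perm_pt[OF multiforms_polys[OF u(4)]] by blast
    moreover note tP = perm_pt_points[OF \<tau>(1) P'(1)]
    ultimately have "f \<notin> perm_pt n \<tau> P'"
      using poly_idealD(4)[OF multiproj_pointsD(3)[OF X.points_ZD[OF tP]] _ mform_polys[OF u(1)]] by blast
    then have "esym_pt n (perm_pt n \<tau> P') \<in> W"
      using f(3) tP X.points_ZD[OF tP] by (auto simp: basic_open_def)
    then show ?thesis by (simp only: esym_pt_perm_pt[OF n_pos \<tau>(1)] P'(2))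
  qed
  ultimately show "\<exists>f. Rmform f \<and> f \<notin> Q \<and> basic_open {1} (\<lambda>_. n) f \<inter> points Y.Z \<subseteq> W"
    using mformI[OF b(2)] by (auto simp: basic_open_def)
qed

subsection \<open>Injectivity\<close>

text \<open>Averaging \<open>esym n F = G * esym n D\<close> replaces \<open>G\<close> by its
  average, which comes from the target ring; injectivity of \<open>esym n\<close> then cancels it
  from the identity.\<close>

lemma AY_descent:
  assumes F: "F \<in> multiforms {1} (\<lambda>_. n) d" and a: "esym n F \<in> AX"
  shows "F \<in> AY"
proof (cases "esym n F = 0")
  case True
  then have "F = 0" by (rule esym_eq_0[OF n_pos multiforms_polys[OF F]])
  then show ?thesis using poly_idealD(2)[OF ideal_AY] by simp
next
  case False
  note FR = multiforms_polys[OF F]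
  obtain G where G: "esym n F = G * esym n D" "G \<in> multiforms {1..n} (\<lambda>_. 1) (\<lambda>i. udeg {1..n} (d 1) i - udeg {1..n} e i)"
    using principal_multiform[OF esymD_form a[unfolded AX_def] esym_multiforms[OF F] False] by blast
  have "(\<lambda>i. udeg {1..n} (d 1) i - udeg {1..n} e i) = udeg {1..n} (d 1 - e)" by (auto simp: udeg_def)
  then have "G \<in> Sforms (d 1 - e)" using G(2) by (simp only:)
  then have "(\<Sum>\<sigma> | \<sigma> permutes {1..n}. perm_vars \<sigma> G) \<in> sym_img n (d 1 - e)" by (rule sym_img_symmetrised)
  then obtain H where H: "H \<in> multiforms {1} (\<lambda>_. n) (udeg {1} (d 1 - e))"
    "(\<Sum>\<sigma> | \<sigma> permutes {1..n}. perm_vars \<sigma> G) = esym n H" by (auto simp: sym_img_def)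
  have "esym n F = Cst (1 / fact n) * (\<Sum>\<sigma> | \<sigma> permutes {1..n}. perm_vars \<sigma> (esym n F))"
    by (rule sum_perm_vars_const[symmetric]) (rule perm_vars_esym[OF _ FR])
  also have "(\<Sum>\<sigma> | \<sigma> permutes {1..n}. perm_vars \<sigma> (esym n F)) =
      (\<Sum>\<sigma> | \<sigma> permutes {1..n}. perm_vars \<sigma> (esym n D * G))"
    by (simp only: G(1) mult.commute)
  also have "\<dots> = esym n D * esym n H"
    unfolding H(2)[symmetric] by (rule sum_perm_vars_invariant) (rule perm_vars_esym[OF _ multiforms_polys[OF D_form]])
  also have "Cst (1 / fact n) * (esym n D * esym n H) = esym n ((Cst (1 / fact n) * H) * D)"
    by (simp only: esym.hom_mult esym.hom_Cst mult_ac)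
  finally have eq: "esym n F = esym n ((Cst (1 / fact n) * H) * D)" .
  have CH: "Cst (1 / fact n) * H \<in> Rpolys" by (rule polys_mult[OF polys_Cst multiforms_polys[OF H(1)]])
  have "F = (Cst (1 / fact n) * H) * D"
    by (rule esym_inject[OF n_pos FR polys_mult[OF CH multiforms_polys[OF D_form]] eq])
  then show ?thesis unfolding AY_def principal_def using CH by blast
qed

text \<open>Equality upstairs gives a multiplier \<open>v\<close> outside \<open>P\<close> that
  moves the difference \<open>w\<close> of cross products into \<open>AX\<close>. Both
  \<open>AX\<close> and \<open>esym n w\<close> are stable under permutations, so the conjugates of
  \<open>u * v\<close> do the same, and so does the symmetric \<open>H\<close> built from them, to
  which \<open>AY_descent\<close> applies.\<close>

lemma cls_esym_inj:
  assumes P: "P \<in> Spoints" and ag: "Rsame a g" "esym n g \<notin> P" and bh: "Rsame b h" "esym n h \<notin> P"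
    and eq: "X.cls P (esym n a) (esym n g) = X.cls P (esym n b) (esym n h)"
  shows "Y.cls (esym_pt n P) a g = Y.cls (esym_pt n P) b h"
proof -
  note PD = multiproj_pointsD[OF P]
  define w where "w = a * h - b * g"
  obtain d where w: "w \<in> multiforms {1} (\<lambda>_. n) d"
    using same_deg_mform(1)[OF same_deg_cross_diff[OF ag(1) bh(1)]] unfolding w_def mform_def by blast
  obtain v where v: "Smform v" "v \<notin> P" "v * (esym n a * esym n h - esym n b * esym n g) \<in> AX"
    using eq X.cls_eq_iff[OF P E.same_deg_hom[OF ag(1)] ag(2) E.same_deg_hom[OF bh(1)] bh(2)] by blast
  have vw: "v * esym n w \<in> AX"
    using v(3) by (simp only: w_def esym.hom_diff esym.hom_mult)
  obtain u m where u: "Smform u" "u \<notin> P" "m \<ge> 1" "u * v \<in> Sforms m"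
    using raise_form[OF P v(1,2)] by blast
  have uv: "u * v \<notin> P" by (rule prime_mult_notin[OF PD(1) mform_polys[OF u(1)] mform_polys[OF v(1)] u(2) v(2)])
  obtain c M H where c: "\<And>\<tau>. \<tau> permutes {1..n} \<Longrightarrow> c \<tau> \<in> Sforms M"
    "H \<in> multiforms {1} (\<lambda>_. n) (udeg {1} (M + m))"
    "esym n H = (\<Sum>\<tau> | \<tau> permutes {1..n}. c \<tau> * perm_vars \<tau> (u * v))" "esym n H \<notin> P"
    using invariant_denominator[OF P u(4) uv] by blast
  have "esym n (H * w) = (\<Sum>\<tau> | \<tau> permutes {1..n}. c \<tau> * (perm_vars \<tau> (u * v) * esym n w))"
    by (simp only: esym.hom_mult c(3) sum_distrib_right mult.assoc)
  also have "\<dots> \<in> AX"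
  proof (rule poly_ideal_sum[OF ideal_AX])
    fix \<tau> assume "\<tau> \<in> {\<tau>. \<tau> permutes {1..n}}"
    then have \<tau>: "\<tau> permutes {1..n}" by simp
    have "u * (v * esym n w) \<in> AX" by (rule poly_idealD(4)[OF ideal_AX vw mform_polys[OF u(1)]])
    then have "perm_vars \<tau> (u * (v * esym n w)) \<in> AX" by (rule perm_AX[OF \<tau>])
    also have "perm_vars \<tau> (u * (v * esym n w)) = perm_vars \<tau> (u * v) * esym n w"
      by (simp only: perm_vars.hom_mult perm_vars_esym[OF \<tau> multiforms_polys[OF w]] mult.assoc)
    finally show "c \<tau> * (perm_vars \<tau> (u * v) * esym n w) \<in> AX"
      by (rule poly_idealD(4)[OF ideal_AX _ multiforms_polys[OF c(1)[OF \<tau>]]])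
  qed
  finally have "esym n (H * w) \<in> AX" .
  then have "H * w \<in> AY" by (rule AY_descent[OF multiforms_mult[OF c(2) w]])
  moreover have "H \<notin> esym_pt n P" "g \<notin> esym_pt n P" "h \<notin> esym_pt n P"
    using c(4) ag(2) bh(2) by (auto simp: esym_pt_def)
  ultimately show ?thesis
    using Y.cls_eq_iff[OF esym_pt_point[OF n_pos P] ag(1) _ bh(1)] mformI[OF c(2)] unfolding w_def by blast
qed

section \<open>Inverse images of open sets and pullback of sections\<close>

definition preimage :: "'k mpoly set set \<Rightarrow> 'k mpoly set set" where
  "preimage V = {P \<in> points X.Z. esym_pt n P \<in> V}"

lemma preim_proj: "preim X.Z proj V = preimage V"
  by (simp only: preim_def preimage_def pt_proj)

lemma preimage_subset: "preimage V \<subseteq> points X.Z"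
  by (auto simp: preimage_def)

lemma pull_proj:
  assumes "P \<in> preimage V" "s (esym_pt n P) = Y.cls (esym_pt n P) a g" "Rsame a g" "esym n g \<notin> P"
  shows "pull X.Z proj V s P = X.cls P (esym n a) (esym n g)"
  using assms germ_proj[OF X.points_ZD, of P a g] unfolding pull_def preim_proj pt_proj
  by (simp add: preimage_def)

lemma pull_proj_inj:
  assumes V: "V \<subseteq> points Y.Z" and s: "s \<in> sects Y.Z V" and t: "t \<in> sects Y.Z V"
    and eq: "pull X.Z proj V s = pull X.Z proj V t"
  shows "s = t"
proof (rule extensionalityI[of _ V])
  show "s \<in> extensional V" "t \<in> extensional V" using s t unfolding Y.sects_Z[OF V] by auto
  fix Q assume Q: "Q \<in> V"
  obtain P where P: "P \<in> points X.Z" "esym_pt n P = Q" using point_over V Q by blast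
  then have PV: "P \<in> preimage V" using Q by (simp add: preimage_def)
  obtain a g where ag: "s Q = Y.cls Q a g" "Rsame a g" "g \<notin> Q"
    by (rule Y.carrier_ZE[OF Y.sects_Z_carrier[OF V s Q]])
  obtain b h where bh: "t Q = Y.cls Q b h" "Rsame b h" "h \<notin> Q"
    by (rule Y.carrier_ZE[OF Y.sects_Z_carrier[OF V t Q]])
  have g: "esym n g \<notin> P" using ag(3) same_deg_polys(2)[OF ag(2)] unfolding P(2)[symmetric] esym_pt_def by blast
  have h: "esym n h \<notin> P" using bh(3) same_deg_polys(2)[OF bh(2)] unfolding P(2)[symmetric] esym_pt_def by blast
  have "X.cls P (esym n a) (esym n g) = X.cls P (esym n b) (esym n h)"
    using pull_proj[OF PV _ ag(2) g, of s] pull_proj[OF PV _ bh(2) h, of t] ag(1) bh(1) eq by (simp only: P(2))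
  from cls_esym_inj[OF X.points_ZD[OF P(1)] ag(2) g bh(2) h this] show "s Q = t Q"
    by (simp only: ag(1) bh(1) P(2))
qed

subsection \<open>Descent of invariant sections\<close>

lemma perm_pt_preimage:
  assumes \<sigma>: "\<sigma> permutes {1..n}"
  shows "P \<in> preimage V \<Longrightarrow> perm_pt n \<sigma> P \<in> preimage V"
    "P \<in> points X.Z \<Longrightarrow> perm_pt n \<sigma> P \<in> preimage V \<Longrightarrow> P \<in> preimage V"
  using perm_pt_points[OF \<sigma>] by (auto simp: preimage_def esym_pt_perm_pt[OF n_pos \<sigma>])

lemma preim_act:
  assumes \<sigma>: "\<sigma> permutes {1..n}"
  shows "preim X.Z (act \<sigma>) (preimage V) = preimage V"
  unfolding preim_def pt_act using perm_pt_preimage[OF \<sigma>] preimage_subset by blast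

text \<open>
  Otherwise some prime contains the annihilator of the difference modulo \<open>AX\<close> but not \<open>f * g\<close>: a
  point of the scheme at which the two fractions differ.
\<close>

lemma kill_difference:
  assumes a: "Ssame a f" and b: "Ssame b g" and pos: "f * g \<in> Sforms m" "m \<ge> 1"
    and eq: "\<And>P. P \<in> points X.Z \<Longrightarrow> f \<notin> P \<Longrightarrow> g \<notin> P \<Longrightarrow> X.cls P a f = X.cls P b g"
  obtains k where "(f * g) ^ k * (a * g - b * f) \<in> AX"
proof -
  define w where "w = a * g - b * f"
  obtain d where w: "w \<in> multiforms {1..n} (\<lambda>_. 1) d"
    using same_deg_mform(1)[OF same_deg_cross_diff[OF a b]] unfolding w_def mform_def by blast
  note wS = multiforms_polys[OF w] and fgS = multiforms_polys[OF pos(1)]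
  note AXD = poly_idealD[OF ideal_AX]
  have "\<exists>k. (f * g) ^ k * w \<in> AX"
  proof (rule ccontr)
    assume no: "\<not> ?thesis"
    \<comment> \<open>The annihilator of \<open>w\<close> modulo \<open>AX\<close>; it is
      multihomogeneous because both \<open>w\<close> and the generator of \<open>AX\<close> are
      forms.\<close>
    define N where "N = {u \<in> Spolys. u * w \<in> AX}"
    define T where "T = range (\<lambda>k. (f * g) ^ k)"
    have N: "poly_ideal {1..n} (\<lambda>_. 1) N"
      unfolding poly_ideal_def
    proof (intro conjI ballI)
      show "N \<subseteq> Spolys" by (auto simp: N_def)
      show "0 \<in> N" using AXD(2) by (simp add: N_def polys_0)
      fix F assume F: "F \<in> N"
      show "F + G \<in> N" if "G \<in> N" for G
        using F that AXD(3) by (simp add: N_def polys_add distrib_right)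
      show "G * F \<in> N" if "G \<in> Spolys" for G
        using F that AXD(4) by (simp add: N_def polys_mult mult.assoc)
    qed
    have Nmh: "multihom N"
      unfolding multihom_def
    proof (intro ballI allI)
      fix F c assume F: "F \<in> N"
      have "multihom_part (\<lambda>i. c i + d i) (F * w) \<in> AX"
        using multihom_principal[OF esymD_form] F unfolding N_def AX_def multihom_def by blast
      then show "multihom_part c F \<in> N"
        using F by (simp add: N_def multihom_part_mult_multiform[OF w] multihom_part_polys)
    qed
    have "\<exists>P. primeideal P (coord_ring {1..n} (\<lambda>_. 1)) \<and> multihom P \<and> N \<subseteq> P \<and> T \<inter> P = {}"
    proof (rule exists_multihom_prime_disjoint[OF N Nmh])
      show "\<exists>d. x \<in> multiforms {1..n} (\<lambda>_. 1) d" if "x \<in> T" for x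
        using that multiforms_power[OF pos(1)] unfolding T_def by blast
      have "1 = (f * g) ^ 0" by (simp only: power_0)
      then show "1 \<in> T" unfolding T_def by blast
      show "x * y \<in> T" if xT: "x \<in> T" and yT: "y \<in> T" for x y
      proof -
        obtain i j where "x = (f * g) ^ i" "y = (f * g) ^ j" using xT yT unfolding T_def by blast
        then have "x * y = (f * g) ^ (i + j)" by (simp only: power_add)
        then show ?thesis unfolding T_def by blast
      qed
      show "T \<inter> N = {}" using no unfolding T_def N_def by blast
    qed
    then obtain P where P: "primeideal P (coord_ring {1..n} (\<lambda>_. 1))" "multihom P" "N \<subseteq> P" "T \<inter> P = {}"
      by blast
    note PI = primeidealD_poly(1)[OF P(1)]
    have "(f * g) ^ 1 \<in> T" unfolding T_def by blast
    then have fg: "f * g \<notin> P" using P(4) by auto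
    have "\<exists>j\<le>1. Var i j \<notin> P" if i: "i \<in> {1..n}" for i
    proof (rule ccontr)
      assume "\<not> ?thesis"
      then have all: "\<And>j. j \<le> 1 \<Longrightarrow> Var i j \<in> P" by blast
      have "f * g \<in> P"
        by (rule multiform_in_ideal[OF PI _ all pos(1)]) (use i pos(2) in \<open>auto simp: udeg_def\<close>)
      then show False using fg by simp
    qed
    then have PS: "P \<in> Spoints" unfolding multiproj_points_iff using P by blast
    show False
    \<comment> \<open>Off the hypersurface there is nothing to compare, but there
      \<open>esym n D\<close> itself annihilates \<open>w\<close> modulo \<open>AX\<close> and is
      outside \<open>P\<close>.\<close>
    proof (cases "esym n D \<in> P")
      case False
      have "w * esym n D \<in> AX" unfolding AX_def principal_def using wS by blast
      then have "esym n D * w \<in> AX" by (simp only: mult.commute)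
      then have "esym n D \<in> N" using multiforms_polys[OF esymD_form] by (simp add: N_def)
      then show False using False P(3) by blast
    next
      case True
      then have PX: "P \<in> points X.Z" using PS by (simp add: points_X)
      have fP: "f \<notin> P" "g \<notin> P"
        using fg poly_idealD(4)[OF PI _ same_deg_polys(2)[OF a]] poly_idealD(5)[OF PI _ same_deg_polys(2)[OF b]] by auto
      obtain u where u: "Smform u" "u \<notin> P" "u * w \<in> AX"
        using X.cls_eq_iff[OF PS a fP(1) b fP(2)] eq[OF PX fP] unfolding w_def by blast
      then have "u \<in> N" using mform_polys[OF u(1)] by (simp add: N_def)
      then show False using P(3) u(2) by blast
    qed
  qed
  then show thesis using that unfolding w_def by blast
qed

text \<open>Evaluating the invariance of \<open>s\<close> at \<open>P\<close> expresses
  \<open>s P\<close> through its value at the translate of \<open>P\<close>.\<close>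

lemma section_act:
  assumes \<sigma>: "\<sigma> permutes {1..n}" and inv: "pull X.Z (act \<sigma>) (preimage V) s = s"
    and P: "P \<in> points X.Z" and a: "Ssame a f" "perm_vars \<sigma> f \<notin> P"
    and s: "perm_pt n \<sigma> P \<in> preimage V" "s (perm_pt n \<sigma> P) = X.cls (perm_pt n \<sigma> P) a f"
  shows "P \<in> preimage V \<and> s P = X.cls P (perm_vars \<sigma> a) (perm_vars \<sigma> f)"
proof
  show PV: "P \<in> preimage V" by (rule perm_pt_preimage(2)[OF \<sigma> P s(1)])
  have "s P = pull X.Z (act \<sigma>) (preimage V) s P" by (simp only: inv)
  also have "\<dots> = germ (act \<sigma>) P (s (perm_pt n \<sigma> P))"
    using PV by (simp add: pull_def preim_act[OF \<sigma>] pt_act)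
  also have "\<dots> = X.cls P (perm_vars \<sigma> a) (perm_vars \<sigma> f)"
    unfolding s(2) by (rule germ_act[OF \<sigma> X.points_ZD[OF P] a])
  finally show "s P = X.cls P (perm_vars \<sigma> a) (perm_vars \<sigma> f)" .
qed

lemma openin_preimage: "openin (undertop Y.Z) V \<Longrightarrow> openin (undertop X.Z) (preimage V)"
  using pi.openin_preim[of V] by (simp only: proj_ind[symmetric] preim_proj)

text \<open>The denominator absorbs a form \<open>g\<close> that cuts out a neighbourhood inside the
  preimage, so that its nonvanishing alone places a point there; a further factor \<open>u\<close>
  makes the degree diagonal.\<close>

lemma local_fraction:
  assumes V: "openin (undertop Y.Z) V" and s: "s \<in> sects X.Z (preimage V)" and P: "P \<in> preimage V"
  obtains a f m where "a \<in> Sforms m" "f \<in> Sforms m" "m \<ge> 1" "f \<notin> P"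
    "\<forall>P'\<in>points X.Z. f \<notin> P' \<longrightarrow> P' \<in> preimage V \<and> s P' = X.cls P' a f"
proof -
  have PX: "P \<in> points X.Z" using P preimage_subset by blast
  note PP = X.points_ZD[OF PX]
  note PD = multiproj_pointsD[OF PP]
  obtain a0 f0 where f0: "Ssame a0 f0" "f0 \<notin> P" "\<forall>P'\<in>preimage V. f0 \<notin> P' \<longrightarrow> s P' = X.cls P' a0 f0"
    using s P unfolding X.sects_Z[OF preimage_subset] by blast
  obtain g where g: "Smform g" "g \<notin> P" "basic_open {1..n} (\<lambda>_. 1) g \<inter> points X.Z \<subseteq> preimage V"
    using openin_preimage[OF V] P unfolding X.openin_Z by blast
  note f0S = same_deg_polys(2)[OF f0(1)] and gS = mform_polys[OF g(1)]
  have gf: "g * f0 \<notin> P" by (rule prime_mult_notin[OF PD(1) gS f0S g(2) f0(2)])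
  have sd: "Ssame (g * a0) (g * f0)" by (rule same_deg_mult[OF same_deg_refl[OF g(1)] f0(1)])
  obtain u m where u: "Smform u" "u \<notin> P" "m \<ge> 1" "u * (g * f0) \<in> Sforms m"
    "\<And>a. Ssame a (g * f0) \<Longrightarrow> u * a \<in> Sforms m"
    using raise_form[OF PP same_deg_mform(2)[OF sd] gf] by blast
  note uS = mform_polys[OF u(1)]
  show thesis
  proof (rule that; (intro ballI impI)?)
    show "u * (g * a0) \<in> Sforms m" by (rule u(5)[OF sd])
    show "u * (g * f0) \<in> Sforms m" "m \<ge> 1" by (rule u(4), rule u(3))
    show "u * (g * f0) \<notin> P" by (rule prime_mult_notin[OF PD(1) uS polys_mult[OF gS f0S] u(2) gf])
    fix P' assume P': "P' \<in> points X.Z" "u * (g * f0) \<notin> P'"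
    note PP' = X.points_ZD[OF P'(1)]
    note PD' = multiproj_pointsD[OF PP']
    have n: "u \<notin> P'" "g \<notin> P'" "f0 \<notin> P'"
      using P'(2) by (auto simp: primeidealD_poly(3)[OF PD'(1)] uS gS f0S polys_mult)
    have nz: "u \<noteq> 0" "g \<noteq> 0" using prime_notin_nonzero[OF PD'(1)] n by auto
    have PV: "P' \<in> preimage V" using g(3) P'(1) n(2) PP' by (auto simp: basic_open_def)
    moreover have "s P' = X.cls P' a0 f0" using f0(3) PV n(3) by blast
    ultimately show "P' \<in> preimage V \<and> s P' = X.cls P' (u * (g * a0)) (u * (g * f0))"
      by (simp add: X.cls_expand nz)
  qed
qed

text \<open>
  If \<open>s = a / f\<close> where \<open>f\<close> does not vanish then \<open>s = \<sigma> a / \<sigma> f\<close> where \<open>\<sigma> f\<close> does not vanish. After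
  replacing \<open>a / f\<close> by \<open>a f\<^sup>K / f\<^sup>K\<^sup>+\<^sup>1\<close> these fractions agree on the level of numerators, so they glue
  to \<open>(\<Sum>\<^sub>\<sigma> b\<^sub>\<sigma> \<sigma> a) / (\<Sum>\<^sub>\<sigma> b\<^sub>\<sigma> \<sigma> f)\<close>. The \<open>b\<^sub>\<sigma>\<close> can be chosen such that the denominator is symmetric,
  and the numerator can then be symmetrised.
\<close>

lemma local_descent:
  assumes V: "openin (undertop Y.Z) V" and s: "s \<in> sects X.Z (preimage V)"
    and inv: "\<And>\<sigma>. \<sigma> permutes {1..n} \<Longrightarrow> pull X.Z (act \<sigma>) (preimage V) s = s" and Q: "Q \<in> V"
  obtains \<alpha> H where "Rsame \<alpha> H" "H \<notin> Q"
    "\<forall>P\<in>points X.Z. esym n H \<notin> P \<longrightarrow> s P = X.cls P (esym n \<alpha>) (esym n H)"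
proof -
  let ?S = "{\<sigma>. \<sigma> permutes {1..n}}"
  have finS: "finite ?S" by (intro finite_permutations) simp
  have "Q \<in> points Y.Z" using Q openin_subset[OF V] by blast
  then obtain P where P: "P \<in> points X.Z" "esym_pt n P = Q" by (rule point_over)
  note PP = X.points_ZD[OF P(1)]
  note PD = multiproj_pointsD[OF PP]
  have PV: "P \<in> preimage V" using P Q by (simp add: preimage_def)
  obtain a f m where af: "a \<in> Sforms m" "f \<in> Sforms m" "m \<ge> 1" "f \<notin> P"
    "\<forall>P'\<in>points X.Z. f \<notin> P' \<longrightarrow> P' \<in> preimage V \<and> s P' = X.cls P' a f"
    by (rule local_fraction[OF V s PV])
  let ?a = "\<lambda>\<sigma>. perm_vars \<sigma> a" and ?f = "\<lambda>\<sigma>. perm_vars \<sigma> f"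
  have sd: "Ssame (?a \<sigma>) (?f \<sigma>)" if "\<sigma> permutes {1..n}" for \<sigma>
    by (rule same_degI[OF perm_vars_udeg[OF that af(1)] perm_vars_udeg[OF that af(2)]])
  have rep: "P' \<in> preimage V \<and> s P' = X.cls P' (?a \<sigma>) (?f \<sigma>)"
    if \<sigma>: "\<sigma> permutes {1..n}" and P': "P' \<in> points X.Z" "?f \<sigma> \<notin> P'" for \<sigma> P'
  proof -
    have "f \<notin> perm_pt n \<sigma> P'" using P'(2) notin_perm_pt[OF multiforms_polys[OF af(2)]] by blast
    then have "perm_pt n \<sigma> P' \<in> preimage V \<and> s (perm_pt n \<sigma> P') = X.cls (perm_pt n \<sigma> P') a f"
      using af(5) perm_pt_points[OF \<sigma> P'(1)] by blast
    then show ?thesis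
      using section_act[OF \<sigma> inv[OF \<sigma>] P'(1) same_degI[OF af(1,2)] P'(2)] by blast
  qed
  have "\<exists>k. (?f \<sigma> * ?f \<tau>) ^ k * (?a \<sigma> * ?f \<tau> - ?a \<tau> * ?f \<sigma>) \<in> AX"
    if \<sigma>: "\<sigma> permutes {1..n}" and \<tau>: "\<tau> permutes {1..n}" for \<sigma> \<tau>
  proof -
    have ff: "?f \<sigma> * ?f \<tau> \<in> Sforms (m + m)"
      using multiforms_mult[OF perm_vars_udeg[OF \<sigma> af(2)] perm_vars_udeg[OF \<tau> af(2)]] unfolding udeg_add .
    have mm: "m + m \<ge> 1" using af(3) by simp
    have "X.cls P' (?a \<sigma>) (?f \<sigma>) = X.cls P' (?a \<tau>) (?f \<tau>)"
      if "P' \<in> points X.Z" "?f \<sigma> \<notin> P'" "?f \<tau> \<notin> P'" for P'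
      using rep[OF \<sigma> that(1,2)] rep[OF \<tau> that(1,3)] by simp
    then show ?thesis using kill_difference[OF sd[OF \<sigma>] sd[OF \<tau>] ff mm] by blast
  qed
  then obtain k where k: "\<And>\<sigma> \<tau>. \<sigma> permutes {1..n} \<Longrightarrow> \<tau> permutes {1..n} \<Longrightarrow>
      (?f \<sigma> * ?f \<tau>) ^ k \<sigma> \<tau> * (?a \<sigma> * ?f \<tau> - ?a \<tau> * ?f \<sigma>) \<in> AX"
    by metis
  \<comment> \<open>One exponent that works for all pairs of permutations at once.\<close>
  define K where "K = (\<Sum>\<sigma>\<in>?S. \<Sum>\<tau>\<in>?S. k \<sigma> \<tau>)"
  have kK: "k \<sigma> \<tau> \<le> K" if "\<sigma> permutes {1..n}" "\<tau> permutes {1..n}" for \<sigma> \<tau>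
  proof -
    have "k \<sigma> \<tau> \<le> (\<Sum>\<tau>\<in>?S. k \<sigma> \<tau>)" using that finS by (intro member_le_sum) auto
    also have "\<dots> \<le> K" unfolding K_def using that finS by (intro member_le_sum) auto
    finally show ?thesis .
  qed
  define f' where "f' = f ^ Suc K"
  define a' where "a' = f ^ K * a"
  define m' where "m' = Suc K * m"
  have f'_form: "f' \<in> Sforms m'"
  proof -
    have "f' \<in> multiforms {1..n} (\<lambda>_. 1) (\<lambda>i. Suc K * udeg {1..n} m i)"
      unfolding f'_def by (rule multiforms_power[OF af(2)])
    also have "(\<lambda>i. Suc K * udeg {1..n} m i) = udeg {1..n} m'" by (auto simp: udeg_def m'_def)
    finally show ?thesis .
  qed
  have a'_form: "a' \<in> Sforms m'"
  proof -
    have "a' \<in> multiforms {1..n} (\<lambda>_. 1) (\<lambda>i. K * udeg {1..n} m i + udeg {1..n} m i)"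
      unfolding a'_def by (rule multiforms_mult[OF multiforms_power[OF af(2)] af(1)])
    also have "(\<lambda>i. K * udeg {1..n} m i + udeg {1..n} m i) = udeg {1..n} m'" by (auto simp: udeg_def m'_def)
    finally show ?thesis .
  qed
  let ?A = "\<lambda>\<sigma>. perm_vars \<sigma> a'" and ?F = "\<lambda>\<sigma>. perm_vars \<sigma> f'"
  have FA: "?F \<sigma> = ?f \<sigma> ^ K * ?f \<sigma>" "?A \<sigma> = ?f \<sigma> ^ K * ?a \<sigma>" for \<sigma>
    by (simp_all only: f'_def a'_def perm_vars.hom_mult perm_vars.hom_power power_Suc2)
  have glue: "?A \<sigma> * ?F \<tau> - ?A \<tau> * ?F \<sigma> \<in> AX" if \<sigma>: "\<sigma> permutes {1..n}" and \<tau>: "\<tau> permutes {1..n}" for \<sigma> \<tau>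
  proof -
    have "?A \<sigma> * ?F \<tau> - ?A \<tau> * ?F \<sigma> = (?f \<sigma> * ?f \<tau>) ^ K * (?a \<sigma> * ?f \<tau> - ?a \<tau> * ?f \<sigma>)"
      by (simp only: FA power_mult_distrib right_diff_distrib mult_ac)
    also have "K = (K - k \<sigma> \<tau>) + k \<sigma> \<tau>" using kK[OF \<sigma> \<tau>] by simp
    also have "(?f \<sigma> * ?f \<tau>) ^ ((K - k \<sigma> \<tau>) + k \<sigma> \<tau>) * (?a \<sigma> * ?f \<tau> - ?a \<tau> * ?f \<sigma>) =
        (?f \<sigma> * ?f \<tau>) ^ (K - k \<sigma> \<tau>) * ((?f \<sigma> * ?f \<tau>) ^ k \<sigma> \<tau> * (?a \<sigma> * ?f \<tau> - ?a \<tau> * ?f \<sigma>))"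
      by (simp only: power_add mult.assoc)
    also have "\<dots> \<in> AX"
      by (rule poly_idealD(4)[OF ideal_AX k[OF \<sigma> \<tau>]])
        (intro polys_power polys_mult same_deg_polys(2)[OF sd[OF \<sigma>]] same_deg_polys(2)[OF sd[OF \<tau>]])
    finally show ?thesis .
  qed
  have "f' \<notin> P" unfolding f'_def by (rule prime_power[OF PD(1) multiforms_polys[OF af(2)] af(4)])
  then obtain b M H where b: "\<And>\<tau>. \<tau> permutes {1..n} \<Longrightarrow> b \<tau> \<in> Sforms M"
    "H \<in> multiforms {1} (\<lambda>_. n) (udeg {1} (M + m'))"
    "esym n H = (\<Sum>\<tau> | \<tau> permutes {1..n}. b \<tau> * ?F \<tau>)" "esym n H \<notin> P"
    using invariant_denominator[OF PP f'_form] by blast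
  have H_inv: "perm_vars \<rho> (esym n H) = esym n H" if "\<rho> permutes {1..n}" for \<rho>
    by (rule perm_vars_esym[OF that multiforms_polys[OF b(2)]])
  define B where "B = (\<Sum>\<sigma> | \<sigma> permutes {1..n}. b \<sigma> * ?A \<sigma>)"
  have "B \<in> Sforms (M + m')"
    unfolding B_def udeg_add[symmetric]
    by (intro multiforms_sum multiforms_mult) (use b(1) perm_vars_udeg[OF _ a'_form] in auto)
  then have "(\<Sum>\<rho> | \<rho> permutes {1..n}. perm_vars \<rho> B) \<in> sym_img n (M + m')" by (rule sym_img_symmetrised)
  then obtain \<beta> where \<beta>: "\<beta> \<in> multiforms {1} (\<lambda>_. n) (udeg {1} (M + m'))"
    "(\<Sum>\<rho> | \<rho> permutes {1..n}. perm_vars \<rho> B) = esym n \<beta>" by (auto simp: sym_img_def)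
  define \<alpha> where "\<alpha> = Cst (1 / fact n) * \<beta>"
  have \<alpha>H: "Rsame \<alpha> H" unfolding \<alpha>_def by (rule same_degI[OF multiforms_Cst_mult[OF \<beta>(1)] b(2)])
  have num: "?A \<tau> * esym n H - esym n \<alpha> * ?F \<tau> \<in> AX" if \<tau>: "\<tau> permutes {1..n}" for \<tau>
  proof -
    \<comment> \<open>\<open>H\<close> is invariant, so applying \<open>\<rho>\<close> to the
      expressions for \<open>H\<close> and \<open>B\<close> shows that every conjugate of
      \<open>B\<close> is as good a numerator over \<open>H\<close> as \<open>B\<close>. Hence so is
      their average.\<close>
    have "?A \<tau> * esym n H - perm_vars \<rho> B * ?F \<tau> \<in> AX" if \<rho>: "\<rho> permutes {1..n}" for \<rho>
    proof -
      interpret p: graded_hom "perm_vars \<rho> :: 'k mpoly \<Rightarrow> _" "{1..n}" "\<lambda>_. 1" "{1..n}" "\<lambda>_. 1" "\<lambda>d i. d (\<rho> i)"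
        by (rule graded_hom_perm_vars[OF \<rho>])
      have cF: "perm_vars \<rho> (?F \<sigma>) = ?F (\<sigma> \<circ> \<rho>)" "perm_vars \<rho> (?A \<sigma>) = ?A (\<sigma> \<circ> \<rho>)" if "\<sigma> \<in> ?S" for \<sigma>
        using that by (simp_all add: perm_vars_comp[OF \<rho>])
      have "esym n H = perm_vars \<rho> (\<Sum>\<sigma> | \<sigma> permutes {1..n}. b \<sigma> * ?F \<sigma>)"
        by (simp only: b(3)[symmetric] H_inv[OF \<rho>])
      also have "\<dots> = (\<Sum>\<sigma> | \<sigma> permutes {1..n}. perm_vars \<rho> (b \<sigma>) * ?F (\<sigma> \<circ> \<rho>))"
        unfolding perm_vars.hom_sum perm_vars.hom_mult by (intro sum.cong refl arg_cong2[of _ _ _ _ "(*)"] cF(1))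
      finally have H: "esym n H = (\<Sum>\<sigma> | \<sigma> permutes {1..n}. perm_vars \<rho> (b \<sigma>) * ?F (\<sigma> \<circ> \<rho>))" .
      have B: "perm_vars \<rho> B = (\<Sum>\<sigma> | \<sigma> permutes {1..n}. perm_vars \<rho> (b \<sigma>) * ?A (\<sigma> \<circ> \<rho>))"
        unfolding B_def perm_vars.hom_sum perm_vars.hom_mult
        by (intro sum.cong refl arg_cong2[of _ _ _ _ "(*)"] cF(2))
      have "?A \<tau> * esym n H - perm_vars \<rho> B * ?F \<tau> =
          (\<Sum>\<sigma> | \<sigma> permutes {1..n}. perm_vars \<rho> (b \<sigma>) * (?A \<tau> * ?F (\<sigma> \<circ> \<rho>) - ?A (\<sigma> \<circ> \<rho>) * ?F \<tau>))"
        unfolding H B sum_distrib_left sum_distrib_right sum_subtractf[symmetric]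
        by (intro sum.cong refl) (simp only: right_diff_distrib mult_ac)
      also have "\<dots> \<in> AX"
      proof (rule poly_ideal_sum[OF ideal_AX])
        fix \<sigma> assume "\<sigma> \<in> ?S"
        then have \<sigma>: "\<sigma> permutes {1..n}" by simp
        show "perm_vars \<rho> (b \<sigma>) * (?A \<tau> * ?F (\<sigma> \<circ> \<rho>) - ?A (\<sigma> \<circ> \<rho>) * ?F \<tau>) \<in> AX"
          by (rule poly_idealD(4)[OF ideal_AX glue[OF \<tau> permutes_compose[OF \<rho> \<sigma>]]
                p.hom_polys[OF multiforms_polys[OF b(1)[OF \<sigma>]]]])
      qed
      finally show ?thesis .
    qed
    then have "(\<Sum>\<rho>\<in>?S. ?A \<tau> * esym n H - perm_vars \<rho> B * ?F \<tau>) \<in> AX"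
      by (intro poly_ideal_sum[OF ideal_AX]) simp
    then have "Cst (1 / fact n) * (\<Sum>\<rho>\<in>?S. ?A \<tau> * esym n H - perm_vars \<rho> B * ?F \<tau>) \<in> AX"
      by (rule poly_idealD(4)[OF ideal_AX _ polys_Cst])
    also have "(\<Sum>\<rho>\<in>?S. ?A \<tau> * esym n H - perm_vars \<rho> B * ?F \<tau>) =
        (\<Sum>\<rho>\<in>?S. ?A \<tau> * perm_vars \<rho> (esym n H) - perm_vars \<rho> B * ?F \<tau>)"
      by (intro sum.cong refl) (simp add: H_inv)
    also have "\<dots> = ?A \<tau> * (\<Sum>\<rho>\<in>?S. perm_vars \<rho> (esym n H)) - esym n \<beta> * ?F \<tau>"
      by (simp only: sum_subtractf sum_distrib_left[symmetric] sum_distrib_right[symmetric] \<beta>(2))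
    also have "Cst (1 / fact n) * (?A \<tau> * (\<Sum>\<rho>\<in>?S. perm_vars \<rho> (esym n H)) - esym n \<beta> * ?F \<tau>) =
        ?A \<tau> * (Cst (1 / fact n) * (\<Sum>\<rho>\<in>?S. perm_vars \<rho> (esym n H))) - esym n \<alpha> * ?F \<tau>"
      by (simp only: \<alpha>_def esym.hom_mult esym.hom_Cst right_diff_distrib mult_ac)
    also have "Cst (1 / fact n) * (\<Sum>\<rho>\<in>?S. perm_vars \<rho> (esym n H)) = esym n H"
      by (rule sum_perm_vars_const[OF H_inv])
    finally show ?thesis .
  qed
  show thesis
  proof (rule that[OF \<alpha>H]; (intro ballI impI)?)
    show "H \<notin> Q" using b(4) unfolding P(2)[symmetric] esym_pt_def by blast
    fix P' assume P': "P' \<in> points X.Z" "esym n H \<notin> P'"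
    note PP' = X.points_ZD[OF P'(1)]
    note PD' = multiproj_pointsD[OF PP']
    have "(\<Sum>\<tau> | \<tau> permutes {1..n}. b \<tau> * ?F \<tau>) \<notin> P'" using P'(2) unfolding b(3) .
    then obtain \<tau> where \<tau>: "\<tau> permutes {1..n}" "?F \<tau> \<notin> P'"
      using notin_sum_perm[where b = b and w = ?F, OF PD'(3) multiforms_polys[OF b(1)]] by blast
    have fS: "?f \<tau> \<in> Spolys" by (rule same_deg_polys(2)[OF sd[OF \<tau>(1)]])
    have f: "?f \<tau> \<notin> P'"
      using \<tau>(2) poly_idealD(4)[OF PD'(3) _ polys_power[OF fS]] unfolding FA by blast
    have "s P' = X.cls P' (?a \<tau>) (?f \<tau>)" using rep[OF \<tau>(1) P'(1) f] by blast
    also have "\<dots> = X.cls P' (?A \<tau>) (?F \<tau>)"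
      unfolding FA
      by (rule X.cls_expand[symmetric]) (use prime_notin_nonzero[OF PD'(1) prime_power[OF PD'(1) fS f]] in blast)
    also have "\<dots> = X.cls P' (esym n \<alpha>) (esym n H)"
    proof -
      \<comment> \<open>The relation holds in \<open>AX\<close> itself after the passage to
        \<open>f'\<close> and \<open>a'\<close>, so the multiplier can be 1.\<close>
      have "1 * (?A \<tau> * esym n H - esym n \<alpha> * ?F \<tau>) \<in> AX" using num[OF \<tau>(1)] by simp
      then show ?thesis
        using X.cls_eq_iff[OF PP' same_degI[OF perm_vars_udeg[OF \<tau>(1) a'_form] perm_vars_udeg[OF \<tau>(1) f'_form]] \<tau>(2)
            E.same_deg_hom[OF \<alpha>H] P'(2)] mformI[OF multiforms_1] primeidealD_poly(2)[OF PD'(1)] by blast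
    qed
    finally show "s P' = X.cls P' (esym n \<alpha>) (esym n H)" .
  qed
qed

text \<open>The local fractions define one section because any two of them agree after pullback to a
  point above, and such equalities descend by \<open>cls_esym_inj\<close>.\<close>

lemma invariant_section_descends:
  assumes V: "openin (undertop Y.Z) V" and s: "s \<in> sects X.Z (preimage V)"
    and inv: "\<And>\<sigma>. \<sigma> permutes {1..n} \<Longrightarrow> pull X.Z (act \<sigma>) (preimage V) s = s"
  obtains t where "t \<in> sects Y.Z V" "pull X.Z proj V t = s"
proof -
  have VY: "V \<subseteq> points Y.Z" by (rule openin_subset[OF V])
  have "\<exists>\<alpha> H. Rsame \<alpha> H \<and> H \<notin> Q \<and>
      (\<forall>P\<in>points X.Z. esym n H \<notin> P \<longrightarrow> s P = X.cls P (esym n \<alpha>) (esym n H))" if Q: "Q \<in> V" for Q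
  proof -
    obtain \<alpha> H where "Rsame \<alpha> H" "H \<notin> Q"
      "\<forall>P\<in>points X.Z. esym n H \<notin> P \<longrightarrow> s P = X.cls P (esym n \<alpha>) (esym n H)"
      by (rule local_descent[OF V s inv Q])
    then show ?thesis by blast
  qed
  then obtain \<alpha> H where *: "\<And>Q. Q \<in> V \<Longrightarrow> Rsame (\<alpha> Q) (H Q)" "\<And>Q. Q \<in> V \<Longrightarrow> H Q \<notin> Q"
    "\<And>Q P. Q \<in> V \<Longrightarrow> P \<in> points X.Z \<Longrightarrow> esym n (H Q) \<notin> P \<Longrightarrow> s P = X.cls P (esym n (\<alpha> Q)) (esym n (H Q))"
    by metis
  define t where "t = (\<lambda>Q\<in>V. Y.cls Q (\<alpha> Q) (H Q))"
  have notin: "esym n h \<notin> P" if "h \<notin> esym_pt n P" "Rsame a h" for a h P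
    using that same_deg_polys(2)[OF that(2)] by (simp add: esym_pt_def)
  have t: "t \<in> sects Y.Z V"
    unfolding Y.sects_Z[OF VY]
  proof (intro conjI ballI)
    show "t \<in> extensional V" by (simp add: t_def)
    fix Q assume Q: "Q \<in> V"
    \<comment> \<open>At \<open>Q'\<close> the section was defined by the fraction chosen for
      \<open>Q'\<close>; over \<open>Q'\<close> both fractions represent \<open>s\<close>.\<close>
    have "t Q' = Y.cls Q' (\<alpha> Q) (H Q)" if Q': "Q' \<in> V" "H Q \<notin> Q'" for Q'
    proof -
      obtain P where P: "P \<in> points X.Z" "esym_pt n P = Q'" using point_over VY Q'(1) by blast
      have 1: "esym n (H Q) \<notin> P" using notin[OF _ *(1)[OF Q]] Q'(2) P(2) by blast
      have 2: "esym n (H Q') \<notin> P" using notin[OF _ *(1)[OF Q'(1)]] *(2)[OF Q'(1)] P(2) by blast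
      have "X.cls P (esym n (\<alpha> Q')) (esym n (H Q')) = X.cls P (esym n (\<alpha> Q)) (esym n (H Q))"
        using *(3)[OF Q P(1) 1] *(3)[OF Q'(1) P(1) 2] by simp
      from cls_esym_inj[OF X.points_ZD[OF P(1)] *(1)[OF Q'(1)] 2 *(1)[OF Q] 1 this]
      show ?thesis using Q'(1) by (simp add: t_def P(2))
    qed
    then show "\<exists>a f. Rsame a f \<and> f \<notin> Q \<and> (\<forall>Q'\<in>V. f \<notin> Q' \<longrightarrow> t Q' = Y.cls Q' a f)"
      using *(1,2)[OF Q] by blast
  qed
  have "pull X.Z proj V t = s"
  proof (rule extensionalityI[of _ "preimage V"])
    show "pull X.Z proj V t \<in> extensional (preimage V)" by (simp add: pull_def preim_proj)
    show "s \<in> extensional (preimage V)" using s unfolding X.sects_Z[OF preimage_subset] by blast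
    fix P assume P: "P \<in> preimage V"
    then have PX: "P \<in> points X.Z" and Q: "esym_pt n P \<in> V" by (auto simp: preimage_def)
    have h: "esym n (H (esym_pt n P)) \<notin> P" by (rule notin[OF *(2)[OF Q] *(1)[OF Q]])
    have "pull X.Z proj V t P = X.cls P (esym n (\<alpha> (esym_pt n P))) (esym n (H (esym_pt n P)))"
      by (rule pull_proj[OF P _ *(1)[OF Q] h]) (simp add: t_def Q)
    also have "\<dots> = s P" by (rule *(3)[OF Q PX h, symmetric])
    finally show "pull X.Z proj V t P = s P" .
  qed
  then show thesis using that t by blast
qed

subsection \<open>The orbit space\<close>

definition fibre :: "'k mpoly set \<Rightarrow> 'k mpoly set set" where
  "fibre Q = {P \<in> points X.Z. esym_pt n P = Q}"

lemma orbit_fibre: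
  assumes P: "P \<in> points X.Z"
  shows "orbit_of (sym_group n) act P = fibre (esym_pt n P)"
proof (intro equalityI subsetI)
  fix P' assume "P' \<in> orbit_of (sym_group n) act P"
  then obtain \<sigma> where \<sigma>: "\<sigma> permutes {1..n}" "P' = perm_pt n \<sigma> P"
    by (auto simp: orbit_of_def sym_group_carrier pt_act)
  then show "P' \<in> fibre (esym_pt n P)"
    using perm_pt_points[OF \<sigma>(1) P] by (simp add: fibre_def esym_pt_perm_pt[OF n_pos])
next
  fix P' assume "P' \<in> fibre (esym_pt n P)"
  then have P': "P' \<in> points X.Z" "esym_pt n P = esym_pt n P'" by (auto simp: fibre_def)
  obtain \<sigma> where \<sigma>: "\<sigma> permutes {1..n}" "P' = perm_pt n \<sigma> P"
    by (rule esym_pt_fibre[OF n_pos X.points_ZD[OF P] X.points_ZD[OF P'(1)] P'(2)])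
  then show "P' \<in> orbit_of (sym_group n) act P"
    by (auto simp: orbit_of_def sym_group_carrier pt_act)
qed

lemma orbits: "orbit_of (sym_group n) act ` points X.Z = fibre ` points Y.Z"
proof -
  have "orbit_of (sym_group n) act ` points X.Z = (\<lambda>P. fibre (esym_pt n P)) ` points X.Z"
    by (rule image_cong[OF refl orbit_fibre])
  also have "\<dots> = fibre ` (esym_pt n ` points X.Z)" by (simp only: image_image)
  also have "esym_pt n ` points X.Z = points Y.Z"
  proof (intro equalityI subsetI)
    fix Q assume "Q \<in> points Y.Z"
    then obtain P where "P \<in> points X.Z" "esym_pt n P = Q" by (rule point_over)
    then show "Q \<in> esym_pt n ` points X.Z" by blast
  qed (auto simp: esym_pt_points)
  finally show ?thesis .
qed

lemma Union_fibre: "\<Union> (fibre ` W) = preimage W"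
  by (auto simp: fibre_def preimage_def)

lemma fibre_inj: "inj_on fibre (points Y.Z)"
proof (rule inj_onI)
  fix Q Q' assume "Q \<in> points Y.Z" "fibre Q = fibre Q'"
  moreover obtain P where "P \<in> points X.Z" "esym_pt n P = Q" by (rule point_over[OF \<open>Q \<in> points Y.Z\<close>])
  ultimately show "Q = Q'" by (auto simp: fibre_def)
qed

text \<open>\<open>topology\<close> is meaningful only for a predicate that satisfies the axioms.
  They are checked after the sets of orbits have been parametrised by sets of points of the
  target.\<close>

lemma openin_orbits:
  "openin (orbit_topology (sym_group n) act X.Z) U \<longleftrightarrow>
     (\<exists>W. U = fibre ` W \<and> openin (undertop Y.Z) W)"
proof -
  let ?op = "\<lambda>U. U \<subseteq> orbit_of (sym_group n) act ` points X.Z \<and> openin (undertop X.Z) (\<Union>U)"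
  have op: "?op U \<longleftrightarrow> (\<exists>W. U = fibre ` W \<and> openin (undertop Y.Z) W)" for U
  proof
    assume U: "?op U"
    then obtain W where W: "W \<subseteq> points Y.Z" "U = fibre ` W"
      unfolding orbits by (meson subset_imageE)
    have "openin (undertop X.Z) {P \<in> points X.Z. esym_pt n P \<in> W}"
      using U by (simp add: W(2) Union_fibre preimage_def)
    then show "\<exists>W. U = fibre ` W \<and> openin (undertop Y.Z) W" using openin_image[OF W(1)] W(2) by blast
  next
    assume "\<exists>W. U = fibre ` W \<and> openin (undertop Y.Z) W"
    then obtain W where W: "U = fibre ` W" "openin (undertop Y.Z) W" by blast
    then show "?op U"
      unfolding orbits W(1) Union_fibre using openin_preimage[OF W(2)] openin_subset[OF W(2)] by blast
  qed
  have "istopology ?op"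
    unfolding istopology_def
  proof (intro conjI allI impI)
    fix S T assume S: "?op S" and T: "?op T"
    obtain V where V: "S = fibre ` V" "openin (undertop Y.Z) V" using op[THEN iffD1, OF S] by (elim exE conjE)
    obtain W where W: "T = fibre ` W" "openin (undertop Y.Z) W" using op[THEN iffD1, OF T] by (elim exE conjE)
    \<comment> \<open>Intersections commute with images because distinct points of the target have
      distinct fibres, none of which is empty.\<close>
    have "S \<inter> T = fibre ` (V \<inter> W)"
      unfolding V(1) W(1)
      by (rule inj_on_image_Int[OF fibre_inj openin_subset[OF V(2)] openin_subset[OF W(2)], symmetric])
    then have "?op (S \<inter> T)" using openin_Int[OF V(2) W(2)] by (intro op[THEN iffD2] exI conjI)
    then show "S \<inter> T \<subseteq> orbit_of (sym_group n) act ` points X.Z" "openin (undertop X.Z) (\<Union> (S \<inter> T))"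
      by (rule conjunct1, rule conjunct2)
  next
    fix \<K> assume K: "\<forall>U\<in>\<K>. ?op U"
    then show "\<Union>\<K> \<subseteq> orbit_of (sym_group n) act ` points X.Z" by blast
    have "\<Union> (\<Union>\<K>) = \<Union> ((\<lambda>U. \<Union>U) ` \<K>)" by blast
    moreover have "openin (undertop X.Z) (\<Union> ((\<lambda>U. \<Union>U) ` \<K>))"
      by (rule openin_Union) (use K in blast)
    ultimately show "openin (undertop X.Z) (\<Union> (\<Union>\<K>))" by (simp only:)
  qed
  then have "openin (orbit_topology (sym_group n) act X.Z) U \<longleftrightarrow> ?op U"
    unfolding orbit_topology_def by (simp add: topology_inverse')
  then show ?thesis by (simp only: op)
qed

lemma topspace_orbits: "topspace (orbit_topology (sym_group n) act X.Z) = fibre ` points Y.Z"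
proof
  show "fibre ` points Y.Z \<subseteq> topspace (orbit_topology (sym_group n) act X.Z)"
    by (rule openin_subset) (use openin_orbits in blast)
  show "topspace (orbit_topology (sym_group n) act X.Z) \<subseteq> fibre ` points Y.Z"
  proof -
    obtain W where W: "topspace (orbit_topology (sym_group n) act X.Z) = fibre ` W" "openin (undertop Y.Z) W"
      using openin_orbits[THEN iffD1, OF openin_topspace] by (elim exE conjE)
    show ?thesis unfolding W(1) by (rule image_mono[OF openin_subset[OF W(2)]])
  qed
qed

section \<open>The isomorphism from the orbit space to the hypersurface\<close>

lemma rpt_fibre:
  assumes "Q \<in> points Y.Z"
  shows "rpt (descended_map X.Z proj) (fibre Q) = Q"
proof -
  obtain P where "P \<in> points X.Z" "esym_pt n P = Q" by (rule point_over[OF assms])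
  then have "pt proj ` fibre Q = {Q}" by (auto simp: pt_proj fibre_def)
  then show ?thesis by (simp add: descended_map_def)
qed

lemma rpt_preimage:
  assumes "W \<subseteq> points Y.Z"
  shows "{x \<in> fibre ` points Y.Z. rpt (descended_map X.Z proj) x \<in> W} = fibre ` W"
  using assms by (auto simp: rpt_fibre)

lemma homeomorphic_orbits:
  "homeomorphic_map (orbit_topology (sym_group n) act X.Z) (undertop Y.Z) (rpt (descended_map X.Z proj))"
  unfolding homeomorphic_map_def quotient_map_def topspace_orbits
proof (intro conjI allI impI)
  show "rpt (descended_map X.Z proj) ` fibre ` points Y.Z = points Y.Z"
    by (simp add: image_image rpt_fibre)
  show "inj_on (rpt (descended_map X.Z proj)) (fibre ` points Y.Z)"
    by (rule inj_onI) (auto simp: rpt_fibre)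
  fix W assume W: "W \<subseteq> points Y.Z"
  show "openin (orbit_topology (sym_group n) act X.Z)
      {x \<in> fibre ` points Y.Z. rpt (descended_map X.Z proj) x \<in> W} = openin (undertop Y.Z) W"
    unfolding rpt_preimage[OF W] openin_orbits
  proof
    assume "\<exists>W'. fibre ` W = fibre ` W' \<and> openin (undertop Y.Z) W'"
    then obtain W' where W': "fibre ` W = fibre ` W'" "openin (undertop Y.Z) W'" by (elim exE conjE)
    have "W = W'" using inj_on_image_eq_iff[OF fibre_inj W openin_subset[OF W'(2)]] W'(1) by blast
    then show "openin (undertop Y.Z) W" using W'(2) by simp
  qed blast
qed

lemma pull_invariant:
  assumes V: "openin (undertop Y.Z) V" and s: "s \<in> sects Y.Z V" and \<sigma>: "\<sigma> permutes {1..n}"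
  shows "pull X.Z (act \<sigma>) (preimage V) (pull X.Z proj V s) = pull X.Z proj V s"
proof (rule extensionalityI[of _ "preimage V"])
  show "pull X.Z (act \<sigma>) (preimage V) (pull X.Z proj V s) \<in> extensional (preimage V)"
    by (simp add: pull_def preim_act[OF \<sigma>])
  show "pull X.Z proj V s \<in> extensional (preimage V)" by (simp add: pull_def preim_proj)
  fix P assume P: "P \<in> preimage V"
  then have PX: "P \<in> points X.Z" and Q: "esym_pt n P \<in> V" by (auto simp: preimage_def)
  note c = Y.sects_Z_carrier[OF openin_subset[OF V] s Q]
  show "pull X.Z (act \<sigma>) (preimage V) (pull X.Z proj V s) P = pull X.Z proj V s P"
    using P perm_pt_preimage(1)[OF \<sigma> P] germ_act_proj[OF \<sigma> X.points_ZD[OF PX] c]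
    by (simp add: pull_def preim_act[OF \<sigma>] preim_proj pt_act pt_proj esym_pt_perm_pt[OF n_pos \<sigma>])
qed

lemma germ_proj_ring_hom:
  "P \<in> points X.Z \<Longrightarrow> germ proj P \<in> Ring.ring_hom (stalk Y.Z (esym_pt n P)) (stalk X.Z P)"
  unfolding proj_ind using pi.germ_ind_ring_hom[OF X.points_ZD] by (simp only: pmap_esym)

text \<open>Pullback is a homomorphism germ by germ. It is injective by
  \<open>pull_proj_inj\<close>, and onto the invariant sections by
  \<open>invariant_section_descends\<close>.\<close>

lemma pull_ring_iso:
  assumes V: "openin (undertop Y.Z) V"
  shows "pull X.Z proj V \<in> ring_iso (section_ring Y.Z V)
    ((section_ring X.Z (preimage V))
      \<lparr>carrier := {s \<in> sects X.Z (preimage V). \<forall>g\<in>carrier (sym_group n). pull X.Z (act g) (preimage V) s = s}\<rparr>)"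
proof -
  have VY: "V \<subseteq> points Y.Z" by (rule openin_subset[OF V])
  have PV: "P \<in> points X.Z" "esym_pt n P \<in> V" if "P \<in> preimage V" for P
    using that by (auto simp: preimage_def)
  have carr: "s (esym_pt n P) \<in> carrier (stalk Y.Z (esym_pt n P))" if "s \<in> sects Y.Z V" "P \<in> preimage V" for s P
    by (rule Y.sects_Z_carrier[OF VY that(1) PV(2)[OF that(2)]])
  note hom = ring_hom_mult[OF germ_proj_ring_hom[OF PV(1)]] ring_hom_add[OF germ_proj_ring_hom[OF PV(1)]]
    ring_hom_one[OF germ_proj_ring_hom[OF PV(1)]]
  have sect: "pull X.Z proj V s \<in> sects X.Z (preimage V)" if "s \<in> sects Y.Z V" for s
    using pi.pull_sects[OF V that] by (simp only: proj_ind[symmetric] preim_proj)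
  let ?I = "{s \<in> sects X.Z (preimage V). \<forall>g\<in>carrier (sym_group n). pull X.Z (act g) (preimage V) s = s}"
  have "pull X.Z proj V \<in> Ring.ring_hom (section_ring Y.Z V) ((section_ring X.Z (preimage V))\<lparr>carrier := ?I\<rparr>)"
  proof (rule ring_hom_memI)
    fix s assume "s \<in> carrier (section_ring Y.Z V)"
    then have s: "s \<in> sects Y.Z V" by (simp add: section_ring_def)
    then show "pull X.Z proj V s \<in> carrier ((section_ring X.Z (preimage V))\<lparr>carrier := ?I\<rparr>)"
      using sect pull_invariant[OF V s] by (simp add: sym_group_carrier)
    fix t assume "t \<in> carrier (section_ring Y.Z V)"
    then have t: "t \<in> sects Y.Z V" by (simp add: section_ring_def)
    show "pull X.Z proj V (s \<otimes>\<^bsub>section_ring Y.Z V\<^esub> t) =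
        pull X.Z proj V s \<otimes>\<^bsub>(section_ring X.Z (preimage V))\<lparr>carrier := ?I\<rparr>\<^esub> pull X.Z proj V t"
      by (simp add: section_ring_def pull_def preim_proj pt_proj)
        (rule restrict_ext, simp add: PV hom carr s t)
    show "pull X.Z proj V (s \<oplus>\<^bsub>section_ring Y.Z V\<^esub> t) =
        pull X.Z proj V s \<oplus>\<^bsub>(section_ring X.Z (preimage V))\<lparr>carrier := ?I\<rparr>\<^esub> pull X.Z proj V t"
      by (simp add: section_ring_def pull_def preim_proj pt_proj)
        (rule restrict_ext, simp add: PV hom carr s t)
  next
    show "pull X.Z proj V \<one>\<^bsub>section_ring Y.Z V\<^esub> = \<one>\<^bsub>(section_ring X.Z (preimage V))\<lparr>carrier := ?I\<rparr>\<^esub>"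
      by (simp add: section_ring_def pull_def preim_proj pt_proj)
        (rule restrict_ext, simp add: PV hom)
  qed
  moreover have "bij_betw (pull X.Z proj V) (sects Y.Z V) ?I"
    unfolding bij_betw_def
  proof (intro conjI equalityI subsetI)
    show "inj_on (pull X.Z proj V) (sects Y.Z V)"
      by (rule inj_onI) (rule pull_proj_inj[OF VY])
    show "s \<in> ?I" if "s \<in> pull X.Z proj V ` sects Y.Z V" for s
      using that sect pull_invariant[OF V] by (auto simp: sym_group_carrier)
    show "s \<in> pull X.Z proj V ` sects Y.Z V" if sI: "s \<in> ?I" for s
    proof -
      have "s \<in> sects X.Z (preimage V)" "\<And>\<sigma>. \<sigma> permutes {1..n} \<Longrightarrow> pull X.Z (act \<sigma>) (preimage V) s = s"
        using sI by (auto simp: sym_group_carrier)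
      then obtain t where "t \<in> sects Y.Z V" "pull X.Z proj V t = s"
        by (rule invariant_section_descends[OF V])
      then show ?thesis by blast
    qed
  qed
  ultimately show ?thesis by (simp add: ring_iso_def section_ring_def)
qed

theorem quotient_morphism: "is_quotient_morphism (sym_group n) act X.Z Y.Z proj"
  unfolding is_quotient_morphism_def
proof (intro conjI acts_on_X invariant_proj)
  have scal: "germ proj P (scal Y.Z (esym_pt n P) c) = scal X.Z P c" if "P \<in> points X.Z" for P c
    using pi.germ_ind_scal[OF X.points_ZD[OF that]] by (simp only: proj_ind pmap_esym)
  have top: "rtop (quotient_space (sym_group n) act X.Z) = orbit_topology (sym_group n) act X.Z"
    "rtop (ringed_space_of Y.Z) = undertop Y.Z"
    by (simp_all add: quotient_space_def ringed_space_of_def)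
  show "rspace_iso (quotient_space (sym_group n) act X.Z) (ringed_space_of Y.Z) (descended_map X.Z proj)"
    unfolding rspace_iso_def top topspace_orbits Let_def
  proof (intro conjI allI impI homeomorphic_orbits)
    fix V assume V: "openin (undertop Y.Z) V"
    have VY: "V \<subseteq> points Y.Z" by (rule openin_subset[OF V])
    note U = rpt_preimage[OF VY]
    show "rpull (descended_map X.Z proj) V \<in> ring_iso (rsec (ringed_space_of Y.Z) V)
        (rsec (quotient_space (sym_group n) act X.Z)
          {p \<in> fibre ` points Y.Z. rpt (descended_map X.Z proj) p \<in> V})"
      unfolding U using pull_ring_iso[OF V]
      by (simp add: quotient_space_def ringed_space_of_def descended_map_def Union_fibre)
    show "rpull (descended_map X.Z proj) V (rscal (ringed_space_of Y.Z) V c) =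
        rscal (quotient_space (sym_group n) act X.Z)
          {p \<in> fibre ` points Y.Z. rpt (descended_map X.Z proj) p \<in> V} c" for c
      unfolding U
      by (simp add: quotient_space_def ringed_space_of_def descended_map_def Union_fibre pull_def preim_proj pt_proj)
        (rule restrict_ext, simp add: preimage_def scal)
    fix V' s
    assume *: "openin (undertop Y.Z) V' \<and> V' \<subseteq> V \<and> s \<in> carrier (rsec (ringed_space_of Y.Z) V)"
    then have U': "{p \<in> fibre ` points Y.Z. rpt (descended_map X.Z proj) p \<in> V'} = fibre ` V'"
      using VY by (intro rpt_preimage) blast
    show "rpull (descended_map X.Z proj) V' (rres (ringed_space_of Y.Z) V V' s) =
        rres (quotient_space (sym_group n) act X.Z)
          {p \<in> fibre ` points Y.Z. rpt (descended_map X.Z proj) p \<in> V}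
          {p \<in> fibre ` points Y.Z. rpt (descended_map X.Z proj) p \<in> V'}
          (rpull (descended_map X.Z proj) V s)"
      unfolding U U'
      using * by (auto simp: quotient_space_def ringed_space_of_def descended_map_def Union_fibre pull_def
          preim_proj pt_proj preimage_def fibre_def restrict_def fun_eq_iff)
  qed
qed

end

theorem theorem2p8:
  fixes n :: nat
  assumes "n \<ge> 1"
  shows "is_quotient_morphism (sym_group n) (X_action n)
           (X_scheme n :: ('k::{alg_closed_field, field_char_0}, 'k mpoly set, 'k mpoly fract set) lrspace)
           (disc_scheme n) (pi_tilde n)
       \<and> rspace_isomorphic
           (quotient_space (sym_group n) (X_action n)
             (X_scheme n :: ('k, 'k mpoly set, 'k mpoly fract set) lrspace))
           (ringed_space_of (disc_scheme n :: ('k, 'k mpoly set, 'k mpoly fract set) lrspace))"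
proof -
  obtain e where e: "(disc_poly n :: 'k mpoly) \<in> multiforms {1} (\<lambda>_. n) (udeg {1} e)"
    by (rule disc_poly_multiform[OF assms])
  interpret symmetric_hypersurface n "disc_poly n :: 'k mpoly" e
    by unfold_locales (rule assms, rule e)
  \<comment> \<open>The locale works with explicit multiples of \<open>D\<close>, the definition of
    the discriminant scheme with a generated ideal.\<close>
  have JY: "JY = disc_ideal n"
    by (simp only: JY_def AY_def disc_ideal_def[abs_def] principal_genideal[OF multiforms_polys[OF e]])
  have JX: "JX = X_ideal n"
    by (simp only: JX_def X_ideal_def JY)
  have X: "X.Z = X_scheme n"
    unfolding X.Z_def by (simp only: X_scheme_def JX P1_power_def)
  have Y: "Y.Z = disc_scheme n"
    unfolding Y.Z_def by (simp only: disc_scheme_def JY projective_space_def)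
  have maps: "act = X_action n" "proj = pi_tilde n"
    by (simp_all only: JX act_def[abs_def] X_action_def[abs_def] proj_def pi_tilde_def)
  have "is_quotient_morphism (sym_group n) (X_action n) (X_scheme n :: ('k, 'k mpoly set, 'k mpoly fract set) lrspace)
      (disc_scheme n) (pi_tilde n)"
    using quotient_morphism unfolding X Y maps .
  \<comment> \<open>The isomorphism is part of the quotient property, with
    \<open>descended_map\<close> as witness.\<close>
  then show ?thesis
    unfolding is_quotient_morphism_def rspace_isomorphic_def by blast
qed

end
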